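(* Let the obstacle $\psi$ be symmetric and radially decreasing, and suppose there is $u_0\in C_\psi$ with $\mathcal{E}(u_0)\le G(2)^2$. Then there exists a symmetric minimizer of $\mathcal{E}$ in $C_\psi$. Moreover, if $\psi$ is a symmetric cone obstacle, this minimizer is the unique symmetric critical point in $C_\psi$.
   Context: The elastic energy is $\mathcal{E}: W^{2,2}(0,1)\cap W_0^{1,2}(0,1)\to\mathbb{R}$, $\mathcal{E}(u)=\int_0^1 \frac{u''(x)^2}{(1+u'(x)^2)^{5/2}}\,dx$, where $W^{2,2}(0,1)\cap W_0^{1,2}(0,1)$ carries the norm $\|u\|=\|u''\|_{L^2}$; $D\mathcal{E}$ denotes its Fréchet derivative. Set $G(s)=\int_0^s (1+t^2)^{-5/4}\,dt$. Standing assumption on the obstacle: $\psi\in C([0,1])$, $\psi(0)<0$, $\psi(1)<0$, and there is $x_0\in(0,1)$ with $\psi(x_0)>0$. Set $C_\psi=\{u\in W^{2,2}(0,1)\cap W_0^{1,2}(0,1): u\ge\psi \text{ a.e.}\}$. A function $u$ on $[0,1]$ is symmetric if $u=u(1-\cdot)$. The obstacle $\psi$ is radially decreasing if it is a decreasing function of $|x-\frac12|$. It is a symmetric cone obstacle if it is symmetric and $\psi|_{[0,1/2]}$ is affine linear. A (constrained) critical point in $C_\psi$ is a function $u\in C_\psi$ with $D\mathcal{E}(u)(v-u)\ge0$ for all $v\in C_\psi$. *)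

theory Defs
  imports "HOL-Analysis.Analysis"
begin

section \<open>Sobolev spaces on the unit interval\<close>

text \<open>
  The definitions of weak derivative, \<open>W\<^sup>1\<^sup>,\<^sup>2(0,1)\<close>, \<open>W\<^sup>2\<^sup>,\<^sup>2(0,1)\<close> and \<open>W\<^sub>0\<^sup>1\<^sup>,\<^sup>2(0,1)\<close> are those of
  Brezis, \<^emph>\<open>Functional Analysis, Sobolev Spaces and Partial Differential Equations\<close>, Chapter 8;
  in particular the test functions are the \<open>C\<^sup>1\<close> functions with compact support in \<open>(0,1)\<close>.
\<close>

abbreviation M01 :: "real measure" where
  "M01 \<equiv> lebesgue_on {0<..<1}"

definition L2 :: "(real \<Rightarrow> real) set" where
  "L2 = {f. f \<in> borel_measurable M01 \<and> integrable M01 (\<lambda>x. (f x)\<^sup>2)}"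

definition norm_L2 :: "(real \<Rightarrow> real) \<Rightarrow> real" where
  "norm_L2 f = sqrt (LINT x|M01. (f x)\<^sup>2)"

definition test_functions :: "(real \<Rightarrow> real) set" where
  "test_functions = {\<phi>. \<phi> C1_differentiable_on UNIV \<and>
     (\<exists>K. compact K \<and> K \<subseteq> {0<..<1} \<and> (\<forall>x. x \<notin> K \<longrightarrow> \<phi> x = 0))}"

definition has_weak_deriv :: "(real \<Rightarrow> real) \<Rightarrow> (real \<Rightarrow> real) \<Rightarrow> bool" where
  "has_weak_deriv u g \<longleftrightarrow> g \<in> L2 \<and>
     (\<forall>\<phi>\<in>test_functions. (LINT x|M01. u x * deriv \<phi> x) = - (LINT x|M01. g x * \<phi> x))"

text \<open>Weak derivatives are unique only up to null sets; see \<open>weak_deriv_AE\<close> below.\<close>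

definition weak_deriv :: "(real \<Rightarrow> real) \<Rightarrow> real \<Rightarrow> real" where
  "weak_deriv u = (SOME g. has_weak_deriv u g)"

definition W12 :: "(real \<Rightarrow> real) set" where
  "W12 = {u \<in> L2. \<exists>g. has_weak_deriv u g}"

definition W22 :: "(real \<Rightarrow> real) set" where
  "W22 = {u \<in> W12. weak_deriv u \<in> W12}"

definition norm_W12 :: "(real \<Rightarrow> real) \<Rightarrow> real" where
  "norm_W12 u = sqrt ((norm_L2 u)\<^sup>2 + (norm_L2 (weak_deriv u))\<^sup>2)"

definition W12_0 :: "(real \<Rightarrow> real) set" where
  "W12_0 = {u \<in> W12. \<forall>\<epsilon>>0. \<exists>\<phi>\<in>test_functions. norm_W12 (\<lambda>x. u x - \<phi> x) < \<epsilon>}"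


subsection \<open>Square-integrable functions\<close>

lemma finite_M01: "finite_measure M01"
  by (simp add: finite_measure_lebesgue_on)

interpretation M01: finite_measure M01
  by (rule finite_M01)

lemma L2_measurable: "f \<in> L2 \<Longrightarrow> f \<in> borel_measurable M01"
  and L2_integrable_sq: "f \<in> L2 \<Longrightarrow> integrable M01 (\<lambda>x. (f x)\<^sup>2)"
  by (auto simp: L2_def)

lemma L2_integrable_mult:
  assumes "f \<in> L2" "g \<in> L2"
  shows "integrable M01 (\<lambda>x. f x * g x)"
proof (rule Bochner_Integration.integrable_bound)
  show "integrable M01 (\<lambda>x. (f x)\<^sup>2 + (g x)\<^sup>2)"
    using assms by (intro Bochner_Integration.integrable_add L2_integrable_sq)
  show "(\<lambda>x. f x * g x) \<in> borel_measurable M01"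
    using assms[THEN L2_measurable] by measurable
  have "\<bar>a * b\<bar> \<le> a\<^sup>2 + b\<^sup>2" for a b :: real
  proof -
    have "2 * (\<bar>a\<bar> * \<bar>b\<bar>) \<le> a\<^sup>2 + b\<^sup>2"
      using sum_squares_bound[of "\<bar>a\<bar>" "\<bar>b\<bar>"] by (simp add: mult.assoc)
    moreover have "0 \<le> \<bar>a\<bar> * \<bar>b\<bar>" by simp
    ultimately show ?thesis unfolding abs_mult by linarith
  qed
  then show "AE x in M01. norm (f x * g x) \<le> norm ((f x)\<^sup>2 + (g x)\<^sup>2)"
    by (intro AE_I2) (auto intro: order_trans[OF _ abs_ge_self])
qed

lemma L2_lincomb:
  assumes "f \<in> L2" "g \<in> L2"
  shows "(\<lambda>x. a * f x + b * g x) \<in> L2"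
proof -
  have "integrable M01 (\<lambda>x. a\<^sup>2 * (f x)\<^sup>2 + 2 * a * b * (f x * g x) + b\<^sup>2 * (g x)\<^sup>2)"
    using assms
    by (intro Bochner_Integration.integrable_add integrable_mult_right L2_integrable_sq
          L2_integrable_mult)
  moreover have "(\<lambda>x. a\<^sup>2 * (f x)\<^sup>2 + 2 * a * b * (f x * g x) + b\<^sup>2 * (g x)\<^sup>2)
      = (\<lambda>x. (a * f x + b * g x)\<^sup>2)"
    by (auto simp: power2_eq_square algebra_simps)
  moreover have "(\<lambda>x. a * f x + b * g x) \<in> borel_measurable M01"
    using assms[THEN L2_measurable] by measurable
  ultimately show ?thesis by (simp add: L2_def)
qed

lemma L2_zero: "(\<lambda>x. 0) \<in> L2"
  by (simp add: L2_def)

lemma L2_one: "(\<lambda>x. 1) \<in> L2"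
  by (simp add: L2_def)

lemma norm_L2_nonneg: "0 \<le> norm_L2 f"
  by (simp add: norm_L2_def)

lemma norm_L2_sq: "(norm_L2 f)\<^sup>2 = (LINT x|M01. (f x)\<^sup>2)"
  by (simp add: norm_L2_def)

lemma norm_L2_eq_0:
  assumes "f \<in> L2"
  shows "norm_L2 f = 0 \<longleftrightarrow> (AE x in M01. f x = 0)"
  using integral_nonneg_eq_0_iff_AE[OF L2_integrable_sq[OF assms]]
  by (simp add: norm_L2_def)

lemma norm_L2_cong:
  assumes "f \<in> L2" "g \<in> L2" "AE x in M01. f x = g x"
  shows "norm_L2 f = norm_L2 g"
  unfolding norm_L2_def
  using assms L2_integrable_sq[THEN borel_measurable_integrable]
  by (intro arg_cong[of _ _ sqrt] integral_cong_AE) auto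

lemma norm_L2_lincomb_sq:
  assumes "f \<in> L2" "g \<in> L2"
  shows "(norm_L2 (\<lambda>x. f x + t * g x))\<^sup>2
    = (norm_L2 f)\<^sup>2 + 2 * t * (LINT x|M01. f x * g x) + t\<^sup>2 * (norm_L2 g)\<^sup>2"
proof -
  note i = L2_integrable_sq[OF assms(1)] L2_integrable_mult[OF assms] L2_integrable_sq[OF assms(2)]
  have "(norm_L2 (\<lambda>x. f x + t * g x))\<^sup>2
      = (LINT x|M01. (f x)\<^sup>2 + 2 * t * (f x * g x) + t\<^sup>2 * (g x)\<^sup>2)"
    unfolding norm_L2_sq
    by (intro Bochner_Integration.integral_cong) (auto simp: power2_eq_square algebra_simps)
  also have "\<dots> = (norm_L2 f)\<^sup>2 + 2 * t * (LINT x|M01. f x * g x) + t\<^sup>2 * (norm_L2 g)\<^sup>2"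
    unfolding norm_L2_sq using i by simp
  finally show ?thesis .
qed

lemma L2_Cauchy_Schwarz:
  assumes "f \<in> L2" "g \<in> L2"
  shows "\<bar>LINT x|M01. f x * g x\<bar> \<le> norm_L2 f * norm_L2 g"
proof -
  define A B C where "A = (norm_L2 f)\<^sup>2" and "B = (LINT x|M01. f x * g x)" and "C = (norm_L2 g)\<^sup>2"
  have *: "0 \<le> A + 2 * t * B + t\<^sup>2 * C" for t
    using norm_L2_lincomb_sq[OF assms, of t] zero_le_power2[of "norm_L2 (\<lambda>x. f x + t * g x)"]
    by (simp add: A_def B_def C_def)
  have "B\<^sup>2 \<le> A * C"
  proof (cases "C = 0")
    case True
    have "B = 0"
    proof (rule ccontr)
      assume "B \<noteq> 0"
      then have "2 * (- (A + 1) / (2 * B)) * B = - (A + 1)"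
        by simp
      then show False using *[of "- (A + 1) / (2 * B)"] True by simp
    qed
    then show ?thesis using True by simp
  next
    case False
    then have "C > 0" by (simp add: C_def)
    have "0 \<le> A - B\<^sup>2 / C"
      using *[of "- B / C"] \<open>C > 0\<close> by (simp add: power2_eq_square)
    then show ?thesis using \<open>C > 0\<close> by (simp add: field_simps)
  qed
  also have "A * C = (norm_L2 f * norm_L2 g)\<^sup>2"
    by (simp add: A_def C_def power_mult_distrib)
  finally have "\<bar>B\<bar> \<le> \<bar>norm_L2 f * norm_L2 g\<bar>"
    by (simp add: abs_le_square_iff)
  then show ?thesis
    by (simp add: B_def abs_mult norm_L2_nonneg)
qed

lemma norm_L2_triangle:
  assumes "f \<in> L2" "g \<in> L2"
  shows "norm_L2 (\<lambda>x. f x + g x) \<le> norm_L2 f + norm_L2 g"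
proof (rule power2_le_imp_le)
  have "(norm_L2 (\<lambda>x. f x + g x))\<^sup>2
      = (norm_L2 f)\<^sup>2 + 2 * (LINT x|M01. f x * g x) + (norm_L2 g)\<^sup>2"
    using norm_L2_lincomb_sq[OF assms, of 1] by simp
  also have "\<dots> \<le> (norm_L2 f)\<^sup>2 + 2 * (norm_L2 f * norm_L2 g) + (norm_L2 g)\<^sup>2"
    using L2_Cauchy_Schwarz[OF assms] by simp
  also have "\<dots> = (norm_L2 f + norm_L2 g)\<^sup>2"
    by (simp add: power2_sum)
  finally show "(norm_L2 (\<lambda>x. f x + g x))\<^sup>2 \<le> (norm_L2 f + norm_L2 g)\<^sup>2" .
qed (simp add: norm_L2_nonneg)

lemma norm_L2_scale: "norm_L2 (\<lambda>x. a * f x) = \<bar>a\<bar> * norm_L2 f"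
  by (simp add: norm_L2_def power_mult_distrib real_sqrt_mult)


subsection \<open>Test functions\<close>

lemma continuous_M01:
  fixes f :: "real \<Rightarrow> real"
  assumes "continuous_on {0..1} f"
  shows "f \<in> borel_measurable M01" "integrable M01 f"
proof -
  show m: "f \<in> borel_measurable M01"
    using assms by (intro continuous_imp_measurable_on_sets_lebesgue)
      (auto intro: continuous_on_subset)
  have "bounded (f ` {0..1})"
    using assms by (intro compact_imp_bounded compact_continuous_image) auto
  then obtain B where "\<forall>y\<in>f ` {0..1}. norm y \<le> B"
    unfolding bounded_iff by blast
  then show "integrable M01 f"
    using m by (intro M01.integrable_const_bound[where B = B] AE_I2) auto
qed

lemma continuous_L2: "continuous_on {0..1} f \<Longrightarrow> f \<in> L2"
  by (simp add: L2_def continuous_M01 continuous_on_power)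

lemma test_functionsD:
  assumes "\<phi> \<in> test_functions"
  shows "(\<phi> has_real_derivative deriv \<phi> x) (at x)"
    and "continuous_on A (deriv \<phi>)" "continuous_on A \<phi>"
    and "\<phi> 0 = 0" "\<phi> 1 = 0"
proof -
  obtain D where D: "\<And>x. (\<phi> has_real_derivative D x) (at x)" "continuous_on UNIV D"
    using assms
    by (auto simp: test_functions_def C1_differentiable_on_def
        has_real_derivative_iff_has_vector_derivative)
  have eq: "deriv \<phi> = D"
    using D(1) by (auto intro: DERIV_imp_deriv)
  show d: "(\<phi> has_real_derivative deriv \<phi> x) (at x)" for x
    using D eq by simp
  show "continuous_on A (deriv \<phi>)"
    using continuous_on_subset[OF D(2), of A] eq by simp
  show "continuous_on A \<phi>"
    using d by (intro continuous_at_imp_continuous_on ballI DERIV_isCont)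
  show "\<phi> 0 = 0" "\<phi> 1 = 0"
    using assms by (force simp: test_functions_def)+
qed

lemma test_functions_L2: "\<phi> \<in> test_functions \<Longrightarrow> \<phi> \<in> L2"
  and deriv_test_functions_L2: "\<phi> \<in> test_functions \<Longrightarrow> deriv \<phi> \<in> L2"
  by (simp_all add: continuous_L2 test_functionsD)

lemma test_functionsI:
  assumes "\<And>x. (\<phi> has_real_derivative D x) (at x)" "continuous_on UNIV D"
    and "compact K" "K \<subseteq> {0<..<1}" "\<And>x. x \<notin> K \<Longrightarrow> \<phi> x = 0"
  shows "\<phi> \<in> test_functions"
  using assms
  by (auto simp: test_functions_def C1_differentiable_on_def
      has_real_derivative_iff_has_vector_derivative)

lemma test_functions_lincomb:
  assumes "\<phi> \<in> test_functions" "\<psi> \<in> test_functions"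
  shows "(\<lambda>x. a * \<phi> x + b * \<psi> x) \<in> test_functions"
    and "deriv (\<lambda>x. a * \<phi> x + b * \<psi> x) = (\<lambda>x. a * deriv \<phi> x + b * deriv \<psi> x)"
proof -
  obtain K L where K: "compact K" "K \<subseteq> {0<..<1}" "\<And>x. x \<notin> K \<Longrightarrow> \<phi> x = 0"
    and L: "compact L" "L \<subseteq> {0<..<1}" "\<And>x. x \<notin> L \<Longrightarrow> \<psi> x = 0"
    using assms by (auto simp: test_functions_def)
  have d: "((\<lambda>x. a * \<phi> x + b * \<psi> x) has_real_derivative a * deriv \<phi> x + b * deriv \<psi> x) (at x)" for x
    using assms by (auto intro!: derivative_eq_intros test_functionsD(1))
  show "(\<lambda>x. a * \<phi> x + b * \<psi> x) \<in> test_functions"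
  proof (rule test_functionsI[OF d])
    show "continuous_on UNIV (\<lambda>x. a * deriv \<phi> x + b * deriv \<psi> x)"
      using assms by (intro continuous_intros test_functionsD(2))
    show "compact (K \<union> L)" "K \<union> L \<subseteq> {0<..<1}"
      using K L by auto
    show "a * \<phi> x + b * \<psi> x = 0" if "x \<notin> K \<union> L" for x
      using K L that by simp
  qed
  show "deriv (\<lambda>x. a * \<phi> x + b * \<psi> x) = (\<lambda>x. a * deriv \<phi> x + b * deriv \<psi> x)"
    using d by (auto intro: DERIV_imp_deriv)
qed

lemma test_functions_mult:
  assumes "\<phi> \<in> test_functions" and g: "\<And>x. (g has_real_derivative g' x) (at x)" "continuous_on UNIV g'"
  shows "(\<lambda>x. g x * \<phi> x) \<in> test_functions"
    and "deriv (\<lambda>x. g x * \<phi> x) = (\<lambda>x. g x * deriv \<phi> x + g' x * \<phi> x)"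
proof -
  obtain K where K: "compact K" "K \<subseteq> {0<..<1}" "\<And>x. x \<notin> K \<Longrightarrow> \<phi> x = 0"
    using assms by (auto simp: test_functions_def)
  have c: "continuous_on UNIV g"
    using g by (intro continuous_at_imp_continuous_on ballI DERIV_isCont)
  have d: "((\<lambda>x. g x * \<phi> x) has_real_derivative g x * deriv \<phi> x + g' x * \<phi> x) (at x)" for x
    using assms by (auto intro!: derivative_eq_intros test_functionsD(1))
  show "(\<lambda>x. g x * \<phi> x) \<in> test_functions"
  proof (rule test_functionsI[OF d])
    show "continuous_on UNIV (\<lambda>x. g x * deriv \<phi> x + g' x * \<phi> x)"
      using assms c by (intro continuous_intros test_functionsD(2,3)[OF assms(1)])
    show "g x * \<phi> x = 0" if "x \<notin> K" for x
      using K that by simp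
  qed (fact K)+
  show "deriv (\<lambda>x. g x * \<phi> x) = (\<lambda>x. g x * deriv \<phi> x + g' x * \<phi> x)"
    using d by (auto intro: DERIV_imp_deriv)
qed

lemma integral_deriv_test_function:
  assumes "\<phi> \<in> test_functions"
  shows "(LINT x|M01. deriv \<phi> x) = 0"
proof -
  have "(deriv \<phi> has_integral \<phi> 1 - \<phi> 0) {0..1}"
    using test_functionsD(1)[OF assms]
    by (intro fundamental_theorem_of_calculus)
      (auto simp: has_real_derivative_iff_has_vector_derivative
        intro: has_vector_derivative_at_within)
  then have "integral {0..1} (deriv \<phi>) = 0"
    using test_functionsD[OF assms] by (simp add: integral_unique)
  moreover have "(LINT x|M01. deriv \<phi> x) = integral {0<..<1} (deriv \<phi>)"
    using assms by (intro lebesgue_integral_eq_integral continuous_M01 test_functionsD) auto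
  ultimately show ?thesis
    by (simp add: integral_open_interval_real)
qed

lemma integral_by_parts_test_functions:
  assumes "\<phi> \<in> test_functions" "\<psi> \<in> test_functions"
  shows "(LINT x|M01. \<phi> x * deriv \<psi> x) = - (LINT x|M01. deriv \<phi> x * \<psi> x)"
proof -
  note m = test_functions_mult[OF assms(2) test_functionsD(1)[OF assms(1)] test_functionsD(2)[OF assms(1)]]
  have "(LINT x|M01. \<phi> x * deriv \<psi> x + deriv \<phi> x * \<psi> x) = 0"
    using integral_deriv_test_function[OF m(1)] m(2) by simp
  moreover have "(LINT x|M01. \<phi> x * deriv \<psi> x + deriv \<phi> x * \<psi> x)
      = (LINT x|M01. \<phi> x * deriv \<psi> x) + (LINT x|M01. deriv \<phi> x * \<psi> x)"
    using assms by (intro Bochner_Integration.integral_add L2_integrable_mult test_functions_L2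
        deriv_test_functions_L2)
  ultimately show ?thesis by simp
qed

lemma has_weak_deriv_test_function:
  "\<phi> \<in> test_functions \<Longrightarrow> has_weak_deriv \<phi> (deriv \<phi>)"
  by (simp add: has_weak_deriv_def deriv_test_functions_L2 integral_by_parts_test_functions)


subsection \<open>The fundamental lemma\<close>

definition smooth_step :: "real \<Rightarrow> real" where
  "smooth_step y = (max 0 y)\<^sup>2 / (1 + (max 0 y)\<^sup>2)"

lemma smooth_step_deriv:
  "(smooth_step has_real_derivative 2 * max 0 y / (1 + (max 0 y)\<^sup>2)\<^sup>2) (at y)"
proof -
  have p: "((\<lambda>y::real. (max 0 y)\<^sup>2) has_real_derivative 2 * max 0 y) (at y)"
  proof (cases y "0::real" rule: linorder_cases)
    case less
    have "((\<lambda>y::real. 0) has_real_derivative 2 * max 0 y) (at y)"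
      using less by (auto intro!: derivative_eq_intros)
    then show ?thesis
      by (rule DERIV_cong_ev[THEN iffD1, rotated -1])
        (use less in \<open>auto intro!: eventually_mono[OF eventually_nhds_in_open[of "{..<0}"]]\<close>)
  next
    case greater
    have "((\<lambda>y::real. y\<^sup>2) has_real_derivative 2 * max 0 y) (at y)"
      using greater by (auto intro!: derivative_eq_intros)
    then show ?thesis
      by (rule DERIV_cong_ev[THEN iffD1, rotated -1])
        (use greater in \<open>auto intro!: eventually_mono[OF eventually_nhds_in_open[of "{0<..}"]]\<close>)
  next
    case equal
    have "(\<lambda>h::real. (max 0 h)\<^sup>2 / h) \<midarrow>0\<rightarrow> 0"
    proof (rule Lim_null_comparison)
      show "\<forall>\<^sub>F h::real in at 0. norm ((max 0 h)\<^sup>2 / h) \<le> \<bar>h\<bar>"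
        by (auto simp: max_def power2_eq_square intro!: always_eventually)
      show "(\<lambda>h::real. \<bar>h\<bar>) \<midarrow>0\<rightarrow> 0"
        by (intro tendsto_rabs_zero tendsto_ident_at)
    qed
    then show ?thesis using equal by (simp add: DERIV_def)
  qed
  have "1 + (max 0 y)\<^sup>2 \<noteq> 0"
    by (smt (verit) zero_le_power2)
  then have "((\<lambda>y. (max 0 y)\<^sup>2 / (1 + (max 0 y)\<^sup>2)) has_real_derivative
      (2 * max 0 y * (1 + (max 0 y)\<^sup>2) - (max 0 y)\<^sup>2 * (0 + 2 * max 0 y))
        / ((1 + (max 0 y)\<^sup>2) * (1 + (max 0 y)\<^sup>2))) (at y)"
    by (intro DERIV_divide DERIV_add DERIV_const p)
  moreover have "(2 * m * (1 + m\<^sup>2) - m\<^sup>2 * (0 + 2 * m)) / ((1 + m\<^sup>2) * (1 + m\<^sup>2))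
      = 2 * m / (1 + m\<^sup>2)\<^sup>2" for m :: real
    by (simp add: power2_eq_square algebra_simps)
  ultimately show ?thesis
    unfolding smooth_step_def by metis
qed

lemma smooth_step_bounds: "0 \<le> smooth_step y" "smooth_step y \<le> 1"
  unfolding smooth_step_def by (auto simp: divide_le_eq add_pos_nonneg)

lemma smooth_step_neg: "y \<le> 0 \<Longrightarrow> smooth_step y = 0"
  by (simp add: smooth_step_def)

lemma smooth_step_tendsto: "(smooth_step \<longlongrightarrow> 1) at_top"
proof -
  have "((\<lambda>y::real. 1 - 1 / (1 + y\<^sup>2)) \<longlongrightarrow> 1 - 0) at_top"
    by (intro tendsto_diff tendsto_const tendsto_divide_0[OF tendsto_const]
        filterlim_at_top_imp_at_infinity filterlim_tendsto_add_at_top[OF tendsto_const]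
        filterlim_pow_at_top filterlim_ident) auto
  moreover have "\<forall>\<^sub>F y in at_top. 1 - 1 / (1 + y\<^sup>2) = smooth_step y"
    using eventually_gt_at_top[of 0]
  proof eventually_elim
    case (elim y)
    have "1 + y\<^sup>2 \<noteq> 0" by (smt (verit) zero_le_power2)
    with elim show ?case by (simp add: smooth_step_def field_simps)
  qed
  ultimately show ?thesis
    by (simp add: tendsto_cong)
qed

lemma bump_test_function:
  fixes a b t :: real
  assumes "0 \<le> a" "b \<le> 1" "0 < t"
  shows "(\<lambda>x. smooth_step (t * (x - a) - 1) * smooth_step (t * (b - x) - 1)) \<in> test_functions"
proof (rule test_functionsI)
  define s where "s y = 2 * max 0 y / (1 + (max 0 y)\<^sup>2)\<^sup>2" for y :: real
  have nz: "(1 + (max 0 y)\<^sup>2)\<^sup>2 \<noteq> (0::real)" for y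
    by (smt (verit) zero_le_power2 power_eq_0_iff)
  have cs: "continuous_on UNIV s"
    unfolding s_def using nz by (intro continuous_intros ballI)
  have s: "(smooth_step has_real_derivative s y) (at y)" for y
    unfolding s_def by (rule smooth_step_deriv)
  have c: "continuous_on UNIV smooth_step"
    using s by (intro continuous_at_imp_continuous_on ballI DERIV_isCont)
  show "((\<lambda>x. smooth_step (t * (x - a) - 1) * smooth_step (t * (b - x) - 1)) has_real_derivative
     s (t * (x - a) - 1) * t * smooth_step (t * (b - x) - 1)
     + - (s (t * (b - x) - 1) * t) * smooth_step (t * (x - a) - 1)) (at x)" for x
    by (auto intro!: derivative_eq_intros DERIV_chain2[OF s])
  show "continuous_on UNIV (\<lambda>x. s (t * (x - a) - 1) * t * smooth_step (t * (b - x) - 1)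
     + - (s (t * (b - x) - 1) * t) * smooth_step (t * (x - a) - 1))"
    by (intro continuous_intros continuous_on_compose2[OF cs] continuous_on_compose2[OF c]) auto
  show "compact {a + 1 / t..b - 1 / t}"
    by simp
  have "0 < 1 / t"
    using assms by simp
  then have "0 < x \<and> x < 1" if "a + 1 / t \<le> x \<and> x \<le> b - 1 / t" for x
    using that assms(1,2) by linarith
  then show "{a + 1 / t..b - 1 / t} \<subseteq> {0<..<1}"
    unfolding subset_iff atLeastAtMost_iff greaterThanLessThan_iff by blast
  show "smooth_step (t * (x - a) - 1) * smooth_step (t * (b - x) - 1) = 0"
    if "x \<notin> {a + 1 / t..b - 1 / t}" for x
    using that assms by (auto simp: field_simps not_le smooth_step_neg)
qed

lemma integral_interval_eq_0:
  fixes a b :: real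
  assumes g: "g \<in> L2" and 0: "\<And>\<phi>. \<phi> \<in> test_functions \<Longrightarrow> (LINT x|M01. g x * \<phi> x) = 0"
    and ab: "0 \<le> a" "b \<le> 1"
  shows "(LINT x|M01. indicator {a<..<b} x * g x) = 0"
proof -
  define \<phi> where "\<phi> n x = smooth_step (real (Suc n) * (x - a) - 1) * smooth_step (real (Suc n) * (b - x) - 1)"
    for n :: nat and x
  have t: "\<phi> n \<in> test_functions" for n
    unfolding \<phi>_def using ab by (intro bump_test_function) auto
  have gi: "integrable M01 g"
    using L2_integrable_mult[OF g L2_one] by simp
  have "(\<lambda>n. LINT x|M01. g x * \<phi> n x) \<longlonglongrightarrow> (LINT x|M01. indicator {a<..<b} x * g x)"
  proof (rule integral_dominated_convergence[where w = "\<lambda>x. \<bar>g x\<bar>"])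
    show "(\<lambda>x. indicator {a<..<b} x * g x) \<in> borel_measurable M01"
      using L2_measurable[OF g] ab
      by (intro borel_measurable_times borel_measurable_indicator)
        (auto simp: sets_restrict_space_iff)
    show "(\<lambda>x. g x * \<phi> n x) \<in> borel_measurable M01" for n
      using L2_measurable[OF g] L2_measurable[OF test_functions_L2[OF t]] by measurable
    show "integrable M01 (\<lambda>x. \<bar>g x\<bar>)"
      using gi by simp
    have "\<bar>\<phi> n x\<bar> \<le> 1" for n x
      unfolding \<phi>_def using smooth_step_bounds by (simp add: abs_mult mult_le_one)
    then show "AE x in M01. norm (g x * \<phi> n x) \<le> \<bar>g x\<bar>" for n
      by (intro AE_I2) (simp add: abs_mult mult_left_le)
    have lim: "(\<lambda>n. smooth_step (real (Suc n) * d - 1)) \<longlonglongrightarrow> 1" if "d > 0" for d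
    proof (rule filterlim_compose[OF smooth_step_tendsto])
      have "filterlim (\<lambda>n. real (Suc n)) at_top sequentially"
        by (rule filterlim_compose[OF filterlim_real_sequentially filterlim_Suc])
      then have "filterlim (\<lambda>n. d * real (Suc n)) at_top sequentially"
        using that by (intro filterlim_tendsto_pos_mult_at_top[OF tendsto_const])
      then have "filterlim (\<lambda>n. - 1 + d * real (Suc n)) at_top sequentially"
        by (intro filterlim_tendsto_add_at_top[OF tendsto_const])
      then show "filterlim (\<lambda>n. real (Suc n) * d - 1) at_top sequentially"
        by (simp add: mult.commute)
    qed
    have "(\<lambda>n. \<phi> n x) \<longlonglongrightarrow> indicator {a<..<b} x" for x
    proof (cases "x \<in> {a<..<b}")
      case True
      then have "(\<lambda>n. \<phi> n x) \<longlonglongrightarrow> 1 * 1"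
        unfolding \<phi>_def by (intro tendsto_mult lim) auto
      then show ?thesis using True by simp
    next
      case False
      then have "x - a \<le> 0 \<or> b - x \<le> 0"
        by auto
      then have "real (Suc n) * (x - a) - 1 \<le> 0 \<or> real (Suc n) * (b - x) - 1 \<le> 0" for n
        using mult_nonneg_nonpos[of "real (Suc n)" "x - a"] mult_nonneg_nonpos[of "real (Suc n)" "b - x"]
        by (smt (verit) of_nat_0_le_iff)
      then have "\<phi> n x = 0" for n
        using smooth_step_neg unfolding \<phi>_def by fastforce
      then show ?thesis using False by simp
    qed
    then have "(\<lambda>n. g x * \<phi> n x) \<longlonglongrightarrow> g x * indicator {a<..<b} x" for x
      by (rule tendsto_mult_left)
    then show "AE x in M01. (\<lambda>n. g x * \<phi> n x) \<longlonglongrightarrow> indicator {a<..<b} x * g x"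
      by (simp add: mult.commute)
  qed
  then show ?thesis
    using 0[OF t] by (simp add: LIMSEQ_const_iff)
qed

lemma fundamental_lemma:
  assumes g: "g \<in> L2" and 0: "\<And>\<phi>. \<phi> \<in> test_functions \<Longrightarrow> (LINT x|M01. g x * \<phi> x) = 0"
  shows "AE x in M01. g x = 0"
proof (rule M01.density_zero)
  show gi: "integrable M01 g"
    using L2_integrable_mult[OF g L2_one] by simp
  define E where "E = range (\<lambda>(a, b). {a<..<b::real})"
  have gen: "sets borel = sigma_sets UNIV E"
    unfolding E_def borel_eq_box[where 'a = real] box_real by simp
  have int: "integrable M01 (\<lambda>x. indicator B x * g x)" if "B \<in> sets lebesgue" for B
  proof -
    have "integrable M01 (\<lambda>x. indicator (B \<inter> {0<..<1}) x *\<^sub>R g x)"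
      using that by (intro integrable_mult_indicator gi) (auto simp: sets_restrict_space_iff)
    then show ?thesis
      by (rule Bochner_Integration.integrable_cong[THEN iffD1, rotated -1])
        (auto simp: indicator_def)
  qed
  have borel: "(LINT x|M01. indicator B x * g x) = 0" if "B \<in> sets borel" for B
  proof -
    have "Int_stable E"
      unfolding Int_stable_def E_def by auto
    moreover have "E \<subseteq> Pow UNIV" "B \<in> sigma_sets UNIV E"
      using that gen by auto
    ultimately
    show ?thesis
    proof (induction rule: sigma_sets_induct_disjoint)
      case (basic A)
      then obtain a b where A: "A = {a<..<b}" by (auto simp: E_def)
      have "(LINT x|M01. indicator A x * g x)
          = (LINT x|M01. indicator {max 0 a<..<min 1 b} x * g x)"
        unfolding A by (intro Bochner_Integration.integral_cong) (auto simp: indicator_def)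
      also have "\<dots> = 0"
        using g 0 by (intro integral_interval_eq_0) auto
      finally show ?case .
    next
      case empty
      then show ?case by simp
    next
      case (compl A)
      have A: "A \<in> sets lebesgue"
        using compl gen by auto
      have "(LINT x|M01. g x) = (LINT x|M01. indicator {0<..<1} x * g x)"
        by (intro Bochner_Integration.integral_cong) auto
      also have "\<dots> = 0"
        using g 0 by (intro integral_interval_eq_0) auto
      finally have "(LINT x|M01. g x) = 0" .
      moreover have "(LINT x|M01. indicator (UNIV - A) x * g x) = (LINT x|M01. g x - indicator A x * g x)"
        by (intro Bochner_Integration.integral_cong) (auto simp: indicator_def)
      ultimately show ?case
        using compl int[OF A] gi by simp
    next
      case (union A)
      have "A i \<in> sets borel" for i
        using union(2) gen by auto
      then have A: "A i \<in> sets lebesgue" for i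
        by auto
      have s: "(LINT x|M01. indicator (\<Union>i<n. A i) x * g x) = 0" for n
      proof (induction n)
        case (Suc n)
        have "A n \<inter> A i = {}" if "i < n" for i
          using union(1) that by (auto simp: disjoint_family_on_def)
        then have "A n \<inter> (\<Union>i<n. A i) = {}"
          by blast
        moreover have "(\<Union>i<Suc n. A i) = A n \<union> (\<Union>i<n. A i)"
          by (simp add: lessThan_Suc)
        ultimately have "indicator (\<Union>i<Suc n. A i) x = indicator (\<Union>i<n. A i) x + (indicator (A n) x :: real)" for x
          by (auto simp: indicator_def)
        then have "(LINT x|M01. indicator (\<Union>i<Suc n. A i) x * g x)
            = (LINT x|M01. indicator (\<Union>i<n. A i) x * g x + indicator (A n) x * g x)"
          by (simp add: algebra_simps)
        also have "\<dots> = 0"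
          using Suc union(3)[of n] int[OF A] int[of "\<Union>i<n. A i"] A by simp
        finally show ?case .
      qed simp
      have "(\<lambda>n. LINT x|M01. indicator (\<Union>i<n. A i) x * g x) \<longlonglongrightarrow> (LINT x|M01. indicator (\<Union>i. A i) x * g x)"
      proof (rule integral_dominated_convergence[where w = "\<lambda>x. \<bar>g x\<bar>"])
        show "AE x in M01. (\<lambda>n. indicator (\<Union>i<n. A i) x * g x) \<longlonglongrightarrow> indicator (\<Union>i. A i) x * g x"
          by (intro AE_I2 tendsto_mult tendsto_const LIMSEQ_indicator_UN)
        show "AE x in M01. norm (indicator (\<Union>i<n. A i) x * g x) \<le> \<bar>g x\<bar>" for n
          by (auto simp: indicator_def)
        show "integrable M01 (\<lambda>x. \<bar>g x\<bar>)"
          using gi by simp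
        show "(\<lambda>x. indicator (\<Union>i<n. A i) x * g x) \<in> borel_measurable M01" for n
          using int[of "\<Union>i<n. A i"] A by (intro borel_measurable_integrable) auto
        show "(\<lambda>x. indicator (\<Union>i. A i) x * g x) \<in> borel_measurable M01"
          using int[of "\<Union>i. A i"] A by (intro borel_measurable_integrable) auto
      qed
      then show ?case
        using s by (simp add: LIMSEQ_const_iff)
    qed
  qed
  fix A assume "A \<in> sets M01"
  then have A: "A \<in> sets lebesgue"
    by (auto simp: sets_restrict_space)
  obtain C T T' where CT: "A = C \<union> T" "T \<subseteq> T'" "T' \<in> null_sets lborel" "C \<in> sets lborel"
    by (rule sets_completionE[OF A])
  then have C: "C \<in> sets borel"
    by simp
  have "AE x in lebesgue. x \<notin> T"
    using AE_completion[OF AE_not_in[OF CT(3)]] CT(2) by (auto elim: eventually_mono)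
  then have ae: "AE x in M01. x \<notin> T"
    by (subst AE_restrict_space_iff) auto
  have "(LINT x|M01. indicator A x * g x) = (LINT x|M01. indicator C x * g x)"
    using int[OF A] int[of C] C ae CT(1)
    by (intro integral_cong_AE borel_measurable_integrable) (auto simp: indicator_def)
  then show "set_lebesgue_integral M01 A g = 0"
    using borel[OF C] by (simp add: set_lebesgue_integral_def)
qed


subsection \<open>Weak derivatives\<close>

lemma has_weak_deriv_unique:
  assumes "has_weak_deriv u g" "has_weak_deriv u h"
  shows "AE x in M01. g x = h x"
proof -
  have gh: "g \<in> L2" "h \<in> L2"
    using assms by (auto simp: has_weak_deriv_def)
  have "AE x in M01. 1 * g x + (-1) * h x = 0"
  proof (rule fundamental_lemma[OF L2_lincomb[OF gh]])
    fix \<phi> assume \<phi>: "\<phi> \<in> test_functions"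
    note i = L2_integrable_mult[OF gh(1) test_functions_L2[OF \<phi>]]
      L2_integrable_mult[OF gh(2) test_functions_L2[OF \<phi>]]
    have "(LINT x|M01. g x * \<phi> x) = (LINT x|M01. h x * \<phi> x)"
      using assms \<phi> by (force simp: has_weak_deriv_def)
    then show "(LINT x|M01. (1 * g x + (-1) * h x) * \<phi> x) = 0"
      using i by (simp add: algebra_simps)
  qed
  then show ?thesis by simp
qed

lemma weak_deriv_works: "has_weak_deriv u g \<Longrightarrow> has_weak_deriv u (weak_deriv u)"
  unfolding weak_deriv_def by (rule someI[of "has_weak_deriv u"])

lemma weak_deriv_AE: "has_weak_deriv u g \<Longrightarrow> AE x in M01. weak_deriv u x = g x"
  by (rule has_weak_deriv_unique[OF weak_deriv_works])

lemma W12_weak_deriv: "u \<in> W12 \<Longrightarrow> has_weak_deriv u (weak_deriv u)"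
  by (auto simp: W12_def intro: weak_deriv_works)

lemma W12_L2: "u \<in> W12 \<Longrightarrow> u \<in> L2" "u \<in> W12 \<Longrightarrow> weak_deriv u \<in> L2"
  using W12_weak_deriv by (auto simp: W12_def has_weak_deriv_def)

lemma has_weak_deriv_lincomb:
  assumes "u \<in> L2" "v \<in> L2" "has_weak_deriv u g" "has_weak_deriv v h"
  shows "has_weak_deriv (\<lambda>x. a * u x + b * v x) (\<lambda>x. a * g x + b * h x)"
  unfolding has_weak_deriv_def
proof (intro conjI ballI)
  have gh: "g \<in> L2" "h \<in> L2"
    using assms by (auto simp: has_weak_deriv_def)
  then show "(\<lambda>x. a * g x + b * h x) \<in> L2"
    by (rule L2_lincomb)
  fix \<phi> assume \<phi>: "\<phi> \<in> test_functions"
  have lin: "(LINT x|M01. (a * p x + b * q x) * r x)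
      = a * (LINT x|M01. p x * r x) + b * (LINT x|M01. q x * r x)"
    if "p \<in> L2" "q \<in> L2" "r \<in> L2" for p q r
    using L2_integrable_mult[OF that(1,3)] L2_integrable_mult[OF that(2,3)]
    by (simp add: distrib_right mult.assoc)
  show "(LINT x|M01. (a * u x + b * v x) * deriv \<phi> x) = - (LINT x|M01. (a * g x + b * h x) * \<phi> x)"
    using assms \<phi> gh
    by (simp add: lin test_functions_L2 deriv_test_functions_L2 has_weak_deriv_def)
qed

lemma has_weak_deriv_cong:
  assumes "u \<in> L2" "v \<in> L2" "AE x in M01. u x = v x" "has_weak_deriv u g"
  shows "has_weak_deriv v g"
  unfolding has_weak_deriv_def
proof (intro conjI ballI)
  show "g \<in> L2"
    using assms by (auto simp: has_weak_deriv_def)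
  fix \<phi> assume \<phi>: "\<phi> \<in> test_functions"
  have "(LINT x|M01. u x * deriv \<phi> x) = (LINT x|M01. v x * deriv \<phi> x)"
    using assms L2_integrable_mult[OF _ deriv_test_functions_L2[OF \<phi>]]
    by (intro integral_cong_AE borel_measurable_integrable) auto
  then show "(LINT x|M01. v x * deriv \<phi> x) = - (LINT x|M01. g x * \<phi> x)"
    using assms \<phi> by (simp add: has_weak_deriv_def)
qed

lemma W12_lincomb:
  assumes "u \<in> W12" "v \<in> W12"
  shows "(\<lambda>x. a * u x + b * v x) \<in> W12"
    and "AE x in M01. weak_deriv (\<lambda>x. a * u x + b * v x) x = a * weak_deriv u x + b * weak_deriv v x"
proof -
  have d: "has_weak_deriv (\<lambda>x. a * u x + b * v x) (\<lambda>x. a * weak_deriv u x + b * weak_deriv v x)"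
    using assms by (intro has_weak_deriv_lincomb W12_L2 W12_weak_deriv)
  show "(\<lambda>x. a * u x + b * v x) \<in> W12"
    using d L2_lincomb assms by (auto simp: W12_def)
  show "AE x in M01. weak_deriv (\<lambda>x. a * u x + b * v x) x = a * weak_deriv u x + b * weak_deriv v x"
    using d by (rule weak_deriv_AE)
qed

lemma W22_lincomb:
  assumes "u \<in> W22" "v \<in> W22"
  shows "(\<lambda>x. a * u x + b * v x) \<in> W22"
    and "AE x in M01. weak_deriv (weak_deriv (\<lambda>x. a * u x + b * v x)) x
      = a * weak_deriv (weak_deriv u) x + b * weak_deriv (weak_deriv v) x"
proof -
  let ?w = "\<lambda>x. a * u x + b * v x"
  let ?w' = "\<lambda>x. a * weak_deriv u x + b * weak_deriv v x"
  let ?w'' = "\<lambda>x. a * weak_deriv (weak_deriv u) x + b * weak_deriv (weak_deriv v) x"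
  have uv: "u \<in> W12" "v \<in> W12" "weak_deriv u \<in> W12" "weak_deriv v \<in> W12"
    using assms by (auto simp: W22_def)
  note w = W12_lincomb[OF uv(1,2), of a b]
  have "has_weak_deriv ?w' ?w''"
    using uv by (intro has_weak_deriv_lincomb W12_L2 W12_weak_deriv)
  moreover have "AE x in M01. ?w' x = weak_deriv ?w x"
    using w(2) by auto
  ultimately have d: "has_weak_deriv (weak_deriv ?w) ?w''"
    using uv w(1) by (intro has_weak_deriv_cong[of ?w' "weak_deriv ?w"] L2_lincomb W12_L2)
  then show "?w \<in> W22"
    using w(1) W12_L2(2)[OF w(1)] by (auto simp: W22_def W12_def)
  show "AE x in M01. weak_deriv (weak_deriv ?w) x = ?w'' x"
    using d by (rule weak_deriv_AE)
qed

lemma W22_D: "u \<in> W22 \<Longrightarrow> u \<in> W12" "u \<in> W22 \<Longrightarrow> weak_deriv u \<in> W12"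
  "u \<in> W22 \<Longrightarrow> weak_deriv (weak_deriv u) \<in> L2"
  by (auto simp: W22_def W12_L2)

lemma has_weak_deriv_zero: "has_weak_deriv (\<lambda>x. 0) (\<lambda>x. 0)"
  by (simp add: has_weak_deriv_def L2_zero)

lemma W12_zero: "(\<lambda>x. 0) \<in> W12"
  using has_weak_deriv_zero L2_zero by (auto simp: W12_def)

lemma W22_zero: "(\<lambda>x. 0) \<in> W22"
proof -
  have "has_weak_deriv (weak_deriv (\<lambda>x. 0)) (\<lambda>x. 0)"
    using weak_deriv_AE[OF has_weak_deriv_zero] W12_L2(2)[OF W12_zero]
    by (intro has_weak_deriv_cong[OF L2_zero _ _ has_weak_deriv_zero]) auto
  then show ?thesis
    using W12_zero W12_L2(2)[OF W12_zero] by (auto simp: W22_def W12_def)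
qed

lemma test_functions_W12: "\<phi> \<in> test_functions \<Longrightarrow> \<phi> \<in> W12"
  using has_weak_deriv_test_function test_functions_L2 by (auto simp: W12_def)

lemma test_functions_zero: "(\<lambda>x. 0) \<in> test_functions"
  by (rule test_functionsI[where D = "\<lambda>x. 0" and K = "{}"]) auto

lemma norm_W12_lincomb:
  assumes "u \<in> W12" "v \<in> W12"
  shows "norm_W12 (\<lambda>x. a * u x + b * v x) \<le> \<bar>a\<bar> * norm_W12 u + \<bar>b\<bar> * norm_W12 v"
proof -
  note w = W12_lincomb[OF assms, of a b]
  have lin: "norm_L2 (\<lambda>x. a * f x + b * g x) \<le> \<bar>a\<bar> * norm_L2 f + \<bar>b\<bar> * norm_L2 g"
    if "f \<in> L2" "g \<in> L2" for f g
    using norm_L2_triangle[of "\<lambda>x. a * f x" "\<lambda>x. b * g x"]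
      L2_lincomb[OF that, of a 0] L2_lincomb[OF that, of 0 b]
    by (simp add: norm_L2_scale)
  have "norm_L2 (weak_deriv (\<lambda>x. a * u x + b * v x))
      = norm_L2 (\<lambda>x. a * weak_deriv u x + b * weak_deriv v x)"
    using w assms by (intro norm_L2_cong L2_lincomb W12_L2)
  then have "norm_W12 (\<lambda>x. a * u x + b * v x)
      \<le> sqrt ((\<bar>a\<bar> * norm_L2 u + \<bar>b\<bar> * norm_L2 v)\<^sup>2
           + (\<bar>a\<bar> * norm_L2 (weak_deriv u) + \<bar>b\<bar> * norm_L2 (weak_deriv v))\<^sup>2)"
    using lin[of u v] lin[of "weak_deriv u" "weak_deriv v"] assms
    unfolding norm_W12_def
    by (intro real_sqrt_le_mono add_mono power_mono) (auto simp: W12_L2 norm_L2_nonneg)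
  also have "\<dots> \<le> sqrt ((\<bar>a\<bar> * norm_L2 u)\<^sup>2 + (\<bar>a\<bar> * norm_L2 (weak_deriv u))\<^sup>2)
      + sqrt ((\<bar>b\<bar> * norm_L2 v)\<^sup>2 + (\<bar>b\<bar> * norm_L2 (weak_deriv v))\<^sup>2)"
    by (rule real_sqrt_sum_squares_triangle_ineq)
  also have "\<dots> = \<bar>a\<bar> * norm_W12 u + \<bar>b\<bar> * norm_W12 v"
    by (simp add: norm_W12_def power_mult_distrib real_sqrt_mult flip: distrib_left)
  finally show ?thesis .
qed

lemma norm_W12_nonneg: "0 \<le> norm_W12 u"
  by (simp add: norm_W12_def)

lemma W12_0_zero: "(\<lambda>x. 0) \<in> W12_0"
proof -
  have "norm_L2 (weak_deriv (\<lambda>x. 0)) = 0"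
    using weak_deriv_AE[OF has_weak_deriv_zero]
    by (rule norm_L2_eq_0[THEN iffD2, OF W12_L2(2)[OF W12_zero]])
  moreover have "norm_L2 (\<lambda>x. 0) = 0"
    by (simp add: norm_L2_def)
  ultimately have "norm_W12 (\<lambda>x. 0 - 0) = 0"
    by (simp add: norm_W12_def)
  then have "\<exists>\<phi>\<in>test_functions. norm_W12 (\<lambda>x. 0 - \<phi> x) < \<epsilon>" if "\<epsilon> > 0" for \<epsilon>
    using that by (intro bexI[OF _ test_functions_zero]) simp
  then show ?thesis
    using W12_zero by (simp add: W12_0_def)
qed

lemma W12_0_lincomb:
  assumes "u \<in> W12_0" "v \<in> W12_0"
  shows "(\<lambda>x. a * u x + b * v x) \<in> W12_0"
  unfolding W12_0_def
proof (intro CollectI conjI allI impI)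
  have uv: "u \<in> W12" "v \<in> W12"
    using assms by (auto simp: W12_0_def)
  then show "(\<lambda>x. a * u x + b * v x) \<in> W12"
    by (rule W12_lincomb)
  fix \<epsilon> :: real assume "\<epsilon> > 0"
  define \<delta> where "\<delta> = \<epsilon> / (\<bar>a\<bar> + \<bar>b\<bar> + 1)"
  have \<delta>: "\<delta> > 0" "(\<bar>a\<bar> + \<bar>b\<bar>) * \<delta> < \<epsilon>"
    using \<open>\<epsilon> > 0\<close> by (auto simp: \<delta>_def field_simps add_pos_nonneg)
  obtain \<phi> \<psi> where *: "\<phi> \<in> test_functions" "norm_W12 (\<lambda>x. u x - \<phi> x) < \<delta>"
    "\<psi> \<in> test_functions" "norm_W12 (\<lambda>x. v x - \<psi> x) < \<delta>"
    using assms \<delta>(1) unfolding W12_0_def by blast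
  have w: "(\<lambda>x. u x - \<phi> x) \<in> W12" "(\<lambda>x. v x - \<psi> x) \<in> W12"
    using W12_lincomb(1)[of u \<phi> 1 "-1"] W12_lincomb(1)[of v \<psi> 1 "-1"] * uv
    by (auto simp: test_functions_W12)
  have "norm_W12 (\<lambda>x. (a * u x + b * v x) - (a * \<phi> x + b * \<psi> x))
      = norm_W12 (\<lambda>x. a * (u x - \<phi> x) + b * (v x - \<psi> x))"
    by (simp add: algebra_simps)
  also have "\<dots> \<le> \<bar>a\<bar> * norm_W12 (\<lambda>x. u x - \<phi> x) + \<bar>b\<bar> * norm_W12 (\<lambda>x. v x - \<psi> x)"
    using w by (rule norm_W12_lincomb)
  also have "\<dots> \<le> \<bar>a\<bar> * \<delta> + \<bar>b\<bar> * \<delta>"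
    using * by (intro add_mono mult_left_mono) auto
  also have "\<dots> < \<epsilon>"
    using \<delta>(2) by (simp add: algebra_simps)
  finally show "\<exists>\<phi>\<in>test_functions. norm_W12 (\<lambda>x. (a * u x + b * v x) - \<phi> x) < \<epsilon>"
    by (rule bexI[OF _ test_functions_lincomb(1)[OF *(1,3)]])
qed


subsection \<open>Definiteness of the seminorm \<open>norm_L2 (weak_deriv (weak_deriv u))\<close>\<close>

lemma test_function_Poincare:
  assumes \<phi>: "\<phi> \<in> test_functions"
  shows "norm_L2 \<phi> \<le> 2 * norm_L2 (deriv \<phi>)"
proof -
  have x: "((\<lambda>x::real. x) has_real_derivative 1) (at x)" for x
    by (auto intro!: derivative_eq_intros)
  note m = test_functions_mult[OF \<phi> x continuous_on_const]
  have L: "\<phi> \<in> L2" "deriv \<phi> \<in> L2" "(\<lambda>x. x * \<phi> x) \<in> L2"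
    using \<phi> m(1) by (auto simp: test_functions_L2 deriv_test_functions_L2)
  have "(LINT x|M01. \<phi> x * (x * deriv \<phi> x + 1 * \<phi> x)) = - (LINT x|M01. deriv \<phi> x * (x * \<phi> x))"
    using integral_by_parts_test_functions[OF \<phi> m(1)] m(2) by simp
  moreover have "(LINT x|M01. \<phi> x * (x * deriv \<phi> x + 1 * \<phi> x))
      = (LINT x|M01. deriv \<phi> x * (x * \<phi> x)) + (LINT x|M01. (\<phi> x)\<^sup>2)"
    using L2_integrable_mult[OF L(2,3)] L2_integrable_sq[OF L(1)]
    by (subst Bochner_Integration.integral_add[symmetric])
      (auto simp: power2_eq_square algebra_simps)
  ultimately have "(norm_L2 \<phi>)\<^sup>2 = - 2 * (LINT x|M01. deriv \<phi> x * (x * \<phi> x))"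
    by (simp add: norm_L2_sq)
  also have "\<dots> \<le> 2 * (norm_L2 (deriv \<phi>) * norm_L2 (\<lambda>x. x * \<phi> x))"
    using L2_Cauchy_Schwarz[OF L(2,3)] by simp
  also have "\<dots> \<le> 2 * (norm_L2 (deriv \<phi>) * norm_L2 \<phi>)"
  proof (intro mult_left_mono)
    have "(x * \<phi> x)\<^sup>2 \<le> (\<phi> x)\<^sup>2" if "x \<in> {0<..<1}" for x
      using that by (simp add: power_mult_distrib mult_left_le_one_le power_le_one)
    then show "norm_L2 (\<lambda>x. x * \<phi> x) \<le> norm_L2 \<phi>"
      unfolding norm_L2_def using L2_integrable_sq[OF L(1)] L2_integrable_sq[OF L(3)]
      by (intro real_sqrt_le_mono integral_mono) auto
  qed (auto simp: norm_L2_nonneg)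
  finally have "norm_L2 \<phi> * norm_L2 \<phi> \<le> (2 * norm_L2 (deriv \<phi>)) * norm_L2 \<phi>"
    by (simp add: power2_eq_square)
  then show ?thesis
    using norm_L2_nonneg[of \<phi>] norm_L2_nonneg[of "deriv \<phi>"]
    by (cases "norm_L2 \<phi> = 0") auto
qed

lemma W22_W12_0_definite:
  assumes u: "u \<in> W22" "u \<in> W12_0" and 0: "norm_L2 (weak_deriv (weak_deriv u)) = 0"
  shows "norm_L2 u = 0"
proof -
  let ?D = "weak_deriv u"
  have uW: "u \<in> W12" "?D \<in> W12"
    using u by (auto simp: W22_D)
  have L: "u \<in> L2" "?D \<in> L2" "weak_deriv ?D \<in> L2"
    using uW by (auto simp: W12_L2)
  have ortho: "(LINT x|M01. ?D x * deriv \<phi> x) = 0" if "\<phi> \<in> test_functions" for \<phi>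
  proof -
    have "\<bar>LINT x|M01. weak_deriv ?D x * \<phi> x\<bar> \<le> 0"
      using L2_Cauchy_Schwarz[OF L(3) test_functions_L2[OF that]] 0 by simp
    then show ?thesis
      using W12_weak_deriv[OF uW(2)] that by (simp add: has_weak_deriv_def)
  qed
  have approx: "\<exists>\<phi>\<in>test_functions. norm_L2 (\<lambda>x. u x - \<phi> x) < \<epsilon> \<and> norm_L2 (\<lambda>x. ?D x - deriv \<phi> x) < \<epsilon>"
    if "\<epsilon> > 0" for \<epsilon>
  proof -
    obtain \<phi> where \<phi>: "\<phi> \<in> test_functions" "norm_W12 (\<lambda>x. u x - \<phi> x) < \<epsilon>"
      using u(2) \<open>\<epsilon> > 0\<close> by (auto simp: W12_0_def)
    have "has_weak_deriv (\<lambda>x. 1 * u x + (-1) * \<phi> x) (\<lambda>x. 1 * ?D x + (-1) * deriv \<phi> x)"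
      using \<phi> L uW by (intro has_weak_deriv_lincomb has_weak_deriv_test_function W12_weak_deriv)
        (auto simp: test_functions_L2)
    then have d: "has_weak_deriv (\<lambda>x. u x - \<phi> x) (\<lambda>x. ?D x - deriv \<phi> x)"
      by simp
    have "norm_L2 (weak_deriv (\<lambda>x. u x - \<phi> x)) = norm_L2 (\<lambda>x. ?D x - deriv \<phi> x)"
      using d weak_deriv_works[OF d] weak_deriv_AE[OF d]
      by (intro norm_L2_cong) (auto simp: has_weak_deriv_def)
    moreover have "norm_L2 f \<le> norm_W12 f" "norm_L2 (weak_deriv f) \<le> norm_W12 f" for f
      by (auto simp: norm_W12_def norm_L2_nonneg real_le_rsqrt)
    ultimately show ?thesis
      using \<phi> by (metis order_le_less_trans)
  qed
  have D0: "norm_L2 ?D = 0"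
  proof (rule ccontr)
    assume "norm_L2 ?D \<noteq> 0"
    then have pos: "norm_L2 ?D > 0"
      using norm_L2_nonneg[of ?D] by simp
    obtain \<phi> where \<phi>: "\<phi> \<in> test_functions" "norm_L2 (\<lambda>x. ?D x - deriv \<phi> x) < norm_L2 ?D"
      using approx[OF pos] by auto
    have dL: "deriv \<phi> \<in> L2" "(\<lambda>x. ?D x - deriv \<phi> x) \<in> L2"
      using deriv_test_functions_L2[OF \<phi>(1)] L2_lincomb[OF L(2), of "deriv \<phi>" 1 "-1"] by auto
    have "(norm_L2 ?D)\<^sup>2 = (LINT x|M01. ?D x * (?D x - deriv \<phi> x))"
      using ortho[OF \<phi>(1)] L2_integrable_mult[OF L(2) dL(1)] L2_integrable_mult[OF L(2) L(2)]
      unfolding norm_L2_sq by (simp add: right_diff_distrib power2_eq_square)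
    also have "\<dots> \<le> norm_L2 ?D * norm_L2 (\<lambda>x. ?D x - deriv \<phi> x)"
      using L2_Cauchy_Schwarz[OF L(2) dL(2)] by simp
    also have "\<dots> < norm_L2 ?D * norm_L2 ?D"
      using \<phi>(2) pos by simp
    finally show False
      by (simp add: power2_eq_square)
  qed
  have "norm_L2 u \<le> \<epsilon>" if "\<epsilon> > 0" for \<epsilon>
  proof -
    have "\<epsilon> / 3 > 0"
      using that by simp
    from approx[OF this] obtain \<phi> where \<phi>: "\<phi> \<in> test_functions"
      "norm_L2 (\<lambda>x. u x - \<phi> x) < \<epsilon> / 3" "norm_L2 (\<lambda>x. ?D x - deriv \<phi> x) < \<epsilon> / 3"
      by blast
    have L': "\<phi> \<in> L2" "deriv \<phi> \<in> L2"
      using \<phi> by (auto simp: test_functions_L2 deriv_test_functions_L2)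
    have dL: "(\<lambda>x. ?D x - deriv \<phi> x) \<in> L2" "(\<lambda>x. u x - \<phi> x) \<in> L2"
      using L2_lincomb[OF L(2) L'(2), of 1 "-1"] L2_lincomb[OF L(1) L'(1), of 1 "-1"] by auto
    have "norm_L2 (deriv \<phi>) = norm_L2 (\<lambda>x. (-1) * (?D x - deriv \<phi> x) + ?D x)"
      by simp
    also have "\<dots> \<le> norm_L2 (\<lambda>x. (-1) * (?D x - deriv \<phi> x)) + norm_L2 ?D"
      using L2_lincomb[OF dL(1) dL(1), of "-1" 0] L by (intro norm_L2_triangle) auto
    also have "\<dots> < \<epsilon> / 3"
      using \<phi>(3) D0 by (subst norm_L2_scale) simp
    finally have "norm_L2 \<phi> \<le> 2 * (\<epsilon> / 3)"
      using test_function_Poincare[OF \<phi>(1)] by simp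
    moreover have "norm_L2 u = norm_L2 (\<lambda>x. (u x - \<phi> x) + \<phi> x)"
      by simp
    then have "norm_L2 u \<le> norm_L2 (\<lambda>x. u x - \<phi> x) + norm_L2 \<phi>"
      using norm_L2_triangle[OF dL(2) L'(1)] by simp
    ultimately show ?thesis
      using \<phi>(2) by simp
  qed
  then show ?thesis
    using norm_L2_nonneg[of u] by (meson dense_ge order_antisym)
qed


section \<open>The normed space \<open>W\<^sup>2\<^sup>,\<^sup>2(0,1) \<inter> W\<^sub>0\<^sup>1\<^sup>,\<^sup>2(0,1)\<close>\<close>

text \<open>
  Every class in \<open>W\<^sup>2\<^sup>,\<^sup>2(0,1) \<inter> W\<^sub>0\<^sup>1\<^sup>,\<^sup>2(0,1)\<close> has exactly one representative that is continuous on
  \<open>[0,1]\<close>.  An element of the type \<open>sobolev\<close> is this representative, extended by \<open>0\<close> to a function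
  on the real line, so that equality in the type is equality almost everywhere on \<open>(0,1)\<close>.
\<close>

typedef sobolev = "{u. u \<in> W22 \<and> u \<in> W12_0 \<and> continuous_on {0..1} u \<and> (\<forall>x. x \<notin> {0..1} \<longrightarrow> u x = 0)}"
  morphisms fn Sobolev
  by (rule exI[of _ "\<lambda>x. 0"]) (auto simp: W22_zero W12_0_zero)

setup_lifting type_definition_sobolev

lemma fn_W22: "fn u \<in> W22" and fn_W12_0: "fn u \<in> W12_0"
  and fn_continuous: "continuous_on {0..1} (fn u)"
  and fn_outside: "x \<notin> {0..1} \<Longrightarrow> fn u x = 0"
  using fn[of u] by auto

abbreviation fn' :: "sobolev \<Rightarrow> real \<Rightarrow> real" where
  "fn' u \<equiv> weak_deriv (fn u)"

abbreviation fn'' :: "sobolev \<Rightarrow> real \<Rightarrow> real" where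
  "fn'' u \<equiv> weak_deriv (weak_deriv (fn u))"

lemma sobolev_lincomb:
  assumes "u \<in> W22 \<and> u \<in> W12_0 \<and> continuous_on {0..1} u \<and> (\<forall>x. x \<notin> {0..1} \<longrightarrow> u x = 0)"
    and "v \<in> W22 \<and> v \<in> W12_0 \<and> continuous_on {0..1} v \<and> (\<forall>x. x \<notin> {0..1} \<longrightarrow> v x = 0)"
  shows "(\<lambda>x. a * u x + b * v x) \<in> W22 \<and> (\<lambda>x. a * u x + b * v x) \<in> W12_0 \<and>
    continuous_on {0..1} (\<lambda>x. a * u x + b * v x) \<and> (\<forall>x. x \<notin> {0..1} \<longrightarrow> a * u x + b * v x = 0)"
  using assms by (intro conjI W22_lincomb W12_0_lincomb continuous_intros allI impI) auto

instantiation sobolev :: real_normed_vector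
begin

lift_definition zero_sobolev :: sobolev is "\<lambda>x. 0"
  by (auto simp: W22_zero W12_0_zero)

lift_definition plus_sobolev :: "sobolev \<Rightarrow> sobolev \<Rightarrow> sobolev" is "\<lambda>u v x. u x + v x"
  using sobolev_lincomb[where a = 1 and b = 1] by simp

lift_definition minus_sobolev :: "sobolev \<Rightarrow> sobolev \<Rightarrow> sobolev" is "\<lambda>u v x. u x - v x"
  using sobolev_lincomb[where a = 1 and b = "-1"] by simp

lift_definition uminus_sobolev :: "sobolev \<Rightarrow> sobolev" is "\<lambda>u x. - u x"
  subgoal for u using sobolev_lincomb[of u u "-1" 0] by simp
  done

lift_definition scaleR_sobolev :: "real \<Rightarrow> sobolev \<Rightarrow> sobolev" is "\<lambda>r u x. r * u x"
  subgoal for r u using sobolev_lincomb[of u u r 0] by simp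
  done

definition norm_sobolev :: "sobolev \<Rightarrow> real" where
  "norm_sobolev u = norm_L2 (fn'' u)"

definition dist_sobolev :: "sobolev \<Rightarrow> sobolev \<Rightarrow> real" where
  "dist_sobolev u v = norm (u - v)"

definition sgn_sobolev :: "sobolev \<Rightarrow> sobolev" where
  "sgn_sobolev u = inverse (norm u) *\<^sub>R u"

definition uniformity_sobolev :: "(sobolev \<times> sobolev) filter" where
  "uniformity_sobolev = (INF e\<in>{0<..}. principal {(u, v). dist u v < e})"

definition open_sobolev :: "sobolev set \<Rightarrow> bool" where
  "open_sobolev S = (\<forall>u\<in>S. \<forall>\<^sub>F (u', v) in uniformity. u' = u \<longrightarrow> v \<in> S)"

instance
proof
  fix u v w :: sobolev and a b :: real
  show "u + v + w = u + (v + w)" "u + v = v + u" "0 + u = u" "- u + u = 0" "u - v = u + - v"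
    "a *\<^sub>R (u + v) = a *\<^sub>R u + a *\<^sub>R v" "(a + b) *\<^sub>R u = a *\<^sub>R u + b *\<^sub>R u"
    "a *\<^sub>R b *\<^sub>R u = (a * b) *\<^sub>R u" "1 *\<^sub>R u = u"
    by (transfer; auto simp: fun_eq_iff algebra_simps)+
  show "dist u v = norm (u - v)" "sgn u = inverse (norm u) *\<^sub>R u"
    "(uniformity :: (sobolev \<times> sobolev) filter) = (INF e\<in>{0<..}. principal {(u, v). dist u v < e})"
    by (simp_all add: dist_sobolev_def sgn_sobolev_def uniformity_sobolev_def)
  show "open S = (\<forall>u\<in>S. \<forall>\<^sub>F (u', v) in uniformity. u' = u \<longrightarrow> v \<in> S)" for S :: "sobolev set"
    by (simp add: open_sobolev_def)
  have L: "fn'' u \<in> L2" for u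
    by (simp add: fn_W22 W22_D)
  show "norm (u + v) \<le> norm u + norm v"
  proof -
    have "AE x in M01. fn'' (u + v) x = fn'' u x + fn'' v x"
      using W22_lincomb(2)[OF fn_W22[of u] fn_W22[of v], of 1 1] by (simp add: plus_sobolev.rep_eq)
    then have "norm (u + v) = norm_L2 (\<lambda>x. fn'' u x + fn'' v x)"
      unfolding norm_sobolev_def using L2_lincomb[OF L[of u] L[of v], of 1 1]
      by (intro norm_L2_cong L) auto
    then show ?thesis
      unfolding norm_sobolev_def by (simp add: norm_L2_triangle L)
  qed
  have scale: "norm (c *\<^sub>R v) = \<bar>c\<bar> * norm v" for c and v :: sobolev
  proof -
    have "AE x in M01. fn'' (c *\<^sub>R v) x = c * fn'' v x"
      using W22_lincomb(2)[OF fn_W22[of v] fn_W22[of v], of c 0] by (simp add: scaleR_sobolev.rep_eq)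
    then have "norm (c *\<^sub>R v) = norm_L2 (\<lambda>x. c * fn'' v x)"
      unfolding norm_sobolev_def using L2_lincomb[OF L[of v] L[of v], of c 0]
      by (intro norm_L2_cong L) auto
    then show ?thesis
      unfolding norm_sobolev_def by (simp add: norm_L2_scale)
  qed
  then show "norm (a *\<^sub>R u) = \<bar>a\<bar> * norm u" .
  show "norm u = 0 \<longleftrightarrow> u = 0"
  proof
    assume "norm u = 0"
    then have "norm_L2 (fn u) = 0"
      using W22_W12_0_definite fn_W22 fn_W12_0 by (simp add: norm_sobolev_def)
    then have "(LINT x|M01. (fn u x)\<^sup>2) = 0"
      by (simp add: norm_L2_def)
    moreover have c: "continuous_on {0..1} (\<lambda>x. (fn u x)\<^sup>2)"
      by (intro continuous_intros fn_continuous)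
    then have "(LINT x|M01. (fn u x)\<^sup>2) = integral {0<..<1} (\<lambda>x. (fn u x)\<^sup>2)"
      by (intro lebesgue_integral_eq_integral continuous_M01) auto
    ultimately have "((\<lambda>x. (fn u x)\<^sup>2) has_integral 0) {0..1}"
      using integrable_continuous_real[OF c]
      by (simp add: has_integral_integral integral_open_interval_real)
    then have "(fn u x)\<^sup>2 = 0" if "x \<in> {0..1}" for x
      using has_integral_0_cbox_imp_0[of 0 1 "\<lambda>x. (fn u x)\<^sup>2" x] c that by auto
    then have "fn u = (\<lambda>x. 0)"
      using fn_outside by fastforce
    then show "u = 0"
      by (simp add: fn_inject[symmetric] zero_sobolev.rep_eq)
  next
    assume "u = 0"
    moreover have "(0::real) *\<^sub>R u = 0"
      by transfer simp
    ultimately have "norm u = norm ((0::real) *\<^sub>R u)"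
      by simp
    then show "norm u = 0"
      by (simp only: scale abs_zero mult_zero_left)
  qed
qed

end

section \<open>The obstacle problem for the elastic energy\<close>

definition elastic_energy :: "sobolev \<Rightarrow> real" where
  "elastic_energy u = (LINT x|M01. (fn'' u x)\<^sup>2 / (1 + (fn' u x)\<^sup>2) powr (5 / 2))"

text \<open>The interval integral is the oriented one, so this also covers negative \<open>s\<close>.\<close>

definition G :: "real \<Rightarrow> real" where
  "G s = (LBINT t=0..s. (1 + t\<^sup>2) powr (- 5 / 4))"

definition symmetric :: "(real \<Rightarrow> real) \<Rightarrow> bool" where
  "symmetric f \<longleftrightarrow> (\<forall>x\<in>{0..1}. f x = f (1 - x))"

definition obstacle :: "(real \<Rightarrow> real) \<Rightarrow> bool" where
  "obstacle \<psi> \<longleftrightarrow> continuous_on {0..1} \<psi> \<and> \<psi> 0 < 0 \<and> \<psi> 1 < 0 \<and> (\<exists>x\<^sub>0\<in>{0<..<1}. \<psi> x\<^sub>0 > 0)"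

text \<open>``Decreasing'' is meant in the weak sense.\<close>

definition radially_decreasing :: "(real \<Rightarrow> real) \<Rightarrow> bool" where
  "radially_decreasing \<psi> \<longleftrightarrow>
     (\<exists>h. antimono_on {0..1/2} h \<and> (\<forall>x\<in>{0..1}. \<psi> x = h \<bar>x - 1/2\<bar>))"

definition symmetric_cone :: "(real \<Rightarrow> real) \<Rightarrow> bool" where
  "symmetric_cone \<psi> \<longleftrightarrow> symmetric \<psi> \<and> (\<exists>a b. \<forall>x\<in>{0..1/2}. \<psi> x = a * x + b)"

definition admissible :: "(real \<Rightarrow> real) \<Rightarrow> sobolev set" where
  "admissible \<psi> = {u. AE x in M01. fn u x \<ge> \<psi> x}"

definition minimizer :: "(real \<Rightarrow> real) \<Rightarrow> sobolev \<Rightarrow> bool" where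
  "minimizer \<psi> u \<longleftrightarrow> u \<in> admissible \<psi> \<and> (\<forall>v\<in>admissible \<psi>. elastic_energy u \<le> elastic_energy v)"

text \<open>
  The witness \<open>D\<close> is the (unique) Frechet derivative of the energy at \<open>u\<close> with respect to the
  norm of \<^typ>\<open>sobolev\<close>.
\<close>

definition critical_point :: "(real \<Rightarrow> real) \<Rightarrow> sobolev \<Rightarrow> bool" where
  "critical_point \<psi> u \<longleftrightarrow> u \<in> admissible \<psi> \<and>
     (\<exists>D. (elastic_energy has_derivative D) (at u) \<and> (\<forall>v\<in>admissible \<psi>. D (v - u) \<ge> 0))"

end

theory Submission
  imports Defs "HOL-Complex_Analysis.Great_Picard"
begin

text \<open>
  Write \<open>p = u'\<close>, \<open>V = G (p)\<close> and \<open>g = V'\<close>; then the energy is the integral of \<open>g\<^sup>2\<close>, and the bound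
  \<open>(G 2)\<^sup>2\<close> forces \<open>\<bar>p\<bar> \<le> 2\<close>, since \<open>p\<close> vanishes somewhere.  Along a minimizing sequence the functions \<open>V\<close>
  are equicontinuous, and lower semicontinuity is read off from their difference quotients on dyadic
  partitions.  For a variation with \<open>\<phi>' = (1 + p\<^sup>2) powr (5/4) * \<eta>\<close> the first variation is twice the
  integral of \<open>g * \<eta>'\<close>; taking \<open>\<eta>' = - max g 0\<close> shows that critical points are concave.

  A concave minimizer is symmetrized by assigning to \<open>x\<close> the mean of \<open>G\<close> over the two slopes (up to sign) at
  the ends of the superlevel interval of length \<open>1 - 2 x\<close>.  This does not increase the energy, and as the
  slopes are at most \<open>2\<close> the new function lies above the symmetric decreasing rearrangement, hence above
  the obstacle.

  Over a cone a symmetric critical point \<open>w\<close> touches the obstacle exactly at the tip, and \<open>V'' = - k (1 + p\<^sup>2) powr (5/4)\<close>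
  with \<open>V' 0 = 0\<close> on the left half.  Two algebraic first integrals and a third one in the angle
  \<open>arctan p\<close> determine \<open>p 0\<close> and \<open>k\<close> from the height of the tip, and then \<open>p\<close>.
\<close>

section \<open>Square-integrable functions and their primitives\<close>

text \<open>The variable V is chosen because the energy, which is not convex in u, becomes the
  Dirichlet integral of V; the price is that u(1) = 0 turns into the nonlinear constraint that
  \<open>inv G\<close> of V has mean zero. Two different means meet in the symmetrization.
  Rearranging u itself produces the harmonic mean of the two end slopes, which fits the obstacle
  condition, whereas the energy estimate asks for the arithmetic mean of their G-values. Convexity
  of z \<mapsto> G (1 / z) makes the two comparable, and it holds exactly as long as z \<ge> 1/2;
  this is the origin of the number 2. Throughout, estimates of increments with an error (y - x) * (M
  y - M x) take the place of differentiation almost everywhere: such errors disappear under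
  subdivision.\<close>

lemma integral_M01:
  fixes f :: "real \<Rightarrow> real"
  assumes "integrable M01 f"
  shows "f absolutely_integrable_on {0..1}" "(LINT x|M01. f x) = integral {0..1} f"
proof -
  have "f absolutely_integrable_on {0<..<1}"
    using assms by (simp add: integrable_restrict_space set_integrable_def)
  then show "f absolutely_integrable_on {0..1}"
    by (simp add: absolutely_integrable_on_Icc_iff_Ioo)
  show "(LINT x|M01. f x) = integral {0..1} f"
    using assms by (simp add: lebesgue_integral_eq_integral integral_open_interval_real)
qed

lemma AE_M01_negligible:
  assumes "AE x in M01. P x"
  shows "negligible {x\<in>{0..1}. \<not> P x}"
proof -
  have "AE x in lebesgue. x \<in> {0<..<1} \<longrightarrow> P x"
    using assms by (subst (asm) AE_restrict_space_iff) auto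
  then obtain N where N: "{x \<in> space lebesgue. \<not> (x \<in> {0<..<1} \<longrightarrow> P x)} \<subseteq> N" "N \<in> null_sets lebesgue"
    by (auto elim!: AE_E simp: null_sets_def)
  have "negligible (N \<union> {0, 1})"
    using N(2) by (simp add: negligible_iff_null_sets negligible_Un)
  moreover have "{x\<in>{0..1}. \<not> P x} \<subseteq> N \<union> {0, 1}"
  proof (rule subsetI)
    fix x assume x: "x \<in> {x\<in>{0..1}. \<not> P x}"
    show "x \<in> N \<union> {0, 1}"
    proof (cases "x = 0 \<or> x = 1")
      case False
      then have "x \<in> {0<..<1}" "\<not> P x"
        using x by auto
      then show ?thesis
        using N(1) by (simp add: subset_iff)
    qed auto
  qed
  ultimately show ?thesis
    by (rule negligible_subset)
qed

lemma integral_cong_AE_M01: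
  fixes f g :: "real \<Rightarrow> real"
  assumes "AE x in M01. f x = g x" "0 \<le> x" "y \<le> 1"
  shows "integral {x..y} f = integral {x..y} g"
  by (rule integral_spike[OF AE_M01_negligible[OF assms(1)]]) (use assms in auto)

lemma L2_mult_integrable:
  assumes "f \<in> L2" "g \<in> L2" "0 \<le> x" "y \<le> 1"
  shows "(\<lambda>t. f t * g t) integrable_on {x..y}"
  using integral_M01(1)[OF L2_integrable_mult[OF assms(1,2)]] assms(3,4)
  by (meson absolutely_integrable_on_def atLeastatMost_subset_iff integrable_subinterval_real order.trans)

lemma L2_integrable:
  assumes "f \<in> L2" "0 \<le> x" "y \<le> 1"
  shows "f integrable_on {x..y}"
  using L2_mult_integrable[OF assms(1) L2_one assms(2,3)] by simp

lemma L2_square_integrable: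
  assumes "f \<in> L2" "0 \<le> x" "y \<le> 1"
  shows "(\<lambda>t. (f t)\<^sup>2) integrable_on {x..y}"
  using L2_mult_integrable[OF assms(1) assms] by (simp add: power2_eq_square)

lemma L2_abs: "f \<in> L2 \<Longrightarrow> (\<lambda>t. \<bar>f t\<bar>) \<in> L2"
  by (auto simp: L2_def)

lemma L2_abs_integrable:
  assumes "f \<in> L2" "0 \<le> x" "y \<le> 1"
  shows "(\<lambda>t. \<bar>f t\<bar>) integrable_on {x..y}"
  using L2_integrable[OF L2_abs] assms by blast

lemma LINT_mult: "f \<in> L2 \<Longrightarrow> g \<in> L2 \<Longrightarrow> (LINT x|M01. f x * g x) = integral {0..1} (\<lambda>t. f t * g t)"
  by (intro integral_M01 L2_integrable_mult)

lemma LINT_square: "f \<in> L2 \<Longrightarrow> (LINT x|M01. (f x)\<^sup>2) = integral {0..1} (\<lambda>t. (f t)\<^sup>2)"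
  by (intro integral_M01 L2_integrable_sq)

lemma L2_mult_bounded:
  assumes "f \<in> L2" "c \<in> borel_measurable M01" "\<And>x. x \<in> {0<..<1} \<Longrightarrow> \<bar>c x\<bar> \<le> B"
  shows "(\<lambda>t. c t * f t) \<in> L2"
  unfolding L2_def
proof (intro CollectI conjI)
  show m: "(\<lambda>t. c t * f t) \<in> borel_measurable M01"
    using assms(2) L2_measurable[OF assms(1)] by measurable
  show "integrable M01 (\<lambda>x. (c x * f x)\<^sup>2)"
  proof (rule Bochner_Integration.integrable_bound)
    show "integrable M01 (\<lambda>x. B\<^sup>2 * (f x)\<^sup>2)"
      using L2_integrable_sq[OF assms(1)] by simp
    show "(\<lambda>x. (c x * f x)\<^sup>2) \<in> borel_measurable M01"
      using m by measurable
    have "(c x)\<^sup>2 \<le> B\<^sup>2" if "x \<in> {0<..<1}" for x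
      using power_mono[OF assms(3)[OF that], of 2] by simp
    then show "AE x in M01. norm ((c x * f x)\<^sup>2) \<le> norm (B\<^sup>2 * (f x)\<^sup>2)"
      by (intro AE_I2) (auto simp: power_mult_distrib mult_right_mono)
  qed
qed

lemma L2_mult_continuous:
  assumes "f \<in> L2" "continuous_on {0..1} c"
  shows "(\<lambda>t. c t * f t) \<in> L2"
proof -
  have "compact (c ` {0..1})"
    using assms(2) by (intro compact_continuous_image) auto
  then obtain B where "\<forall>y\<in>c ` {0..1}. norm y \<le> B"
    using compact_imp_bounded bounded_iff by metis
  then show ?thesis
    using assms continuous_M01(1) by (intro L2_mult_bounded[where B = B]) auto
qed

lemma L2_add: "f \<in> L2 \<Longrightarrow> g \<in> L2 \<Longrightarrow> (\<lambda>t. f t + g t) \<in> L2"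
  using L2_lincomb[of f g 1 1] by simp

lemma L2_diff: "f \<in> L2 \<Longrightarrow> g \<in> L2 \<Longrightarrow> (\<lambda>t. f t - g t) \<in> L2"
  using L2_lincomb[of f g 1 "-1"] by simp

lemma L2_cmult: "f \<in> L2 \<Longrightarrow> (\<lambda>t. c * f t) \<in> L2"
  using L2_lincomb[of f f c 0] by simp

lemma L2_indicator:
  assumes "f \<in> L2" "A \<in> sets borel"
  shows "(\<lambda>t. indicator A t * f t) \<in> L2"
proof (rule L2_mult_bounded[OF assms(1), where B = 1])
  have "indicator A \<in> borel_measurable lebesgue"
    using assms(2) by (intro borel_measurable_indicator) auto
  then show "indicator A \<in> borel_measurable M01"
    using measurable_restrict_space1 by blast
qed (auto simp: indicator_def)

lemma integral_square_nonneg: "0 \<le> integral {x..y} (\<lambda>t. (f t)\<^sup>2 :: real)"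
  by (cases "(\<lambda>t. (f t)\<^sup>2) integrable_on {x..y}")
    (auto intro!: Henstock_Kurzweil_Integration.integral_nonneg simp: not_integrable_integral)

lemma integral_Cauchy_Schwarz:
  assumes "f \<in> L2" "0 \<le> x" "x \<le> y" "y \<le> 1"
  shows "(integral {x..y} f)\<^sup>2 \<le> (y - x) * integral {x..y} (\<lambda>t. (f t)\<^sup>2)"
proof (cases "x = y")
  case False
  \<comment> \<open>After subtraction of the mean value, the nonnegative integral of the square is
    the defect in the inequality.\<close>
  define m where "m = integral {x..y} f / (y - x)"
  have i: "f integrable_on {x..y}" "(\<lambda>t. (f t)\<^sup>2) integrable_on {x..y}"
    using assms L2_integrable L2_square_integrable by auto
  have e: "integral {x..y} f = m * (y - x)"
    using False by (simp add: m_def)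
  have "0 \<le> integral {x..y} (\<lambda>t. (f t - m)\<^sup>2)"
    by (rule integral_square_nonneg)
  also have "(\<lambda>t. (f t - m)\<^sup>2) = (\<lambda>t. (f t)\<^sup>2 - 2 * m * f t + m\<^sup>2)"
    by (auto simp: power2_eq_square algebra_simps)
  also have "integral {x..y} \<dots> = integral {x..y} (\<lambda>t. (f t)\<^sup>2) - 2 * m * integral {x..y} f + m\<^sup>2 * (y - x)"
  proof (rule integral_unique)
    have "((\<lambda>t. m\<^sup>2) has_integral m\<^sup>2 * (y - x)) {x..y}"
      using has_integral_const_real[of "m\<^sup>2" x y] assms by (simp add: mult.commute)
    then show "((\<lambda>t. (f t)\<^sup>2 - 2 * m * f t + m\<^sup>2) has_integral
        integral {x..y} (\<lambda>t. (f t)\<^sup>2) - 2 * m * integral {x..y} f + m\<^sup>2 * (y - x)) {x..y}"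
      using i by (intro has_integral_add has_integral_diff has_integral_mult_right integrable_integral)
  qed
  also have "\<dots> = integral {x..y} (\<lambda>t. (f t)\<^sup>2) - m\<^sup>2 * (y - x)"
    by (simp add: e power2_eq_square)
  finally have "(y - x) * (m\<^sup>2 * (y - x)) \<le> (y - x) * integral {x..y} (\<lambda>t. (f t)\<^sup>2)"
    using assms by (intro mult_left_mono) auto
  then show ?thesis
    by (simp add: e power2_eq_square algebra_simps)
qed simp

lemma integral_abs_Cauchy_Schwarz:
  assumes "f \<in> L2" "0 \<le> x" "x \<le> y" "y \<le> 1"
  shows "(integral {x..y} (\<lambda>t. \<bar>f t\<bar>))\<^sup>2 \<le> (y - x) * integral {x..y} (\<lambda>t. (f t)\<^sup>2)"
  using integral_Cauchy_Schwarz[OF L2_abs[OF assms(1)] assms(2-)] by simp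

lemma integral_abs_bound:
  fixes f g :: "real \<Rightarrow> real"
  assumes "f integrable_on S" "g integrable_on S" "\<And>x. x \<in> S \<Longrightarrow> \<bar>f x\<bar> \<le> g x"
  shows "\<bar>integral S f\<bar> \<le> integral S g"
  using Henstock_Kurzweil_Integration.integral_norm_bound_integral[OF assms(1,2)] assms(3) by simp

lemma integral_Icc_diff:
  fixes f :: "real \<Rightarrow> real"
  assumes "f integrable_on {a..c}" "a \<le> b" "b \<le> c"
  shows "integral {a..c} f - integral {a..b} f = integral {b..c} f"
  using Henstock_Kurzweil_Integration.integral_combine[OF assms(2,3,1)] by simp

text \<open>On a subdivision into \<open>n\<close> equal pieces the hypothesis telescopes to an error of order \<open>1/n\<close>.\<close>

lemma chain_le:
  fixes F M :: "real \<Rightarrow> real"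
  assumes "a \<le> b" and le: "\<And>x y. a \<le> x \<Longrightarrow> x \<le> y \<Longrightarrow> y \<le> b \<Longrightarrow> F y - F x \<le> (y - x) * (M y - M x)"
  shows "F b \<le> F a"
proof -
  define C where "C = (b - a) * (M b - M a)"
  have "F b - F a \<le> C / real (Suc m)" for m
  proof -
    define n where "n = Suc m"
    define x where "x i = a + real i * ((b - a) / n)" for i :: nat
    have n: "real n > 0" by (simp add: n_def)
    have x0: "x 0 = a" "x n = b"
      using n by (auto simp: x_def)
    have step: "x (Suc i) - x i = (b - a) / n" for i
      unfolding x_def of_nat_Suc distrib_right by simp
    have lo: "a \<le> x i" for i
      using assms(1) by (simp add: x_def)
    have mono: "x i \<le> x (Suc i)" for i
      using step[of i] assms(1) by (smt (verit) divide_nonneg_nonneg of_nat_0_le_iff)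
    have hi: "x (Suc i) \<le> b" if "i < n" for i
    proof -
      have "x (Suc i) = a + real (Suc i) * ((b - a) / n)"
        by (simp add: x_def)
      also have "\<dots> \<le> a + real n * ((b - a) / n)"
        using that assms(1) by (intro add_left_mono mult_right_mono) auto
      also have "\<dots> = b" using n by simp
      finally show ?thesis .
    qed
    have "F b - F a = (\<Sum>i<n. F (x (Suc i)) - F (x i))"
      using sum_lessThan_telescope[of "\<lambda>i. F (x i)" n] by (simp add: x0)
    also have "\<dots> \<le> (\<Sum>i<n. (b - a) / n * (M (x (Suc i)) - M (x i)))"
      using le lo mono hi step by (intro sum_mono) (metis lessThan_iff)
    also have "\<dots> = C / n"
      using sum_lessThan_telescope[of "\<lambda>i. M (x i)" n]
      unfolding sum_distrib_left[symmetric] by (simp add: x0 C_def)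
    finally show ?thesis by (simp add: n_def)
  qed
  moreover have "(\<lambda>m. C / real (Suc m)) \<longlonglongrightarrow> 0"
    by (rule LIMSEQ_Suc[OF lim_const_over_n])
  ultimately have "F b - F a \<le> 0"
    by (intro LIMSEQ_le_const) auto
  then show ?thesis by simp
qed

lemma chain_eq:
  fixes F M :: "real \<Rightarrow> real"
  assumes "a \<le> b"
    and le: "\<And>x y. a \<le> x \<Longrightarrow> x \<le> y \<Longrightarrow> y \<le> b \<Longrightarrow> \<bar>F y - F x\<bar> \<le> (y - x) * (M y - M x)"
  shows "F b = F a"
proof (rule antisym)
  show "F b \<le> F a"
    using assms(1) by (rule chain_le[where M = M]) (use le in \<open>meson abs_le_D1\<close>)
  have "- F b \<le> - F a"
    using assms(1)
  proof (rule chain_le[where M = M])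
    fix x y assume "a \<le> x" "x \<le> y" "y \<le> b"
    from le[OF this] show "- F y - - F x \<le> (y - x) * (M y - M x)"
      by linarith
  qed
  then show "F a \<le> F b" by simp
qed

text \<open>Absolute continuity on [0,1] with square-integrable derivative, encoded by the integral
  formula so that the calculus below can run on increments. Values of \<open>a\<close> outside [0,1]
  are free, and \<alpha> is determined only up to null sets.\<close>

definition H1 :: "(real \<Rightarrow> real) \<Rightarrow> (real \<Rightarrow> real) \<Rightarrow> bool" where
  "H1 a \<alpha> \<longleftrightarrow> \<alpha> \<in> L2 \<and> (\<forall>x\<in>{0..1}. a x = a 0 + integral {0..x} \<alpha>)"

lemma H1_L2: "H1 a \<alpha> \<Longrightarrow> \<alpha> \<in> L2"
  by (simp add: H1_def)

lemma H1_eq: "H1 a \<alpha> \<Longrightarrow> x \<in> {0..1} \<Longrightarrow> a x = a 0 + integral {0..x} \<alpha>"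
  unfolding H1_def by blast

lemma H1I:
  assumes "\<alpha> \<in> L2" "\<And>x. x \<in> {0..1} \<Longrightarrow> a x = a 0 + integral {0..x} \<alpha>"
  shows "H1 a \<alpha>"
  using assms unfolding H1_def by blast

lemma H1_increment:
  assumes "H1 a \<alpha>" "0 \<le> x" "x \<le> y" "y \<le> 1"
  shows "a y - a x = integral {x..y} \<alpha>"
proof -
  have "a y = a 0 + integral {0..y} \<alpha>" "a x = a 0 + integral {0..x} \<alpha>"
    using assms by (auto intro!: H1_eq[OF assms(1)])
  then show ?thesis
    using integral_Icc_diff[OF L2_integrable[OF H1_L2[OF assms(1)]], of 0 y x] assms by simp
qed

lemma H1_primitive: "\<alpha> \<in> L2 \<Longrightarrow> H1 (\<lambda>x. c + integral {0..x} \<alpha>) \<alpha>"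
  by (simp add: H1_def)

lemma H1_continuous:
  assumes "H1 a \<alpha>"
  shows "continuous_on {0..1} a"
proof -
  have "continuous_on {0..1} (\<lambda>x. a 0 + integral {0..x} \<alpha>)"
    using L2_integrable[OF H1_L2[OF assms]]
    by (intro continuous_intros indefinite_integral_continuous_1) auto
  then show ?thesis
    by (rule continuous_on_eq) (rule H1_eq[OF assms, symmetric])
qed

lemma H1_fun_L2: "H1 a \<alpha> \<Longrightarrow> a \<in> L2"
  using H1_continuous continuous_L2 by blast

lemma H1_increment_le:
  assumes "H1 a \<alpha>" "0 \<le> x" "x \<le> y" "y \<le> 1"
  shows "\<bar>a y - a x\<bar> \<le> integral {x..y} (\<lambda>t. \<bar>\<alpha> t\<bar>)"
  unfolding H1_increment[OF assms]
  using L2_integrable[OF H1_L2[OF assms(1)]] L2_abs_integrable[OF H1_L2[OF assms(1)]] assms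
  by (intro integral_abs_bound) auto

lemma H1_increment_square:
  assumes "H1 a \<alpha>" "0 \<le> x" "x \<le> y" "y \<le> 1"
  shows "(a y - a x)\<^sup>2 \<le> (y - x) * integral {x..y} (\<lambda>t. (\<alpha> t)\<^sup>2)"
  using integral_Cauchy_Schwarz[OF H1_L2[OF assms(1)] assms(2-)] H1_increment[OF assms] by simp

lemma H1_increment_square_le:
  assumes a: "H1 a \<alpha>" and "x \<in> {0..1}" "y \<in> {0..1}"
  shows "(a y - a x)\<^sup>2 \<le> \<bar>y - x\<bar> * integral {0..1} (\<lambda>t. (\<alpha> t)\<^sup>2)"
proof -
  have *: "(a y - a x)\<^sup>2 \<le> (y - x) * integral {0..1} (\<lambda>t. (\<alpha> t)\<^sup>2)" if "0 \<le> x" "x \<le> y" "y \<le> 1" for x y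
  proof -
    have "integral {x..y} (\<lambda>t. (\<alpha> t)\<^sup>2) \<le> integral {0..1} (\<lambda>t. (\<alpha> t)\<^sup>2)"
      using that by (intro integral_subset_le L2_square_integrable[OF H1_L2[OF a]]) auto
    then show ?thesis
      using H1_increment_square[OF a that] mult_left_mono[of _ _ "y - x"] that by (meson diff_ge_0_iff_ge order_trans)
  qed
  show ?thesis
    using *[of x y] *[of y x] assms(2,3) by (cases "x \<le> y") (auto simp: power2_commute)
qed

lemma H1_oscillation:
  assumes "H1 a \<alpha>" "x \<in> {0..1}" "y \<in> {0..1}"
  shows "(a y - a x)\<^sup>2 \<le> integral {0..1} (\<lambda>t. (\<alpha> t)\<^sup>2)"
proof -
  have "\<bar>y - x\<bar> * integral {0..1} (\<lambda>t. (\<alpha> t)\<^sup>2) \<le> 1 * integral {0..1} (\<lambda>t. (\<alpha> t)\<^sup>2)"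
    using assms(2,3) by (intro mult_right_mono integral_square_nonneg) auto
  then show ?thesis using H1_increment_square_le[OF assms] by simp
qed

lemma H1_cong:
  assumes "H1 a \<alpha>" "\<And>x. x \<in> {0..1} \<Longrightarrow> b x = a x"
  shows "H1 b \<alpha>"
proof (rule H1I)
  fix x :: real assume "x \<in> {0..1}"
  then show "b x = b 0 + integral {0..x} \<alpha>"
    using H1_eq[OF assms(1), of x] assms(2)[of x] assms(2)[of 0] by simp
qed (use assms(1) H1_L2 in blast)

lemma H1_AE_cong:
  assumes "H1 a \<alpha>" "\<beta> \<in> L2" "AE x in M01. \<alpha> x = \<beta> x"
  shows "H1 a \<beta>"
proof (rule H1I[OF assms(2)])
  fix x :: real assume "x \<in> {0..1}"
  then show "a x = a 0 + integral {0..x} \<beta>"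
    using H1_eq[OF assms(1), of x] integral_cong_AE_M01[OF assms(3), of 0 x] by simp
qed

lemma H1_lincomb:
  assumes "H1 a \<alpha>" "H1 b \<beta>"
  shows "H1 (\<lambda>x. c * a x + d * b x) (\<lambda>x. c * \<alpha> x + d * \<beta> x)"
proof (rule H1I)
  show "(\<lambda>x. c * \<alpha> x + d * \<beta> x) \<in> L2"
    using assms by (intro L2_lincomb H1_L2)
  fix x :: real assume x: "x \<in> {0..1}"
  have i: "\<alpha> integrable_on {0..x}" "\<beta> integrable_on {0..x}"
    using assms x H1_L2 L2_integrable by auto
  then have "integral {0..x} (\<lambda>x. c * \<alpha> x + d * \<beta> x) = c * integral {0..x} \<alpha> + d * integral {0..x} \<beta>"
    by (subst Henstock_Kurzweil_Integration.integral_add) (auto intro: integrable_on_mult_right)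
  moreover have "a x = a 0 + integral {0..x} \<alpha>" "b x = b 0 + integral {0..x} \<beta>"
    using H1_eq assms x by blast+
  ultimately show "c * a x + d * b x = c * a 0 + d * b 0 + integral {0..x} (\<lambda>x. c * \<alpha> x + d * \<beta> x)"
    by (simp add: algebra_simps)
qed

section \<open>Chain rule, product rule and weak derivatives of primitives\<close>

lemma H1_chainI:
  assumes "\<alpha> \<in> L2"
    and "\<And>x y. 0 \<le> x \<Longrightarrow> x \<le> y \<Longrightarrow> y \<le> 1 \<Longrightarrow>
      \<bar>a y - a x - integral {x..y} \<alpha>\<bar> \<le> (y - x) * (M y - M x)"
  shows "H1 a \<alpha>"
proof (rule H1I[OF assms(1)])
  fix z :: real assume z: "z \<in> {0..1}"
  define F where "F x = a x - integral {0..x} \<alpha>" for x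
  have "F z = F 0"
  proof (rule chain_eq[where F = F and M = M and a = 0 and b = z])
    fix x y assume xy: "0 \<le> x" "x \<le> y" "y \<le> z"
    then have "F y - F x = a y - a x - integral {x..y} \<alpha>"
      using integral_Icc_diff[OF L2_integrable[OF assms(1)], of 0 y x] z by (simp add: F_def)
    then show "\<bar>F y - F x\<bar> \<le> (y - x) * (M y - M x)"
      using assms(2)[of x y] xy z by simp
  qed (use z in auto)
  then show "a z = a 0 + integral {0..z} \<alpha>"
    by (simp add: F_def)
qed

text \<open>On [x, y] the mean value theorem replaces f' (a t) by one value f' c, and the two differ
  by at most L * S with S the integral of the absolute value of \<alpha>. The resulting error L *
  S^2 is, by Cauchy-Schwarz, at most y - x times an increment of L times the integral of the square
  of \<alpha>, which is the form that vanishes under subdivision.\<close>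

lemma H1_compose:
  assumes a: "H1 a \<alpha>" and rng: "\<And>x. x \<in> {0..1} \<Longrightarrow> a x \<in> {l..u}"
    and der: "\<And>z. z \<in> {l..u} \<Longrightarrow> (f has_real_derivative f' z) (at z within {l..u})"
    and Lip: "\<And>z w. z \<in> {l..u} \<Longrightarrow> w \<in> {l..u} \<Longrightarrow> \<bar>f' z - f' w\<bar> \<le> L * \<bar>z - w\<bar>" and "L \<ge> 0"
  shows "H1 (\<lambda>x. f (a x)) (\<lambda>x. f' (a x) * \<alpha> x)"
proof (rule H1_chainI[where M = "\<lambda>x. L * integral {0..x} (\<lambda>t. (\<alpha> t)\<^sup>2)"])
  have "L-lipschitz_on {l..u} f'"
    using Lip \<open>L \<ge> 0\<close> by (intro lipschitz_onI) (auto simp: dist_real_def)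
  then have "continuous_on {l..u} f'"
    by (rule lipschitz_on_continuous_on)
  then have cf: "continuous_on {0..1} (\<lambda>x. f' (a x))"
    using rng by (intro continuous_on_compose2[OF _ H1_continuous[OF a]]) auto
  then show L2: "(\<lambda>x. f' (a x) * \<alpha> x) \<in> L2"
    by (intro L2_mult_continuous H1_L2[OF a])
  fix x y :: real assume xy: "0 \<le> x" "x \<le> y" "y \<le> 1"
  define S where "S = integral {x..y} (\<lambda>t. \<bar>\<alpha> t\<bar>)"
  have iS: "(\<lambda>t. \<bar>\<alpha> t\<bar>) integrable_on {s..t}" if "0 \<le> s" "t \<le> 1" for s t
    using L2_abs_integrable[OF H1_L2[OF a]] that by auto
  have osc: "\<bar>a t - a s\<bar> \<le> S" if "x \<le> s" "s \<le> t" "t \<le> y" for s t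
  proof -
    have "\<bar>a t - a s\<bar> \<le> integral {s..t} (\<lambda>t. \<bar>\<alpha> t\<bar>)"
      using that xy by (intro H1_increment_le[OF a]) auto
    also have "\<dots> \<le> S"
      unfolding S_def using that xy by (intro integral_subset_le iS) auto
    finally show ?thesis .
  qed
  obtain c where c: "c \<in> {l..u}" "f (a y) - f (a x) = f' c * (a y - a x)"
    "min (a x) (a y) \<le> c" "c \<le> max (a x) (a y)"
  proof -
    have mv: "\<exists>c\<in>{p..q}. f q - f p = f' c * (q - p)" if "l \<le> p" "p \<le> q" "q \<le> u" for p q
    proof (cases "p = q")
      case False
      have "\<exists>z\<in>{p<..<q}. f q - f p = (q - p) * f' z"
      proof (rule mvt_simple[where f' = "\<lambda>z t. t * f' z", simplified])
        show "p < q" using that False by simp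
        fix z assume "p \<le> z" "z \<le> q"
        then have "(f has_real_derivative f' z) (at z within {p..q})"
          using der[of z] that
          by (rule_tac has_field_derivative_subset[of f _ z "{l..u}"]) auto
        then show "(f has_derivative (\<lambda>t. t * f' z)) (at z within {p..q})"
          by (simp add: has_field_derivative_def mult_commute_abs)
      qed
      then show ?thesis by (force simp: mult.commute)
    qed (use that in auto)
    have r: "a x \<in> {l..u}" "a y \<in> {l..u}"
      using rng xy by auto
    show ?thesis
    proof (cases "a x \<le> a y")
      case True
      then obtain c where "c \<in> {a x..a y}" "f (a y) - f (a x) = f' c * (a y - a x)"
        using mv[of "a x" "a y"] r by auto
      then show ?thesis using r True by (intro that[of c]) auto
    next
      case False
      then obtain c where "c \<in> {a y..a x}" "f (a x) - f (a y) = f' c * (a x - a y)"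
        using mv[of "a y" "a x"] r by auto
      then show ?thesis using r False by (intro that[of c]) (auto simp: algebra_simps)
    qed
  qed
  have i1: "\<alpha> integrable_on {x..y}" "(\<lambda>x. f' (a x) * \<alpha> x) integrable_on {x..y}"
    using L2_integrable[OF H1_L2[OF a]] L2_integrable[OF L2] xy by auto
  have "f (a y) - f (a x) - integral {x..y} (\<lambda>x. f' (a x) * \<alpha> x)
      = integral {x..y} (\<lambda>t. f' c * \<alpha> t) - integral {x..y} (\<lambda>x. f' (a x) * \<alpha> x)"
    using c(2) H1_increment[OF a xy] by simp
  also have "\<dots> = integral {x..y} (\<lambda>t. f' c * \<alpha> t - f' (a t) * \<alpha> t)"
    using i1 by (intro Henstock_Kurzweil_Integration.integral_diff[symmetric] integrable_on_mult_right) auto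
  also have "\<bar>\<dots>\<bar> \<le> integral {x..y} (\<lambda>t. (L * S) * \<bar>\<alpha> t\<bar>)"
  proof (rule integral_abs_bound)
    show "(\<lambda>t. f' c * \<alpha> t - f' (a t) * \<alpha> t) integrable_on {x..y}"
      using i1 by (intro integrable_diff integrable_on_mult_right) auto
    show "(\<lambda>t. (L * S) * \<bar>\<alpha> t\<bar>) integrable_on {x..y}"
      using iS xy by (intro integrable_on_mult_right) auto
    fix t assume t: "t \<in> {x..y}"
    have "\<bar>c - a t\<bar> \<le> S"
      using osc[of x t] osc[of t y] osc[of x y] c(3,4) t by (auto simp: min_def max_def split: if_splits)
    then have "L * \<bar>c - a t\<bar> \<le> L * S"
      using \<open>L \<ge> 0\<close> by (rule mult_left_mono)
    then have "\<bar>f' c - f' (a t)\<bar> \<le> L * S"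
      using Lip[of c "a t"] c(1) rng[of t] t xy by auto
    then have "\<bar>f' c - f' (a t)\<bar> * \<bar>\<alpha> t\<bar> \<le> L * S * \<bar>\<alpha> t\<bar>"
      by (rule mult_right_mono) simp
    then show "\<bar>f' c * \<alpha> t - f' (a t) * \<alpha> t\<bar> \<le> L * S * \<bar>\<alpha> t\<bar>"
      by (simp add: abs_mult[symmetric] algebra_simps)
  qed
  also have "\<dots> = L * S\<^sup>2"
    by (simp add: S_def power2_eq_square)
  also have "\<dots> \<le> L * ((y - x) * integral {x..y} (\<lambda>t. (\<alpha> t)\<^sup>2))"
    unfolding S_def using \<open>L \<ge> 0\<close> xy
    by (intro mult_left_mono integral_abs_Cauchy_Schwarz H1_L2[OF a]) auto
  also have "\<dots> = (y - x) * (L * integral {0..y} (\<lambda>t. (\<alpha> t)\<^sup>2) - L * integral {0..x} (\<lambda>t. (\<alpha> t)\<^sup>2))"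
  proof -
    have "integral {0..y} (\<lambda>t. (\<alpha> t)\<^sup>2) - integral {0..x} (\<lambda>t. (\<alpha> t)\<^sup>2) = integral {x..y} (\<lambda>t. (\<alpha> t)\<^sup>2)"
      using xy by (intro integral_Icc_diff L2_square_integrable[OF H1_L2[OF a]]) auto
    then show ?thesis
      unfolding right_diff_distrib[symmetric] by simp
  qed
  finally show "\<bar>f (a y) - f (a x) - integral {x..y} (\<lambda>x. f' (a x) * \<alpha> x)\<bar> \<le> \<dots>" .
qed

lemma H1_bounded:
  assumes "H1 a \<alpha>"
  obtains B where "B \<ge> 0" "\<And>x. x \<in> {0..1} \<Longrightarrow> \<bar>a x\<bar> \<le> B"
proof -
  have "compact (a ` {0..1})"
    using H1_continuous[OF assms] by (intro compact_continuous_image) auto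
  then obtain B where "\<forall>y\<in>a ` {0..1}. norm y \<le> B"
    using compact_imp_bounded bounded_iff by metis
  then show thesis
    by (intro that[of "\<bar>B\<bar>"]) force+
qed

lemma H1_power2:
  assumes "H1 a \<alpha>"
  shows "H1 (\<lambda>x. (a x)\<^sup>2) (\<lambda>x. 2 * a x * \<alpha> x)"
proof -
  obtain B where B: "\<And>x. x \<in> {0..1} \<Longrightarrow> \<bar>a x\<bar> \<le> B"
    using H1_bounded[OF assms] by blast
  have "a x \<in> {- B..B}" if "x \<in> {0..1}" for x
    using B[OF that] by auto
  moreover have "\<bar>2 * z - 2 * w\<bar> \<le> 2 * \<bar>z - w\<bar>" for z w :: real
    by (simp add: abs_if)
  ultimately show ?thesis
    by (rule_tac H1_compose[OF assms, where l = "-B" and u = B and L = 2 and f' = "\<lambda>z. 2 * z"])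
      (auto intro!: derivative_eq_intros)
qed

lemma H1_mult:
  assumes "H1 a \<alpha>" "H1 b \<beta>"
  shows "H1 (\<lambda>x. a x * b x) (\<lambda>x. \<alpha> x * b x + a x * \<beta> x)"
proof -
  \<comment> \<open>Polarization: the product is a quarter of the difference of the squares of sum
    and difference.\<close>
  note s = H1_power2[OF H1_lincomb[OF assms, of 1 1]] H1_power2[OF H1_lincomb[OF assms, of 1 "-1"]]
  have "(\<lambda>x. \<alpha> x * b x + a x * \<beta> x) = (\<lambda>x. 1/4 * (2 * (1 * a x + 1 * b x) * (1 * \<alpha> x + 1 * \<beta> x))
      + (-1/4) * (2 * (1 * a x + (-1) * b x) * (1 * \<alpha> x + (-1) * \<beta> x)))"
    by (simp add: fun_eq_iff algebra_simps add_divide_distrib diff_divide_distrib)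
  then show ?thesis
    using H1_lincomb[OF s, of "1/4" "-1/4"]
    by (auto elim!: H1_cong simp: power2_eq_square algebra_simps)
qed

lemma C1_H1:
  assumes "\<And>x. x \<in> {0..1} \<Longrightarrow> (a has_real_derivative \<alpha> x) (at x within {0..1})" "continuous_on {0..1} \<alpha>"
  shows "H1 a \<alpha>"
proof (rule H1I)
  show "\<alpha> \<in> L2" using assms(2) by (rule continuous_L2)
  fix x :: real assume x: "x \<in> {0..1}"
  have "(\<alpha> has_integral a x - a 0) {0..x}"
  proof (rule fundamental_theorem_of_calculus)
    fix z assume "z \<in> {0..x}"
    then have "(a has_real_derivative \<alpha> z) (at z within {0..x})"
      using assms(1)[of z] x by (rule_tac has_field_derivative_subset[of a _ z "{0..1}"]) auto
    then show "(a has_vector_derivative \<alpha> z) (at z within {0..x})"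
      by (simp add: has_real_derivative_iff_has_vector_derivative)
  qed (use x in auto)
  then show "a x = a 0 + integral {0..x} \<alpha>"
    by (simp add: integral_unique)
qed

lemma test_function_H1: "\<phi> \<in> test_functions \<Longrightarrow> H1 \<phi> (deriv \<phi>)"
  by (rule C1_H1) (auto intro: test_functionsD(2) has_field_derivative_at_within[OF test_functionsD(1)])

lemma H1_has_weak_deriv:
  assumes "H1 a \<alpha>"
  shows "has_weak_deriv a \<alpha>"
  unfolding has_weak_deriv_def
proof (intro conjI ballI)
  show "\<alpha> \<in> L2" using assms by (rule H1_L2)
  fix \<phi> assume \<phi>: "\<phi> \<in> test_functions"
  note L = H1_fun_L2[OF assms] H1_L2[OF assms] test_functions_L2[OF \<phi>] deriv_test_functions_L2[OF \<phi>]
  have "integral {0..1} (\<lambda>x. \<alpha> x * \<phi> x + a x * deriv \<phi> x) = 0"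
    using H1_increment[OF H1_mult[OF assms test_function_H1[OF \<phi>]], of 0 1] test_functionsD(4,5)[OF \<phi>]
    by simp
  then have "integral {0..1} (\<lambda>x. \<alpha> x * \<phi> x) + integral {0..1} (\<lambda>x. a x * deriv \<phi> x) = 0"
    using L2_mult_integrable L by (subst (asm) Henstock_Kurzweil_Integration.integral_add) auto
  then show "(LINT x|M01. a x * deriv \<phi> x) = - (LINT x|M01. \<alpha> x * \<phi> x)"
    using L by (simp add: LINT_mult)
qed

lemma H1_unique: "H1 a \<alpha> \<Longrightarrow> H1 a \<beta> \<Longrightarrow> AE x in M01. \<alpha> x = \<beta> x"
  by (rule has_weak_deriv_unique[OF H1_has_weak_deriv H1_has_weak_deriv])

lemma H1_W12: "H1 a \<alpha> \<Longrightarrow> a \<in> W12"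
  using H1_has_weak_deriv H1_fun_L2 by (auto simp: W12_def)

lemma H1_weak_deriv_AE: "H1 a \<alpha> \<Longrightarrow> AE x in M01. weak_deriv a x = \<alpha> x"
  using H1_has_weak_deriv weak_deriv_AE by blast

section \<open>Representatives of Sobolev functions\<close>

lemma AE_le_continuous:
  fixes f g :: "real \<Rightarrow> real"
  assumes ae: "AE x in M01. f x \<le> g x" and c: "continuous_on {0..1} f" "continuous_on {0..1} g"
    and x: "x \<in> {0..1}"
  shows "f x \<le> g x"
proof (rule ccontr)
  assume "\<not> f x \<le> g x"
  define d where "d z = f z - g z" for z
  have "continuous_on {0..1} d"
    unfolding d_def using c by (intro continuous_intros)
  moreover have "d x > 0"
    using \<open>\<not> f x \<le> g x\<close> by (simp add: d_def)
  ultimately obtain e where e: "e > 0" "\<And>z. z \<in> {0..1} \<Longrightarrow> dist z x < e \<Longrightarrow> dist (d z) (d x) < d x"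
    using x unfolding continuous_on_iff by metis
  define s t where "s = max 0 (x - e / 2)" and "t = min 1 (x + e / 2)"
  have st: "s < t"
    using x e(1) by (auto simp: s_def t_def)
  have "{s..t} \<subseteq> {z\<in>{0..1}. \<not> f z \<le> g z}"
  proof
    fix z assume "z \<in> {s..t}"
    then have z: "z \<in> {0..1}" "dist z x < e"
      using e(1) by (auto simp: s_def t_def dist_real_def)
    then show "z \<in> {z\<in>{0..1}. \<not> f z \<le> g z}"
      using e(2)[OF z] by (auto simp: dist_real_def d_def)
  qed
  then have "negligible {s..t}"
    using AE_M01_negligible[OF ae] negligible_subset by blast
  then show False
    using st negligible_interval(1)[of s t] by simp
qed

lemma AE_eq_continuous:
  fixes f g :: "real \<Rightarrow> real"
  assumes "AE x in M01. f x = g x" "continuous_on {0..1} f" "continuous_on {0..1} g" "x \<in> {0..1}"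
  shows "f x = g x"
proof (rule antisym)
  have "AE x in M01. f x \<le> g x" "AE x in M01. g x \<le> f x"
    using assms(1) by (auto elim: eventually_mono)
  then show "f x \<le> g x" "g x \<le> f x"
    using assms AE_le_continuous by blast+
qed

section \<open>The du Bois-Reymond lemma and continuous representatives\<close>

lemma unit_test_function:
  obtains b where "b \<in> test_functions" "(LINT x|M01. b x) = 1"
proof -
  have "\<exists>\<phi>\<in>test_functions. (LINT x|M01. \<phi> x) \<noteq> 0"
  proof (rule ccontr)
    assume "\<not> ?thesis"
    then have "AE x in M01. (1::real) = 0"
      by (intro fundamental_lemma[OF L2_one]) auto
    then have "(1::real) \<le> 0"
      by (intro AE_le_continuous[where f = "\<lambda>x. 1" and g = "\<lambda>x. 0" and x = 0]) auto
    then show False by simp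
  qed
  then obtain \<phi> where \<phi>: "\<phi> \<in> test_functions" "(LINT x|M01. \<phi> x) \<noteq> 0"
    by blast
  show thesis
  proof (rule that)
    show "(\<lambda>x. 1 / (LINT x|M01. \<phi> x) * \<phi> x + 0 * \<phi> x) \<in> test_functions"
      using \<phi> by (intro test_functions_lincomb)
    show "(LINT x|M01. 1 / (LINT x|M01. \<phi> x) * \<phi> x + 0 * \<phi> x) = 1"
      using \<phi> by simp
  qed
qed

text \<open>The primitive vanishes to the left of the support, and to the right of it because the
  total integral is 0.\<close>

lemma test_function_primitive:
  fixes f :: "real \<Rightarrow> real"
  assumes c: "continuous_on UNIV f" and K: "compact K" "K \<subseteq> {0<..<1}" "\<And>x. x \<notin> K \<Longrightarrow> f x = 0"
    and 0: "integral {0..1} f = 0"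
  shows "(\<lambda>x. integral {0..x} f) \<in> test_functions" "deriv (\<lambda>x. integral {0..x} f) = f"
proof -
  define \<phi> where "\<phi> x = integral {0..x} f" for x
  obtain l r where lr: "0 < l" "l < r" "r < 1" "K \<subseteq> {l..r}"
  proof (cases "K = {}")
    case False
    have "Inf K \<in> K" "Sup K \<in> K"
      using False K(1) by (auto intro!: closed_contains_Inf closed_contains_Sup compact_imp_closed
          bounded_imp_bdd_below bounded_imp_bdd_above compact_imp_bounded)
    then have *: "0 < Inf K" "Sup K < 1"
      using K(2) by auto
    have "\<And>x. x \<in> K \<Longrightarrow> Inf K \<le> x \<and> x \<le> Sup K"
      using K(1) by (auto intro!: cInf_lower cSup_upper bounded_imp_bdd_below bounded_imp_bdd_above compact_imp_bounded)
    moreover have "Inf K \<le> Sup K"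
      using calculation \<open>Inf K \<in> K\<close> by blast
    ultimately show thesis
      using * by (intro that[of "Inf K / 2" "(Sup K + 1) / 2"]) (force+)
  qed (auto intro: that[of "1/3" "2/3"])
  have f0: "f x = 0" if "x < l \<or> x > r" for x
    using K(3) lr(4) that by force
  have fi: "f integrable_on {x..y}" for x y
    using c by (intro integrable_continuous_real) (auto intro: continuous_on_subset)
  have z1: "\<phi> x = 0" if "x < l" for x
  proof -
    have "integral {0..x} f = integral {0..x} (\<lambda>x. 0)"
      by (rule Henstock_Kurzweil_Integration.integral_cong) (use f0 that in auto)
    then show ?thesis by (simp add: \<phi>_def)
  qed
  have z2: "\<phi> x = 0" if "x > r" for x
  proof -
    have s: "integral {a..b} f = 0" if "r < a" for a b
    proof -
      have "integral {a..b} f = integral {a..b} (\<lambda>x. 0)"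
        by (rule Henstock_Kurzweil_Integration.integral_cong) (use f0 that in auto)
      then show ?thesis by simp
    qed
    show ?thesis
    proof (cases "x \<le> 1")
      case True
      then show ?thesis
        using integral_Icc_diff[OF fi, of 0 x 1] s[of x 1] 0 that lr by (simp add: \<phi>_def)
    next
      case False
      then show ?thesis
        using integral_Icc_diff[OF fi, of 0 1 x] s[of 1 x] 0 lr by (simp add: \<phi>_def)
    qed
  qed
  have D: "(\<phi> has_real_derivative f x) (at x)" for x
  proof -
    consider "x < l" | "x \<in> {0<..<1}" | "x > r"
      using lr by force
    then show ?thesis
    proof cases
      case 1
      show ?thesis
        by (rule has_field_derivative_transform_within_open[of "\<lambda>_. 0" _ _ "{..<l}"])
          (use 1 f0 z1 in auto)
    next
      case 2
      have "(\<phi> has_vector_derivative f x) (at x within {0..1})"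
        unfolding \<phi>_def using 2 continuous_on_subset[OF c]
        by (intro integral_has_vector_derivative) auto
      then show ?thesis
        using 2 by (simp add: has_real_derivative_iff_has_vector_derivative at_within_Icc_at)
    next
      case 3
      show ?thesis
        by (rule has_field_derivative_transform_within_open[of "\<lambda>_. 0" _ _ "{r<..}"])
          (use 3 f0 z2 in auto)
    qed
  qed
  have "\<phi> \<in> test_functions"
    by (rule test_functionsI[OF D c, of "{l..r}"]) (use lr z1 z2 in auto)
  moreover have "deriv \<phi> = f"
    using D by (auto intro: DERIV_imp_deriv)
  ultimately show "(\<lambda>x. integral {0..x} f) \<in> test_functions" "deriv (\<lambda>x. integral {0..x} f) = f"
    by (simp_all add: \<phi>_def[abs_def])
qed

lemma test_functions_support:
  assumes "\<phi> \<in> test_functions"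
  obtains K where "compact K" "K \<subseteq> {0<..<1}" "\<And>x. x \<notin> K \<Longrightarrow> \<phi> x = 0"
  using assms by (auto simp: test_functions_def)

text \<open>Subtracting from \<phi> a multiple of the unit-mass bump \<open>b\<close> gives mean
  zero, hence the derivative of a test function, on which v vanishes. So the pairing of v with
  \<phi> is c times the integral of \<phi>, where c is the pairing of v with
  \<open>b\<close>.\<close>

lemma weak_deriv_zero_imp_const:
  assumes v: "v \<in> L2" and 0: "\<And>\<phi>. \<phi> \<in> test_functions \<Longrightarrow> (LINT x|M01. v x * deriv \<phi> x) = 0"
  shows "\<exists>c. AE x in M01. v x = c"
proof -
  obtain b where b: "b \<in> test_functions" "(LINT x|M01. b x) = 1"
    by (rule unit_test_function)
  define c where "c = (LINT x|M01. v x * b x)"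
  have "AE x in M01. v x - c = 0"
  proof (rule fundamental_lemma)
    show "(\<lambda>x. v x - c) \<in> L2"
      using L2_diff[OF v L2_cmult[OF L2_one, of c]] by simp
    fix \<phi> assume \<phi>: "\<phi> \<in> test_functions"
    define I where "I = (LINT x|M01. \<phi> x)"
    define f where "f x = 1 * \<phi> x + (- I) * b x" for x
    have f: "f \<in> test_functions"
      unfolding f_def using \<phi> b by (intro test_functions_lincomb)
    have L: "\<phi> \<in> L2" "b \<in> L2" "f \<in> L2"
      using \<phi> b f by (auto intro: test_functions_L2)
    have i: "integrable M01 \<phi>" "integrable M01 b" "integrable M01 f"
      using L2_integrable_mult[OF _ L2_one] L by auto
    have "(LINT x|M01. f x) = I - I * 1"
      unfolding f_def using i b(2) by (simp add: I_def)
    then have f0: "integral {0..1} f = 0"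
      using integral_M01(2)[OF i(3)] by simp
    obtain K where K: "compact K" "K \<subseteq> {0<..<1}" "\<And>x. x \<notin> K \<Longrightarrow> f x = 0"
      using test_functions_support[OF f] by blast
    note p = test_function_primitive[OF test_functionsD(3)[OF f] K f0]
    have "(LINT x|M01. v x * f x) = 0"
      using 0[OF p(1)] p(2) by simp
    moreover have "(LINT x|M01. v x * f x) = (LINT x|M01. v x * \<phi> x) - I * c"
    proof -
      have "(LINT x|M01. v x * f x) = (LINT x|M01. v x * \<phi> x - I * (v x * b x))"
        by (simp add: f_def algebra_simps)
      also have "\<dots> = (LINT x|M01. v x * \<phi> x) - I * c"
        using L2_integrable_mult[OF v L(1)] L2_integrable_mult[OF v L(2)] by (simp add: c_def)
      finally show ?thesis .
    qed
    moreover have "(LINT x|M01. (v x - c) * \<phi> x) = (LINT x|M01. v x * \<phi> x) - c * I"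
      using L2_integrable_mult[OF v L(1)] i(1) by (simp add: left_diff_distrib I_def)
    ultimately show "(LINT x|M01. (v x - c) * \<phi> x) = 0"
      by (simp add: mult.commute)
  qed
  then show ?thesis
    by auto
qed

text \<open>u and a primitive of g have the same weak derivative, so they differ by a constant,
  which is absorbed into the primitive.\<close>

lemma has_weak_deriv_imp_H1:
  assumes u: "u \<in> L2" and g: "has_weak_deriv u g"
  obtains a where "H1 a g" "AE x in M01. u x = a x"
proof -
  define a where "a x = 0 + integral {0..x} g" for x
  have gL: "g \<in> L2"
    using g by (simp add: has_weak_deriv_def)
  have a: "H1 a g"
    unfolding a_def by (rule H1_primitive[OF gL])
  have "has_weak_deriv (\<lambda>x. 1 * u x + (-1) * a x) (\<lambda>x. 1 * g x + (-1) * g x)"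
    by (intro has_weak_deriv_lincomb u g H1_has_weak_deriv a H1_fun_L2[OF a])
  then have "\<exists>c. AE x in M01. 1 * u x + (-1) * a x = c"
    by (intro weak_deriv_zero_imp_const L2_lincomb u H1_fun_L2[OF a]) (simp add: has_weak_deriv_def)
  then obtain c where c: "AE x in M01. 1 * u x + (-1) * a x = c"
    by blast
  show thesis
  proof (rule that)
    show "H1 (\<lambda>x. c + integral {0..x} g) g"
      by (rule H1_primitive[OF gL])
    show "AE x in M01. u x = c + integral {0..x} g"
      using c by eventually_elim (simp add: a_def algebra_simps)
  qed
qed

text \<open>\<open>fn' u\<close> is an arbitrary member of its class; \<open>slope u\<close> is the
  representative that is continuous on [0,1]. Outside [0,1] its values are unspecified.\<close>

definition slope :: "sobolev \<Rightarrow> real \<Rightarrow> real" where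
  "slope u = (SOME p. H1 p (fn'' u) \<and> (AE x in M01. fn' u x = p x))"

lemma slope_H1: "H1 (slope u) (fn'' u)"
  and slope_AE: "AE x in M01. fn' u x = slope u x"
proof -
  have W: "fn' u \<in> W12"
    by (rule W22_D(2)[OF fn_W22])
  obtain p where "H1 p (fn'' u) \<and> (AE x in M01. fn' u x = p x)"
    using has_weak_deriv_imp_H1[OF W12_L2(1)[OF W] W12_weak_deriv[OF W]] by blast
  then have "H1 (slope u) (fn'' u) \<and> (AE x in M01. fn' u x = slope u x)"
    unfolding slope_def by (rule someI[where P = "\<lambda>p. H1 p (fn'' u) \<and> (AE x in M01. fn' u x = p x)"])
  then show "H1 (slope u) (fn'' u)" "AE x in M01. fn' u x = slope u x"
    by auto
qed

lemma slope_continuous: "continuous_on {0..1} (slope u)"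
  by (rule H1_continuous[OF slope_H1])

lemma slope_L2: "slope u \<in> L2"
  by (rule H1_fun_L2[OF slope_H1])

lemma fn''_L2: "fn'' u \<in> L2"
  by (rule H1_L2[OF slope_H1])

lemma slope_integrable: "0 \<le> x \<Longrightarrow> y \<le> 1 \<Longrightarrow> slope u integrable_on {x..y}"
  by (rule L2_integrable[OF slope_L2])

lemma norm_L2_H1_le:
  assumes "H1 a \<alpha>" "a 0 = 0"
  shows "norm_L2 a \<le> norm_L2 \<alpha>"
proof -
  have sq: "(a x)\<^sup>2 \<le> integral {0..1} (\<lambda>t. (\<alpha> t)\<^sup>2)" if "x \<in> {0..1}" for x
    using H1_oscillation[OF assms(1), of 0 x] assms(2) that by simp
  have "integral {0..1} (\<lambda>t. (a t)\<^sup>2) \<le> integral {0..1} (\<lambda>t::real. integral {0..1} (\<lambda>t. (\<alpha> t)\<^sup>2))"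
    using sq L2_square_integrable[OF H1_fun_L2[OF assms(1)]]
    by (intro Henstock_Kurzweil_Integration.integral_le) auto
  then show ?thesis
    unfolding norm_L2_def
    using LINT_square[OF H1_fun_L2[OF assms(1)]] LINT_square[OF H1_L2[OF assms(1)]] by simp
qed

text \<open>The boundary values come from approximation: the W12 norm of an absolutely continuous
  function controls its values at 0 and 1, and the approximating test functions vanish
  there.\<close>

lemma fn_H1: "H1 (fn u) (slope u)" and fn_0: "fn u 0 = 0" and fn_1: "fn u 1 = 0"
proof -
  have W: "fn u \<in> W12"
    by (rule W22_D(1)[OF fn_W22])
  obtain a where a: "H1 a (fn' u)" "AE x in M01. fn u x = a x"
    using has_weak_deriv_imp_H1[OF W12_L2(1)[OF W] W12_weak_deriv[OF W]] by blast
  have eq: "fn u x = a x" if "x \<in> {0..1}" for x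
    using AE_eq_continuous[OF a(2) fn_continuous H1_continuous[OF a(1)] that] .
  have H: "H1 (fn u) (fn' u)"
    by (rule H1_cong[OF a(1) eq])
  then show "H1 (fn u) (slope u)"
    using H1_AE_cong[OF _ slope_L2 slope_AE] by blast
  have small: "\<bar>fn u 0\<bar> < \<epsilon> \<and> \<bar>fn u 1 - fn u 0\<bar> < \<epsilon>" if "\<epsilon> > 0" for \<epsilon>
  proof -
    have "\<epsilon> / 2 > 0" using that by simp
    then obtain \<phi> where \<phi>: "\<phi> \<in> test_functions" "norm_W12 (\<lambda>x. fn u x - \<phi> x) < \<epsilon> / 2"
      using fn_W12_0[of u] unfolding W12_0_def by blast
    define d d' where "d x = 1 * fn u x + (-1) * \<phi> x" and "d' x = 1 * fn' u x + (-1) * deriv \<phi> x" for x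
    have dd: "H1 d d'"
      unfolding d_def d'_def by (intro H1_lincomb H test_function_H1 \<phi>)
    have n: "norm_L2 d < \<epsilon> / 2" "norm_L2 d' < \<epsilon> / 2"
    proof -
      have e: "norm_W12 d < \<epsilon> / 2"
        using \<phi>(2) by (simp add: d_def[abs_def])
      have "norm_L2 d \<le> norm_W12 d" "norm_L2 (weak_deriv d) \<le> norm_W12 d"
        by (auto simp: norm_W12_def norm_L2_nonneg real_le_rsqrt)
      moreover have "norm_L2 (weak_deriv d) = norm_L2 d'"
        by (intro norm_L2_cong H1_weak_deriv_AE[OF dd] H1_L2[OF dd] W12_L2(2) H1_W12[OF dd])
      ultimately show "norm_L2 d < \<epsilon> / 2" "norm_L2 d' < \<epsilon> / 2"
        using e by auto
    qed
    \<comment> \<open>Subtracting this primitive from \<open>d\<close> leaves the constant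
      \<open>d 0\<close>, whose size is therefore an L2 norm.\<close>
    define e where "e x = 0 + integral {0..x} d'" for x
    have eH: "H1 e d'"
      unfolding e_def by (rule H1_primitive[OF H1_L2[OF dd]])
    have "norm_L2 e \<le> norm_L2 d'"
      by (rule norm_L2_H1_le[OF eH]) (simp add: e_def)
    have de: "d x = d 0 + e x" if "x \<in> {0..1}" for x
      using H1_eq[OF dd that] by (simp add: e_def)
    have "\<bar>d 0\<bar> = norm_L2 (\<lambda>x. d x + (-1) * e x)"
    proof -
      have "(LINT x|M01. (d x + (-1) * e x)\<^sup>2) = (LINT x|M01. (d 0)\<^sup>2)"
      proof (rule Bochner_Integration.integral_cong[OF refl])
        fix x assume "x \<in> space M01"
        then have "d x + (-1) * e x = d 0"
          using de[of x] by simp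
        then show "(d x + (-1) * e x)\<^sup>2 = (d 0)\<^sup>2"
          by (rule arg_cong)
      qed
      also have "\<dots> = integral {0..1} (\<lambda>x::real. (d 0)\<^sup>2)"
        by (rule integral_M01) simp
      finally show ?thesis
        by (simp add: norm_L2_def)
    qed
    also have "\<dots> \<le> norm_L2 d + norm_L2 (\<lambda>x. (-1) * e x)"
      by (rule norm_L2_triangle[OF H1_fun_L2[OF dd] L2_cmult[OF H1_fun_L2[OF eH]]])
    also have "norm_L2 (\<lambda>x. (-1) * e x) = norm_L2 e"
      by (subst norm_L2_scale) simp
    finally have "\<bar>d 0\<bar> < \<epsilon>"
      using n \<open>norm_L2 e \<le> norm_L2 d'\<close> by simp
    moreover have "(d 1 - d 0)\<^sup>2 \<le> (norm_L2 d')\<^sup>2"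
      using H1_increment_square[OF dd, of 0 1] by (simp add: norm_L2_sq LINT_square H1_L2[OF dd])
    then have "\<bar>d 1 - d 0\<bar> \<le> norm_L2 d'"
      using norm_L2_nonneg[of d'] by (simp add: abs_le_square_iff[symmetric])
    ultimately show ?thesis
      using n test_functionsD(4,5)[OF \<phi>(1)] by (simp add: d_def)
  qed
  show "fn u 0 = 0"
    using small[of "\<bar>fn u 0\<bar>"] by force
  moreover have "fn u 1 - fn u 0 = 0"
    using small[of "\<bar>fn u 1 - fn u 0\<bar>"] by force
  ultimately show "fn u 1 = 0" by simp
qed

lemma fn_eq: "x \<in> {0..1} \<Longrightarrow> fn u x = integral {0..x} (slope u)"
  using H1_eq[OF fn_H1, of x u] fn_0[of u] by simp

lemma integral_slope: "integral {0..1} (slope u) = 0"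
  using fn_eq[of 1 u] fn_1[of u] by simp

text \<open>Test functions are only required to be C1, so it suffices to approximate the continuous
  slope p in L2 by continuous functions with compact support and mean zero, and to integrate them.
  The cutoffs \<kappa> n provide compact support, a multiple of a bump restores the mean.\<close>

lemma W12_0_primitive:
  assumes u: "H1 u p" and p: "continuous_on {0..1} p" and 0: "u 0 = 0" "u 1 = 0"
  shows "u \<in> W12_0"
  unfolding W12_0_def
proof (intro CollectI conjI allI impI)
  show "u \<in> W12" by (rule H1_W12[OF u])
  fix \<epsilon> :: real assume "\<epsilon> > 0"
  obtain b where b: "b \<in> test_functions" "(LINT x|M01. b x) = 1"
    by (rule unit_test_function)
  define \<kappa> where "\<kappa> n x = smooth_step (real (Suc n) * (x - 0) - 1) * smooth_step (real (Suc n) * (1 - x) - 1)"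
    for n :: nat and x
  have \<kappa>: "\<kappa> n \<in> test_functions" for n
    unfolding \<kappa>_def by (intro bump_test_function) auto
  have \<kappa>01: "0 \<le> \<kappa> n x" "\<kappa> n x \<le> 1" for n x
    unfolding \<kappa>_def using smooth_step_bounds by (auto simp: mult_le_one)
  have pL: "p \<in> L2" using p by (rule continuous_L2)
  define R where "R n x = (1 - \<kappa> n x) * p x" for n x
  have RL: "R n \<in> L2" for n
    unfolding R_def using \<kappa> by (intro L2_mult_continuous pL continuous_intros test_functionsD(3))
  have "(\<lambda>n. LINT x|M01. (R n x)\<^sup>2) \<longlonglongrightarrow> (LINT x|M01. 0)"
  proof (rule integral_dominated_convergence[where w = "\<lambda>x. (p x)\<^sup>2"])
    show "(\<lambda>x. (R n x)\<^sup>2) \<in> borel_measurable M01" for n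
      using L2_measurable[OF RL] by measurable
    show "integrable M01 (\<lambda>x. (p x)\<^sup>2)" by (rule L2_integrable_sq[OF pL])
    have "(1 - \<kappa> n x)\<^sup>2 * (p x)\<^sup>2 \<le> 1 * (p x)\<^sup>2" for n x
      using \<kappa>01[where n = n and x = x] by (intro mult_right_mono power_le_one) auto
    then show "AE x in M01. norm ((R n x)\<^sup>2) \<le> (p x)\<^sup>2" for n
      by (intro AE_I2) (simp add: R_def power_mult_distrib)
    have lim: "(\<lambda>n. smooth_step (real (Suc n) * d - 1)) \<longlonglongrightarrow> 1" if "d > 0" for d
    proof (rule filterlim_compose[OF smooth_step_tendsto])
      have "filterlim (\<lambda>n. real (Suc n)) at_top sequentially"
        by (rule filterlim_compose[OF filterlim_real_sequentially filterlim_Suc])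
      then have "filterlim (\<lambda>n. d * real (Suc n)) at_top sequentially"
        using that by (intro filterlim_tendsto_pos_mult_at_top[OF tendsto_const])
      then have "filterlim (\<lambda>n. - 1 + d * real (Suc n)) at_top sequentially"
        by (intro filterlim_tendsto_add_at_top[OF tendsto_const])
      then show "filterlim (\<lambda>n. real (Suc n) * d - 1) at_top sequentially"
        by (simp add: mult.commute)
    qed
    have "(\<lambda>n. (R n x)\<^sup>2) \<longlonglongrightarrow> ((1 - 1 * 1) * p x)\<^sup>2" if "x \<in> {0<..<1}" for x
      unfolding R_def \<kappa>_def using that by (intro tendsto_intros lim) auto
    then show "AE x in M01. (\<lambda>n. (R n x)\<^sup>2) \<longlonglongrightarrow> 0"
      by (intro AE_I2) auto
  qed simp
  then have "(\<lambda>n. (1 + norm_L2 b) * norm_L2 (R n)) \<longlonglongrightarrow> (1 + norm_L2 b) * sqrt 0"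
    unfolding norm_L2_def by (intro tendsto_intros) simp
  then obtain n where n: "(1 + norm_L2 b) * norm_L2 (R n) < \<epsilon> / 2"
    using order_tendstoD(2)[of _ "(1 + norm_L2 b) * sqrt 0" sequentially "\<epsilon> / 2"] \<open>\<epsilon> > 0\<close>
    by (auto simp: eventually_sequentially)
  define q where "q x = \<kappa> n x * p x" for x
  \<comment> \<open>Since p has mean zero, the truncated slope q has mean - c; adding
    \<open>c * b\<close> corrects this.\<close>
  define c where "c = integral {0..1} (R n)"
  have qL: "q \<in> L2"
    unfolding q_def using \<kappa> by (intro L2_mult_continuous pL test_functionsD(3))
  obtain K where K: "compact K" "K \<subseteq> {0<..<1}" "\<And>x. x \<notin> K \<Longrightarrow> \<kappa> n x = 0"
    using test_functions_support[OF \<kappa>] by blast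
  obtain L where L: "compact L" "L \<subseteq> {0<..<1}" "\<And>x. x \<notin> L \<Longrightarrow> b x = 0"
    using test_functions_support[OF b(1)] by blast
  define f where "f x = q x + c * b x" for x
  have bL: "b \<in> L2" by (rule test_functions_L2[OF b(1)])
  have "continuous_on UNIV q"
  proof -
    \<comment> \<open>p is controlled only on [0,1]; q is continuous on the line because it vanishes
      off the compact set K inside (0,1).\<close>
    have "continuous_on ({0<..<1} \<union> - K) q"
    proof (rule continuous_on_open_Un)
      show "continuous_on {0<..<1} q"
        unfolding q_def
        by (rule continuous_on_mult[OF test_functionsD(3)[OF \<kappa>] continuous_on_subset[OF p]]) auto
      have "continuous_on (- K) (\<lambda>x. 0 :: real)" by simp
      then show "continuous_on (- K) q"
        by (rule continuous_on_eq) (use K(3) in \<open>auto simp: q_def\<close>)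
    qed (use K(1) compact_imp_closed in auto)
    moreover have "{0<..<1} \<union> - K = UNIV" using K(2) by auto
    ultimately show ?thesis by simp
  qed
  then have fc: "continuous_on UNIV f"
    unfolding f_def
    by (intro continuous_on_add continuous_on_mult continuous_on_const test_functionsD(3)[OF b(1)])
  have fK: "f x = 0" if "x \<notin> K \<union> L" for x
    using that K(3) L(3) by (simp add: f_def q_def)
  have p0: "integral {0..1} p = 0"
    using H1_increment[OF u, of 0 1] 0 by simp
  have b1: "integral {0..1} b = 1"
    using integral_M01(2)[of b] L2_integrable_mult[OF bL L2_one] b(2) by simp
  have i: "p integrable_on {0..1}" "R n integrable_on {0..1}" "q integrable_on {0..1}" "b integrable_on {0..1}"
    using L2_integrable pL RL qL bL by auto
  have "integral {0..1} q = integral {0..1} (\<lambda>x. p x - R n x)"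
    by (rule arg_cong[where f = "integral {0..1}"]) (simp add: fun_eq_iff q_def R_def algebra_simps)
  also have "\<dots> = - c"
    using i p0 by (simp add: Henstock_Kurzweil_Integration.integral_diff c_def)
  finally have f0: "integral {0..1} f = 0"
    unfolding f_def using i b1 by (simp add: Henstock_Kurzweil_Integration.integral_add integrable_on_mult_right)
  have KL: "compact (K \<union> L)" "K \<union> L \<subseteq> {0<..<1}"
    using K L by auto
  define \<phi> where "\<phi> x = integral {0..x} f" for x
  have \<phi>: "\<phi> \<in> test_functions" "deriv \<phi> = f"
    using test_function_primitive[OF fc KL fK f0] by (simp_all add: \<phi>_def[abs_def])
  define d where "d x = 1 * u x + (-1) * \<phi> x" for x
  define d' where "d' x = 1 * p x + (-1) * f x" for x
  have dd: "H1 d d'"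
    unfolding d_def d'_def using test_function_H1[OF \<phi>(1)] \<phi>(2) by (intro H1_lincomb u) auto
  have "norm_L2 d' = norm_L2 (\<lambda>x. R n x + (- c) * b x)"
    by (rule arg_cong[where f = norm_L2]) (simp add: fun_eq_iff d'_def f_def q_def R_def algebra_simps)
  also have "\<dots> \<le> norm_L2 (R n) + norm_L2 (\<lambda>x. (- c) * b x)"
    by (rule norm_L2_triangle[OF RL L2_cmult[OF bL]])
  also have "norm_L2 (\<lambda>x. (- c) * b x) = \<bar>c\<bar> * norm_L2 b"
    by (subst norm_L2_scale) simp
  also have "\<bar>c\<bar> \<le> norm_L2 (R n)"
  proof -
    have "c\<^sup>2 \<le> (norm_L2 (R n))\<^sup>2"
      unfolding c_def norm_L2_sq LINT_square[OF RL] using integral_Cauchy_Schwarz[OF RL, of 0 1] by simp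
    then show ?thesis
      using norm_L2_nonneg[of "R n"] by (simp add: abs_le_square_iff[symmetric])
  qed
  then have "norm_L2 (R n) + \<bar>c\<bar> * norm_L2 b \<le> (1 + norm_L2 b) * norm_L2 (R n)"
    using norm_L2_nonneg[of b] by (simp add: algebra_simps mult_left_mono)
  finally have "norm_L2 d' < \<epsilon> / 2"
    using n by simp
  moreover have "norm_L2 d \<le> norm_L2 d'"
    by (rule norm_L2_H1_le[OF dd]) (use 0 test_functionsD(4)[OF \<phi>(1)] in \<open>simp add: d_def\<close>)
  moreover have "norm_L2 (weak_deriv d) = norm_L2 d'"
    by (intro norm_L2_cong H1_weak_deriv_AE[OF dd] H1_L2[OF dd] W12_L2(2) H1_W12[OF dd])
  moreover have "norm_W12 d \<le> norm_L2 d + norm_L2 (weak_deriv d)"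
    unfolding norm_W12_def by (rule sqrt_sum_squares_le_sum) (auto simp: norm_L2_nonneg)
  ultimately have "norm_W12 d < \<epsilon>"
    by simp
  then show "\<exists>\<phi>\<in>test_functions. norm_W12 (\<lambda>x. u x - \<phi> x) < \<epsilon>"
    using \<phi>(1) by (intro bexI[of _ \<phi>]) (simp_all add: d_def[abs_def])
qed

text \<open>Competitors and variations are prescribed by their slopes. Mean zero encodes the
  boundary value at 1, and the extension by 0 matches the representative fixed by the type.\<close>

lemma sobolev_of_slope:
  assumes p: "H1 p f" and 0: "integral {0..1} p = 0"
  obtains u where "\<And>x. x \<in> {0..1} \<Longrightarrow> slope u x = p x" "AE x in M01. fn'' u x = f x"
proof -
  define v where "v x = (if x \<in> {0..1} then integral {0..x} p else 0)" for x
  have v: "H1 v p"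
    by (rule H1_cong[OF H1_primitive[OF H1_fun_L2[OF p], of 0]]) (simp add: v_def)
  note vW = H1_W12[OF v]
  have wd: "AE x in M01. p x = weak_deriv v x"
    using H1_weak_deriv_AE[OF v] by eventually_elim simp
  have d2: "has_weak_deriv (weak_deriv v) f"
    by (rule has_weak_deriv_cong[OF H1_fun_L2[OF p] W12_L2(2)[OF vW] wd H1_has_weak_deriv[OF p]])
  then have "v \<in> W22"
    using vW W12_L2(2)[OF vW] by (auto simp: W22_def W12_def)
  moreover have "v \<in> W12_0"
    by (rule W12_0_primitive[OF v H1_continuous[OF p]]) (use 0 in \<open>auto simp: v_def\<close>)
  ultimately have "fn (Sobolev v) = v"
    using H1_continuous[OF v] by (intro Sobolev_inverse) (auto simp: v_def)
  show thesis
  proof (rule that)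
    show "AE x in M01. fn'' (Sobolev v) x = f x"
      using weak_deriv_AE[OF d2] \<open>fn (Sobolev v) = v\<close> by simp
    have "AE x in M01. slope (Sobolev v) x = p x"
      using slope_AE[of "Sobolev v"] wd unfolding \<open>fn (Sobolev v) = v\<close> by eventually_elim simp
    then show "slope (Sobolev v) x = p x" if "x \<in> {0..1}" for x
      using that by (rule AE_eq_continuous[OF _ slope_continuous H1_continuous[OF p]])
  qed
qed

lemma lincomb_slope:
  assumes "x \<in> {0..1}"
  shows "slope (a *\<^sub>R u + b *\<^sub>R v) x = a * slope u x + b * slope v x"
proof -
  have "fn (a *\<^sub>R u + b *\<^sub>R v) = (\<lambda>x. a * fn u x + b * fn v x)"
    by (simp add: plus_sobolev.rep_eq scaleR_sobolev.rep_eq)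
  then have "AE x in M01. fn' (a *\<^sub>R u + b *\<^sub>R v) x = a * fn' u x + b * fn' v x"
    using W12_lincomb(2)[OF W22_D(1)[OF fn_W22] W22_D(1)[OF fn_W22]] by simp
  then have "AE x in M01. slope (a *\<^sub>R u + b *\<^sub>R v) x = a * slope u x + b * slope v x"
    using slope_AE[of u] slope_AE[of v] slope_AE[of "a *\<^sub>R u + b *\<^sub>R v"] by eventually_elim simp
  then show ?thesis
    by (rule AE_eq_continuous) (intro continuous_intros slope_continuous assms)+
qed

lemma lincomb_fn'': "AE x in M01. fn'' (a *\<^sub>R u + b *\<^sub>R v) x = a * fn'' u x + b * fn'' v x"
proof -
  have "fn (a *\<^sub>R u + b *\<^sub>R v) = (\<lambda>x. a * fn u x + b * fn v x)"
    by (simp add: plus_sobolev.rep_eq scaleR_sobolev.rep_eq)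
  then show ?thesis
    using W22_lincomb(2)[OF fn_W22 fn_W22] by simp
qed

lemma norm_sobolev_integral: "(norm u)\<^sup>2 = integral {0..1} (\<lambda>x. (fn'' u x)\<^sup>2)"
  by (simp add: norm_sobolev_def norm_L2_sq LINT_square fn''_L2)

lemma fn_deriv:
  assumes "0 < x" "x < 1"
  shows "(fn u has_real_derivative slope u x) (at x)"
proof -
  have "((\<lambda>x. integral {0..x} (slope u)) has_vector_derivative slope u x) (at x within {0..1})"
    using assms by (intro integral_has_vector_derivative slope_continuous) auto
  then have "((\<lambda>x. integral {0..x} (slope u)) has_real_derivative slope u x) (at x)"
    using assms by (simp add: has_real_derivative_iff_has_vector_derivative at_within_Icc_at)
  then show ?thesis
    by (rule has_field_derivative_transform_within_open[of _ _ _ "{0<..<1}"])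
      (use assms fn_eq[of _ u] in auto)
qed

lemma slope_has_zero: "\<exists>z\<in>{0<..<1}. slope u z = 0"
proof -
  obtain z where "0 < z" "z < 1" "slope u z = 0"
    using Rolle_deriv[of 0 1 "fn u" "\<lambda>z. (*) (slope u z)"] fn_0[of u] fn_1[of u] fn_continuous[of u]
      fn_deriv[of _ u]
    unfolding has_field_derivative_def by (metis mult.right_neutral zero_less_one)
  then show ?thesis by auto
qed

lemma slope_le_norm:
  assumes "x \<in> {0..1}"
  shows "\<bar>slope u x\<bar> \<le> norm u"
proof -
  obtain z where z: "z \<in> {0<..<1}" "slope u z = 0"
    using slope_has_zero by blast
  have "(slope u x)\<^sup>2 \<le> (norm u)\<^sup>2"
    using H1_oscillation[OF slope_H1, of z x u] z assms by (simp add: norm_sobolev_integral)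
  then show ?thesis
    by (simp add: abs_le_square_iff[symmetric])
qed

section \<open>A dyadic criterion for square-integrable derivatives\<close>

lemma L2_Fatou:
  assumes f: "\<And>i. f i \<in> L2" and m: "h \<in> borel_measurable M01"
    and lim: "AE x in M01. (\<lambda>i. f i x) \<longlonglongrightarrow> h x"
    and C: "\<And>i. (LINT x|M01. (f i x)\<^sup>2) \<le> C"
  shows "h \<in> L2" "(LINT x|M01. (h x)\<^sup>2) \<le> C"
proof -
  have "0 \<le> (LINT x|M01. (f 0 x)\<^sup>2)" by simp
  then have C0: "0 \<le> C" using C[of 0] by linarith
  have "AE x in M01. ennreal ((h x)\<^sup>2) = liminf (\<lambda>i. ennreal ((f i x)\<^sup>2))"
    using lim
  proof eventually_elim
    case (elim x)
    then have "(\<lambda>i. ennreal ((f i x)\<^sup>2)) \<longlonglongrightarrow> ennreal ((h x)\<^sup>2)"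
      by (intro tendsto_ennrealI tendsto_intros)
    from lim_imp_Liminf[OF sequentially_bot this] show ?case
      by (rule sym)
  qed
  then have "(\<integral>\<^sup>+x. ennreal ((h x)\<^sup>2) \<partial>M01) = (\<integral>\<^sup>+x. liminf (\<lambda>i. ennreal ((f i x)\<^sup>2)) \<partial>M01)"
    by (rule nn_integral_cong_AE)
  also have "\<dots> \<le> liminf (\<lambda>i. \<integral>\<^sup>+x. ennreal ((f i x)\<^sup>2) \<partial>M01)"
    using L2_measurable[OF f] by (intro nn_integral_liminf) measurable
  also have "(\<lambda>i. \<integral>\<^sup>+x. ennreal ((f i x)\<^sup>2) \<partial>M01) = (\<lambda>i. ennreal (LINT x|M01. (f i x)\<^sup>2))"
    using L2_integrable_sq[OF f] by (intro ext nn_integral_eq_integral) auto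
  also have "liminf \<dots> \<le> ennreal C"
    using C by (intro Liminf_le always_eventually allI ennreal_leI) auto
  finally have le: "(\<integral>\<^sup>+x. ennreal ((h x)\<^sup>2) \<partial>M01) \<le> ennreal C" .
  have i: "integrable M01 (\<lambda>x. (h x)\<^sup>2)"
    using m le by (intro integrableI_bounded) (auto simp: le_less_trans[OF _ ennreal_less_top])
  then show "h \<in> L2"
    using m by (simp add: L2_def)
  have "ennreal (LINT x|M01. (h x)\<^sup>2) \<le> ennreal C"
    using le nn_integral_eq_integral[OF i] by simp
  then show "(LINT x|M01. (h x)\<^sup>2) \<le> C"
    using C0 by simp
qed

lemma L2_sum:
  assumes "finite A" "\<And>i. i \<in> A \<Longrightarrow> f i \<in> L2"
  shows "(\<lambda>x. \<Sum>i\<in>A. f i x) \<in> L2"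
  using assms by (induction A rule: finite_induct) (auto simp: L2_zero L2_add)

definition dyadic :: "nat \<Rightarrow> nat \<Rightarrow> real" where
  "dyadic n i = real i / 2 ^ n"

definition dyadic_increment :: "(real \<Rightarrow> real) \<Rightarrow> nat \<Rightarrow> nat \<Rightarrow> real" where
  "dyadic_increment v n i = v (dyadic n (Suc i)) - v (dyadic n i)"

text \<open>The Dirichlet integral of the piecewise linear interpolant on 2^n equal cells. As a
  finite sum of squared increments it passes to pointwise limits.\<close>

definition dyadic_energy :: "(real \<Rightarrow> real) \<Rightarrow> nat \<Rightarrow> real" where
  "dyadic_energy v n = (\<Sum>i<2 ^ n. 2 ^ n * (dyadic_increment v n i)\<^sup>2)"

definition dyadic_slope :: "(real \<Rightarrow> real) \<Rightarrow> nat \<Rightarrow> real \<Rightarrow> real" where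
  "dyadic_slope v n x = (\<Sum>i<2 ^ n. indicator {dyadic n i..<dyadic n (Suc i)} x * (2 ^ n * dyadic_increment v n i))"

lemma dyadic_0: "dyadic n 0 = 0" and dyadic_top: "dyadic n (2 ^ n) = 1"
  and dyadic_nonneg: "0 \<le> dyadic n i"
  and dyadic_step: "dyadic n (Suc i) - dyadic n i = 1 / 2 ^ n"
  by (auto simp: dyadic_def diff_divide_distrib[symmetric])

lemma dyadic_mono: "i \<le> j \<Longrightarrow> dyadic n i \<le> dyadic n j"
  by (simp add: dyadic_def divide_right_mono)

lemma dyadic_le_1: "i \<le> 2 ^ n \<Longrightarrow> dyadic n i \<le> 1"
  using dyadic_mono[of i "2 ^ n" n] by (simp add: dyadic_top)

lemma dyadic_refine: "dyadic (Suc n) (2 * i) = dyadic n i"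
  by (simp add: dyadic_def)

lemma dyadic_slope_eq:
  assumes "i < 2 ^ n" "x \<in> {dyadic n i..<dyadic n (Suc i)}"
  shows "dyadic_slope v n x = 2 ^ n * dyadic_increment v n i"
proof -
  have "indicator {dyadic n j..<dyadic n (Suc j)} x = (if j = i then 1 else 0 :: real)" for j
  proof (cases j i rule: linorder_cases)
    case less
    then have "dyadic n (Suc j) \<le> dyadic n i" by (intro dyadic_mono) simp
    then show ?thesis using less assms(2) by (auto simp: indicator_def)
  next
    case greater
    then have "dyadic n (Suc i) \<le> dyadic n j" by (intro dyadic_mono) simp
    then show ?thesis using greater assms(2) by (auto simp: indicator_def)
  qed (use assms(2) in auto)
  then have "dyadic_slope v n x = (\<Sum>j<2 ^ n. if j = i then 2 ^ n * dyadic_increment v n j else 0)"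
    unfolding dyadic_slope_def by (intro sum.cong) auto
  then show ?thesis
    using assms(1) by simp
qed

lemma dyadic_slope_L2: "dyadic_slope v n \<in> L2"
proof -
  have "(\<lambda>x. indicator {dyadic n i..<dyadic n (Suc i)} x * (2 ^ n * dyadic_increment v n i)) \<in> L2" for i
    using L2_indicator[OF L2_cmult[OF L2_one]] by simp
  then show ?thesis
    unfolding dyadic_slope_def[abs_def] by (intro L2_sum) auto
qed

lemma integral_dyadic_split:
  assumes "f integrable_on {0..1::real}"
  shows "integral {0..1} f = (\<Sum>i<2 ^ n. integral {dyadic n i..dyadic n (Suc i)} f :: real)"
proof -
  define I where "I x = integral {0..x} f" for x
  have fi: "f integrable_on {0..x}" if "x \<le> 1" for x
    using assms that by (auto intro: integrable_subinterval_real)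
  have "(\<Sum>i<2 ^ n. integral {dyadic n i..dyadic n (Suc i)} f) = (\<Sum>i<2 ^ n. I (dyadic n (Suc i)) - I (dyadic n i))"
  proof (rule sum.cong[OF refl])
    fix i :: nat assume "i \<in> {..<2 ^ n}"
    then show "integral {dyadic n i..dyadic n (Suc i)} f = I (dyadic n (Suc i)) - I (dyadic n i)"
      unfolding I_def
      by (intro integral_Icc_diff[symmetric] fi dyadic_le_1 dyadic_nonneg dyadic_mono) auto
  qed
  also have "\<dots> = I 1 - I 0"
    using sum_lessThan_telescope[of "\<lambda>i. I (dyadic n i)" "2 ^ n"] by (simp add: dyadic_0 dyadic_top)
  finally show ?thesis
    by (simp add: I_def)
qed

lemma integral_dyadic_slope_mult:
  assumes "f \<in> L2"
  shows "integral {0..1} (\<lambda>x. dyadic_slope v n x * f x)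
    = (\<Sum>i<2 ^ n. 2 ^ n * dyadic_increment v n i * integral {dyadic n i..dyadic n (Suc i)} f)"
proof -
  have "integral {0..1} (\<lambda>x. dyadic_slope v n x * f x)
      = (\<Sum>i<2 ^ n. integral {dyadic n i..dyadic n (Suc i)} (\<lambda>x. dyadic_slope v n x * f x))"
    by (intro integral_dyadic_split L2_mult_integrable dyadic_slope_L2 assms) auto
  also have "\<dots> = (\<Sum>i<2 ^ n. 2 ^ n * dyadic_increment v n i * integral {dyadic n i..dyadic n (Suc i)} f)"
  proof (rule sum.cong[OF refl])
    fix i :: nat assume i: "i \<in> {..<2 ^ n}"
    have "integral {dyadic n i..dyadic n (Suc i)} (\<lambda>x. dyadic_slope v n x * f x)
        = integral {dyadic n i..dyadic n (Suc i)} (\<lambda>x. 2 ^ n * dyadic_increment v n i * f x)"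
      by (rule integral_spike[of "{dyadic n (Suc i)}"]) (use i in \<open>auto simp: dyadic_slope_eq\<close>)
    then show "integral {dyadic n i..dyadic n (Suc i)} (\<lambda>x. dyadic_slope v n x * f x)
        = 2 ^ n * dyadic_increment v n i * integral {dyadic n i..dyadic n (Suc i)} f"
      by simp
  qed
  finally show ?thesis .
qed

lemma integral_dyadic_slope:
  assumes "n \<le> m" "i < 2 ^ n"
  shows "integral {dyadic n i..dyadic n (Suc i)} (dyadic_slope v m) = dyadic_increment v n i"
  using assms
\<comment> \<open>Induction runs downwards from level m: a cell of level n is the union of the cells
  2 i and 2 i + 1 of level n + 1.\<close>
proof (induction arbitrary: i rule: inc_induct)
  case base
  have "integral {dyadic m i..dyadic m (Suc i)} (dyadic_slope v m)
      = integral {dyadic m i..dyadic m (Suc i)} (\<lambda>x. 2 ^ m * dyadic_increment v m i)"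
    by (rule integral_spike[of "{dyadic m (Suc i)}"]) (use base in \<open>auto simp: dyadic_slope_eq\<close>)
  also have "\<dots> = dyadic_increment v m i"
    using dyadic_step[of m i] dyadic_mono[of i "Suc i" m] by simp
  finally show ?case .
next
  case (step n)
  let ?a = "dyadic (Suc n) (2 * i)" and ?b = "dyadic (Suc n) (Suc (2 * i))" and ?c = "dyadic (Suc n) (Suc (Suc (2 * i)))"
  have ac: "dyadic n i = ?a" "dyadic n (Suc i) = ?c"
    using dyadic_refine[of n "Suc i"] by (auto simp: dyadic_refine)
  have i: "Suc (Suc (2 * i)) \<le> 2 ^ Suc n"
    using step.prems by simp
  have "integral {?a..?b} (dyadic_slope v m) + integral {?b..?c} (dyadic_slope v m) = integral {?a..?c} (dyadic_slope v m)"
    using i by (intro Henstock_Kurzweil_Integration.integral_combine dyadic_mono L2_integrable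
        dyadic_slope_L2 dyadic_nonneg dyadic_le_1) auto
  moreover have "integral {?a..?b} (dyadic_slope v m) = dyadic_increment v (Suc n) (2 * i)"
    "integral {?b..?c} (dyadic_slope v m) = dyadic_increment v (Suc n) (Suc (2 * i))"
    using i step.IH by auto
  ultimately show ?case
    by (simp add: ac dyadic_increment_def)
qed

text \<open>The martingale property: on a coarse cell the finer slope has the same integral as the
  coarse one, so pairing with the coarse slope cannot tell them apart. The Pythagorean identity for
  differences of levels follows.\<close>

lemma integral_dyadic_slope_product:
  assumes "n \<le> m"
  shows "integral {0..1} (\<lambda>x. dyadic_slope v n x * dyadic_slope v m x) = dyadic_energy v n"
  unfolding integral_dyadic_slope_mult[OF dyadic_slope_L2] dyadic_energy_def
  using assms by (intro sum.cong) (auto simp: integral_dyadic_slope power2_eq_square)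

lemma integral_dyadic_slope_diff:
  assumes "n \<le> m"
  shows "(LINT x|M01. (dyadic_slope v m x - dyadic_slope v n x)\<^sup>2) = dyadic_energy v m - dyadic_energy v n"
proof -
  let ?g = "dyadic_slope v"
  have i: "integrable M01 (\<lambda>x. ?g k x * ?g l x)" for k l
    by (intro L2_integrable_mult dyadic_slope_L2)
  have e: "(LINT x|M01. ?g k x * ?g l x) = dyadic_energy v k" if "k \<le> l" for k l
    using that by (simp add: LINT_mult dyadic_slope_L2 integral_dyadic_slope_product)
  have "(LINT x|M01. (?g m x - ?g n x)\<^sup>2) = (LINT x|M01. ?g m x * ?g m x - 2 * (?g n x * ?g m x) + ?g n x * ?g n x)"
    by (intro Bochner_Integration.integral_cong) (auto simp: power2_eq_square algebra_simps)
  also have "\<dots> = dyadic_energy v m - 2 * dyadic_energy v n + dyadic_energy v n"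
    using i e[of m m] e[OF assms] e[of n n] by simp
  finally show ?thesis by simp
qed

lemma continuous_zero_dyadic:
  fixes F :: "real \<Rightarrow> real"
  assumes c: "continuous_on {0..1} F" and 0: "\<And>n i. i \<le> 2 ^ n \<Longrightarrow> F (dyadic n i) = 0" and x: "x \<in> {0..1}"
  shows "F x = 0"
proof -
  define k where "k n = nat \<lfloor>x * 2 ^ n\<rfloor>" for n :: nat
  have k: "real (k n) = of_int \<lfloor>x * 2 ^ n\<rfloor>" for n
    using x by (simp add: k_def)
  have le: "k n \<le> 2 ^ n" for n
  proof -
    have "x * 2 ^ n \<le> 1 * 2 ^ n" using x by (intro mult_right_mono) auto
    then have "real (k n) \<le> real (2 ^ n)"
      unfolding k using order_trans[OF of_int_floor_le[of "x * 2 ^ n"], of "1 * 2 ^ n"] by simp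
    then show ?thesis by (simp only: of_nat_le_iff)
  qed
  have d: "\<bar>dyadic n (k n) - x\<bar> \<le> (1/2) ^ n" for n
  proof -
    have "\<bar>real (k n) - x * 2 ^ n\<bar> \<le> 1"
      unfolding k by linarith
    then have "\<bar>real (k n) - x * 2 ^ n\<bar> / 2 ^ n \<le> 1 / 2 ^ n"
      by (intro divide_right_mono) auto
    moreover have "\<bar>real (k n) - x * 2 ^ n\<bar> / 2 ^ n = \<bar>(real (k n) - x * 2 ^ n) / 2 ^ n\<bar>"
      by (simp add: abs_divide)
    ultimately show ?thesis
      by (simp add: dyadic_def power_one_over diff_divide_distrib)
  qed
  have "(\<lambda>n. dyadic n (k n) - x) \<longlonglongrightarrow> 0"
    by (rule Lim_null_comparison[of _ "\<lambda>n. (1/2) ^ n"]) (use d in \<open>auto intro: LIMSEQ_realpow_zero\<close>)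
  then have "(\<lambda>n. dyadic n (k n)) \<longlonglongrightarrow> x"
    by (simp add: LIM_zero_iff)
  then have "(\<lambda>n. F (dyadic n (k n))) \<longlonglongrightarrow> F x"
    by (rule continuous_on_tendsto_compose[OF c _ x])
      (use le in \<open>auto intro!: always_eventually simp: dyadic_nonneg dyadic_le_1\<close>)
  then show ?thesis
    using 0[OF le] by (simp add: LIMSEQ_const_iff)
qed

text \<open>The difference quotients on dyadic partitions form a martingale that is bounded in \<open>L\<^sup>2\<close>.\<close>

theorem H1_of_dyadic_energy:
  assumes v: "continuous_on {0..1} v" and K: "\<And>n. dyadic_energy v n \<le> K"
  obtains g where "H1 v g" "integral {0..1} (\<lambda>x. (g x)\<^sup>2) \<le> K"
proof -
  let ?g = "dyadic_slope v" and ?s = "dyadic_energy v"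
  note gL = dyadic_slope_L2[of v]
  have mono: "?s n \<le> ?s m" if "n \<le> m" for n m
  proof -
    have "0 \<le> (LINT x|M01. (?g m x - ?g n x)\<^sup>2)" by simp
    then show ?thesis using integral_dyadic_slope_diff[OF that, of v] by simp
  qed
  then have "incseq ?s" by (simp add: incseq_def)
  then obtain S where S: "?s \<longlonglongrightarrow> S" "\<And>n. ?s n \<le> S"
    using incseq_convergent[of ?s K] K by auto
  have SK: "S \<le> K"
    using S(1) K by (intro LIMSEQ_le_const2) auto
  have L1: "(LINT x|M01. \<bar>?g m x - ?g n x\<bar>) \<le> sqrt (?s m - ?s n)" if "n \<le> m" for n m
  proof (rule real_le_rsqrt)
    have L: "(\<lambda>x. ?g m x - ?g n x) \<in> L2" by (intro L2_diff gL)
    have "(LINT x|M01. \<bar>?g m x - ?g n x\<bar>) = integral {0..1} (\<lambda>x. \<bar>?g m x - ?g n x\<bar>)"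
      using L2_integrable_mult[OF L2_abs[OF L] L2_one] by (intro integral_M01) simp
    then show "(LINT x|M01. \<bar>?g m x - ?g n x\<bar>)\<^sup>2 \<le> ?s m - ?s n"
      using integral_abs_Cauchy_Schwarz[OF L, of 0 1] LINT_square[OF L] integral_dyadic_slope_diff[OF that, of v]
      by simp
  qed
  \<comment> \<open>The energies increase to a limit, so the slopes are Cauchy in L2 and hence in
    L1; a subsequence then converges almost everywhere.\<close>
  obtain r where r: "strict_mono r" "AE x in M01. Cauchy (\<lambda>i. ?g (r i) x)"
  proof (rule cauchy_L1_AE_cauchy_subseq[where M = M01 and s = ?g])
    show "integrable M01 (?g n)" for n
      using L2_integrable_mult[OF gL L2_one] by simp
    fix e :: real assume e: "e > 0"
    then obtain N where N: "\<And>n. n \<ge> N \<Longrightarrow> S - ?s n < e\<^sup>2"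
      using order_tendstoD(1)[OF S(1), of "S - e\<^sup>2"] by (auto simp: eventually_sequentially algebra_simps)
    have *: "(LINT x|M01. \<bar>?g m x - ?g n x\<bar>) < e" if "N \<le> n" "n \<le> m" for n m
    proof -
      have "?s m - ?s n < e\<^sup>2" using N[OF that(1)] S(2)[of m] by simp
      then have "sqrt (?s m - ?s n) < e"
        using e by (simp add: real_less_lsqrt)
      then show ?thesis using L1[OF that(2)] by simp
    qed
    show "\<exists>N. \<forall>i\<ge>N. \<forall>j\<ge>N. LINT x|M01. norm (?g i x - ?g j x) < e"
    proof (intro exI[of _ N] allI impI)
      fix i j assume "N \<le> i" "N \<le> j"
      then show "LINT x|M01. norm (?g i x - ?g j x) < e"
        using *[of i j] *[of j i] by (cases "i \<le> j") (auto simp: abs_minus_commute)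
    qed
  qed blast
  define h where "h x = lim (\<lambda>i. ?g (r i) x)" for x
  have hm: "h \<in> borel_measurable M01"
    unfolding h_def using L2_measurable[OF gL] by measurable
  have hlim: "AE x in M01. (\<lambda>i. ?g (r i) x) \<longlonglongrightarrow> h x"
    using r(2) by eventually_elim (simp add: h_def Cauchy_convergent convergent_LIMSEQ_iff[symmetric])
  have "(LINT x|M01. (?g n x)\<^sup>2) \<le> S" for n
    using integral_dyadic_slope_product[of n n v] S(2)[of n] LINT_square[OF gL[of n]]
    by (simp add: power2_eq_square)
  then have hL: "h \<in> L2" and hS: "(LINT x|M01. (h x)\<^sup>2) \<le> S"
    using L2_Fatou[OF gL hm hlim, of S] by auto
  \<comment> \<open>Shifting by n keeps every index at least n, so that the identity for the energy
    difference applies along the whole subsequence.\<close>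
  have rn: "n \<le> r (i + n)" for i n
    using seq_suble[OF r(1), of "i + n"] by simp
  have diff: "(LINT x|M01. (h x - ?g n x)\<^sup>2) \<le> S - ?s n" for n
  proof (rule L2_Fatou(2)[where f = "\<lambda>i x. ?g (r (i + n)) x - ?g n x"])
    show "(\<lambda>x. ?g (r (i + n)) x - ?g n x) \<in> L2" for i by (intro L2_diff gL)
    show "(\<lambda>x. h x - ?g n x) \<in> borel_measurable M01"
      using hm L2_measurable[OF gL] by measurable
    show "AE x in M01. (\<lambda>i. ?g (r (i + n)) x - ?g n x) \<longlonglongrightarrow> h x - ?g n x"
      using hlim by eventually_elim (intro tendsto_intros LIMSEQ_ignore_initial_segment)
    show "(LINT x|M01. (?g (r (i + n)) x - ?g n x)\<^sup>2) \<le> S - ?s n" for i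
      using integral_dyadic_slope_diff[of n "r (i + n)" v, OF rn] S(2) by simp
  qed
  \<comment> \<open>At a dyadic point of level n, the slopes of all levels m \<ge> n integrate to v
    exactly. So F measures there only the L2 distance of h from these slopes, which tends to 0;
    continuity does the rest.\<close>
  define F where "F x = v x - v 0 - integral {0..x} h" for x
  have "F x = 0" if "x \<in> {0..1}" for x
  proof (rule continuous_zero_dyadic[OF _ _ that])
    show "continuous_on {0..1} F"
      unfolding F_def using L2_integrable[OF hL]
      by (intro continuous_intros v indefinite_integral_continuous_1) auto
    fix n i :: nat assume i: "i \<le> 2 ^ n"
    define x where "x = dyadic n i"
    have x: "0 \<le> x" "x \<le> 1" using i by (auto simp: x_def dyadic_nonneg dyadic_le_1)
    have gi: "integral {0..x} (?g m) = v x - v 0" if "n \<le> m" for m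
    proof -
      define I where "I y = integral {0..y} (?g m)" for y
      have "I (dyadic n i) = v (dyadic n i) - v 0"
        using i
      proof (induction i)
        case (Suc i)
        have "I (dyadic n (Suc i)) - I (dyadic n i) = integral {dyadic n i..dyadic n (Suc i)} (?g m)"
          unfolding I_def using Suc.prems
          by (intro integral_Icc_diff L2_integrable gL dyadic_nonneg dyadic_mono dyadic_le_1) auto
        also have "\<dots> = dyadic_increment v n i"
          using Suc.prems that by (intro integral_dyadic_slope) auto
        finally show ?case
          using Suc by (simp add: dyadic_increment_def)
      qed (simp add: I_def dyadic_0)
      then show ?thesis by (simp add: I_def x_def)
    qed
    have "(F x)\<^sup>2 \<le> S - ?s m" if "n \<le> m" for m
    proof -
      have L: "(\<lambda>x. h x - ?g m x) \<in> L2" by (intro L2_diff hL gL)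
      have "integral {0..x} (\<lambda>x. h x - ?g m x) = - F x"
        using L2_integrable[OF hL, of 0 x] L2_integrable[OF gL, of 0 x m] x gi[OF that]
        by (simp add: Henstock_Kurzweil_Integration.integral_diff F_def)
      then have "(F x)\<^sup>2 = (integral {0..x} (\<lambda>x. h x - ?g m x))\<^sup>2"
        by simp
      also have "\<dots> \<le> x * integral {0..x} (\<lambda>x. (h x - ?g m x)\<^sup>2)"
        using integral_Cauchy_Schwarz[OF L, of 0 x] x by simp
      also have "\<dots> \<le> 1 * integral {0..1} (\<lambda>x. (h x - ?g m x)\<^sup>2)"
        using x L2_square_integrable[OF L]
        by (intro mult_mono integral_subset_le integral_square_nonneg) auto
      also have "\<dots> \<le> S - ?s m"
        using diff[of m] LINT_square[OF L] by simp
      finally show ?thesis .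
    qed
    moreover have "(\<lambda>m. S - ?s m) \<longlonglongrightarrow> S - S"
      by (intro tendsto_intros S(1))
    ultimately have "(F x)\<^sup>2 \<le> S - S"
      by (intro LIMSEQ_le_const) auto
    then show "F (dyadic n i) = 0"
      by (simp add: x_def)
  qed
  then have "v x = v 0 + integral {0..x} h" if "x \<in> {0..1}" for x
    using that unfolding F_def by (metis add.commute diff_add_cancel diff_eq_eq right_minus_eq)
  then have "H1 v h"
    by (rule H1I[OF hL])
  then show thesis
    using that hS SK LINT_square[OF hL] by simp
qed

lemma dyadic_energy_le:
  assumes inc: "\<And>x y. 0 \<le> x \<Longrightarrow> x \<le> y \<Longrightarrow> y \<le> 1 \<Longrightarrow> (v y - v x)\<^sup>2 \<le> (y - x) * (\<Phi> y - \<Phi> x)"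
  shows "dyadic_energy v n \<le> \<Phi> 1 - \<Phi> 0"
proof -
  have "dyadic_energy v n \<le> (\<Sum>i<2 ^ n. \<Phi> (dyadic n (Suc i)) - \<Phi> (dyadic n i))"
    unfolding dyadic_energy_def
  proof (rule sum_mono)
    fix i :: nat assume i: "i \<in> {..<2 ^ n}"
    have "(dyadic_increment v n i)\<^sup>2 \<le> (1 / 2 ^ n) * (\<Phi> (dyadic n (Suc i)) - \<Phi> (dyadic n i))"
      unfolding dyadic_increment_def dyadic_step[of n i, symmetric]
      using i by (intro inc dyadic_nonneg dyadic_mono dyadic_le_1) auto
    then show "2 ^ n * (dyadic_increment v n i)\<^sup>2 \<le> \<Phi> (dyadic n (Suc i)) - \<Phi> (dyadic n i)"
      by (simp add: field_simps)
  qed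
  also have "\<dots> = \<Phi> 1 - \<Phi> 0"
    using sum_lessThan_telescope[of "\<lambda>i. \<Phi> (dyadic n i)" "2 ^ n"] by (simp add: dyadic_0 dyadic_top)
  finally show ?thesis .
qed

lemma H1_dyadic_energy_le:
  assumes "H1 v g"
  shows "dyadic_energy v n \<le> integral {0..1} (\<lambda>x. (g x)\<^sup>2)"
proof -
  have "dyadic_energy v n \<le> integral {0..1} (\<lambda>x. (g x)\<^sup>2) - integral {0..0} (\<lambda>x. (g x)\<^sup>2)"
  proof (rule dyadic_energy_le)
    fix x y :: real assume xy: "0 \<le> x" "x \<le> y" "y \<le> 1"
    have "integral {0..y} (\<lambda>x. (g x)\<^sup>2) - integral {0..x} (\<lambda>x. (g x)\<^sup>2) = integral {x..y} (\<lambda>x. (g x)\<^sup>2)"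
      using xy by (intro integral_Icc_diff L2_square_integrable[OF H1_L2[OF assms]]) auto
    then show "(v y - v x)\<^sup>2 \<le> (y - x) * (integral {0..y} (\<lambda>x. (g x)\<^sup>2) - integral {0..x} (\<lambda>x. (g x)\<^sup>2))"
      using H1_increment_square[OF assms xy] by simp
  qed
  then show ?thesis by simp
qed

text \<open>For the symmetrized function only a bound on increments is at hand, with \<Phi> in the
  role of the integral of the squared derivative; the derivative and its energy bound come out
  together.\<close>

lemma H1_of_increments:
  assumes inc: "\<And>x y. 0 \<le> x \<Longrightarrow> x \<le> y \<Longrightarrow> y \<le> 1 \<Longrightarrow> (v y - v x)\<^sup>2 \<le> (y - x) * (\<Phi> y - \<Phi> x)"
    and v: "continuous_on {0..1} v"
  obtains g where "H1 v g" "integral {0..1} (\<lambda>x. (g x)\<^sup>2) \<le> \<Phi> 1 - \<Phi> 0"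
  using H1_of_dyadic_energy[OF v dyadic_energy_le[of v \<Phi>, OF inc]] by metis

section \<open>The function \<open>G\<close> and existence of minimizers\<close>

lemma C1_imp_Lipschitz:
  fixes f :: "real \<Rightarrow> real"
  assumes der: "\<And>z. z \<in> {l..u} \<Longrightarrow> (f has_real_derivative f' z) (at z within {l..u})"
    and c: "continuous_on {l..u} f'"
  obtains L where "L \<ge> 0" "\<And>z w. z \<in> {l..u} \<Longrightarrow> w \<in> {l..u} \<Longrightarrow> \<bar>f z - f w\<bar> \<le> L * \<bar>z - w\<bar>"
proof -
  have "compact (f' ` {l..u})"
    using c by (intro compact_continuous_image) auto
  then obtain B where B: "\<forall>y\<in>f' ` {l..u}. norm y \<le> B"
    using compact_imp_bounded bounded_iff by metis
  show thesis
  proof (rule that[of "max B 0"])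
    fix z w assume zw: "z \<in> {l..u}" "w \<in> {l..u}"
    have "norm (f' x) \<le> max B 0" if "x \<in> {l..u}" for x
      using B that by (auto simp: le_max_iff_disj)
    then have "norm (f z - f w) \<le> max B 0 * norm (z - w)"
      using zw der by (intro field_differentiable_bound[of "{l..u}" f f']) auto
    then show "\<bar>f z - f w\<bar> \<le> max B 0 * \<bar>z - w\<bar>" by simp
  qed simp
qed

lemma H1_compose_C2:
  assumes a: "H1 a \<alpha>" and rng: "\<And>x. x \<in> {0..1} \<Longrightarrow> a x \<in> {l..u}"
    and f: "\<And>z. z \<in> {l..u} \<Longrightarrow> (f has_real_derivative f' z) (at z)"
    and f': "\<And>z. z \<in> {l..u} \<Longrightarrow> (f' has_real_derivative f'' z) (at z)"
    and f'': "continuous_on {l..u} f''"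
  shows "H1 (\<lambda>x. f (a x)) (\<lambda>x. f' (a x) * \<alpha> x)"
proof -
  obtain L where L: "L \<ge> 0" "\<And>z w. z \<in> {l..u} \<Longrightarrow> w \<in> {l..u} \<Longrightarrow> \<bar>f' z - f' w\<bar> \<le> L * \<bar>z - w\<bar>"
    by (rule C1_imp_Lipschitz[OF has_field_derivative_at_within[OF f'] f''], assumption, rule that)
  show ?thesis
    by (rule H1_compose[OF a rng has_field_derivative_at_within[OF f] L(2,1)])
qed

lemma H1_compose_real:
  assumes a: "H1 a \<alpha>"
    and f: "\<And>z. (f has_real_derivative f' z) (at z)"
    and f': "\<And>z. (f' has_real_derivative f'' z) (at z)"
    and f'': "continuous_on UNIV f''"
  shows "H1 (\<lambda>x. f (a x)) (\<lambda>x. f' (a x) * \<alpha> x)"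
proof -
  obtain B where B: "\<And>x. x \<in> {0..1} \<Longrightarrow> \<bar>a x\<bar> \<le> B"
    using H1_bounded[OF a] by blast
  have "a x \<in> {- B..B}" if "x \<in> {0..1}" for x
    using B[OF that] by auto
  then show ?thesis
    by (rule H1_compose_C2[OF a _ f f' continuous_on_subset[OF f'']]) auto
qed

text \<open>The reciprocal of the derivative of \<open>G\<close>, hence the derivative of
  \<open>inv G\<close> along the range of \<open>G\<close>.\<close>

definition weight :: "real \<Rightarrow> real" where
  "weight s = (1 + s\<^sup>2) powr (5 / 4)"

definition weight' :: "real \<Rightarrow> real" where
  "weight' s = 5 / 2 * s * (1 + s\<^sup>2) powr (1 / 4)"

definition weight'' :: "real \<Rightarrow> real" where
  "weight'' s = 5 / 2 * (1 + s\<^sup>2) powr (1 / 4) + 5 / 4 * s\<^sup>2 * (1 + s\<^sup>2) powr (- 3 / 4)"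

lemma one_plus_square_pos: "0 < 1 + (s::real)\<^sup>2"
  by (simp add: add_pos_nonneg)

lemma weight_ge_1: "1 \<le> weight s"
  unfolding weight_def by (intro ge_one_powr_ge_zero) auto

lemma weight_pos: "0 < weight s"
  using weight_ge_1[of s] by linarith

lemma weight_neq_0: "weight s \<noteq> 0"
  using weight_pos[of s] by linarith

lemma weight_minus: "weight (- s) = weight s"
  by (simp add: weight_def)

lemma weight_square: "(weight s)\<^sup>2 = (1 + s\<^sup>2) powr (5 / 2)"
  by (simp add: weight_def power2_eq_square flip: powr_add)

lemma DERIV_weight: "(weight has_real_derivative weight' s) (at s)"
proof -
  have "((\<lambda>s. (1 + s\<^sup>2) powr (5 / 4)) has_real_derivative 5 / 4 * (1 + s\<^sup>2) powr (5 / 4 - 1) * (2 * s)) (at s)"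
    using one_plus_square_pos[of s] by (auto intro!: derivative_eq_intros)
  then show ?thesis
    by (simp add: weight_def[abs_def] weight'_def mult_ac)
qed

lemma DERIV_weight': "(weight' has_real_derivative weight'' s) (at s)"
proof -
  have "((\<lambda>s. 5 / 2 * s * (1 + s\<^sup>2) powr (1 / 4)) has_real_derivative
      5 / 2 * (1 + s\<^sup>2) powr (1 / 4) + 5 / 2 * s * (1 / 4 * (1 + s\<^sup>2) powr (1 / 4 - 1) * (2 * s))) (at s)"
    using one_plus_square_pos[of s] by (auto intro!: derivative_eq_intros)
  then show ?thesis
    by (simp add: weight'_def[abs_def] weight''_def power2_eq_square mult_ac)
qed

lemma continuous_weight'': "continuous_on A weight''"
  unfolding weight''_def using one_plus_square_pos by (intro continuous_intros) (auto simp: less_imp_neq[symmetric])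

lemma continuous_weight: "continuous_on A weight" and continuous_weight': "continuous_on A weight'"
  by (intro continuous_at_imp_continuous_on ballI DERIV_isCont[OF DERIV_weight] DERIV_isCont[OF DERIV_weight'])+

lemma DERIV_G: "(G has_real_derivative 1 / weight s) (at s)"
proof -
  let ?f = "\<lambda>t::real. (1 + t\<^sup>2) powr (- 5 / 4)"
  define R where "R = \<bar>s\<bar> + 1"
  have "((\<lambda>u. LBINT t=ereal 0..u. ?f t) has_vector_derivative ?f s) (at s within {- R..R})"
    using one_plus_square_pos
    by (intro interval_integral_FTC2 continuous_intros) (auto simp: R_def less_imp_neq[symmetric])
  then have "(G has_real_derivative ?f s) (at s within {- R..R})"
    by (simp add: has_real_derivative_iff_has_vector_derivative G_def[abs_def] zero_ereal_def)
  moreover have "at s within {- R..R} = at s"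
    by (rule at_within_Icc_at) (auto simp: R_def)
  moreover have "?f s = 1 / weight s"
    by (simp add: weight_def powr_minus_divide)
  ultimately show ?thesis by simp
qed

lemma G_strict_mono: "strict_mono G"
proof (rule strict_monoI)
  fix s t :: real assume "s < t"
  then show "G s < G t"
  proof (rule DERIV_pos_imp_increasing)
    fix x
    show "\<exists>y. (G has_real_derivative y) (at x) \<and> y > 0"
      by (rule exI[of _ "1 / weight x"]) (simp add: DERIV_G weight_pos)
  qed
qed

lemma G_less_iff [simp]: "G s < G t \<longleftrightarrow> s < t"
  and G_le_iff [simp]: "G s \<le> G t \<longleftrightarrow> s \<le> t"
  and G_eq_iff [simp]: "G s = G t \<longleftrightarrow> s = t"
  using G_strict_mono by (auto simp: strict_mono_less strict_mono_less_eq strict_mono_eq)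

lemma G_0 [simp]: "G 0 = 0"
  by (simp add: G_def zero_ereal_def)

lemma G_minus [simp]: "G (- s) = - G s"
proof -
  have "((\<lambda>s. G s + G (- s)) has_real_derivative 1 / weight x + 1 / weight (- x) * (- 1)) (at x)" for x
    by (intro DERIV_add DERIV_G DERIV_chain2[OF DERIV_G]) (auto intro!: derivative_eq_intros)
  then have "((\<lambda>s. G s + G (- s)) has_real_derivative 0) (at x)" for x
    by (simp add: weight_minus)
  then have "G s + G (- s) = G 0 + G (- 0)"
    by (intro DERIV_isconst_all) auto
  then show ?thesis by simp
qed

lemma continuous_G: "continuous_on A G"
  by (intro continuous_at_imp_continuous_on ballI DERIV_isCont[OF DERIV_G])

lemma abs_G_le_iff: "\<bar>G s\<bar> \<le> G R \<longleftrightarrow> \<bar>s\<bar> \<le> R"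
  using G_le_iff[of s R] G_le_iff[of "- s" R] by (simp add: abs_le_iff del: G_le_iff)

lemma inv_G_G [simp]: "inv G (G s) = s"
  using G_strict_mono by (simp add: strict_mono_imp_inj_on)

text \<open>\<open>G\<close> is bounded, so \<open>inv G\<close> is meaningful only on its range;
  bounds by some \<open>G R\<close> are carried along to certify that values lie there.\<close>

lemma G_surj_on:
  assumes "\<bar>y\<bar> \<le> G R"
  obtains s where "\<bar>s\<bar> \<le> R" "y = G s"
proof -
  have "G (- R) \<le> y" "y \<le> G R" using assms by (simp_all add: abs_le_iff)
  moreover from this have "G (- R) \<le> G R" by linarith
  then have "- R \<le> R" by (simp only: G_le_iff)
  ultimately obtain s where "- R \<le> s" "s \<le> R" "G s = y"
    using IVT'[of G "- R" y R] continuous_G by blast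
  then show thesis by (intro that[of s]) auto
qed

lemma DERIV_inv_G: "(inv G has_real_derivative weight s) (at (G s))"
proof -
  have "isCont (inv G) (G s)"
    by (rule isCont_inverse_function2[of "s - 1" s "s + 1"]) (auto intro: DERIV_isCont[OF DERIV_G])
  then have "(inv G has_real_derivative inverse (1 / weight s)) (at (G s))"
  proof (rule DERIV_inverse_function[rotated -1])
    show "(G has_real_derivative 1 / weight s) (at (inv G (G s)))"
      by (simp add: DERIV_G)
    define R where "R = \<bar>s\<bar> + 1"
    show "G (- R) < G s" "G s < G R" by (auto simp: R_def)
    show "G (inv G y) = y" if "G (- R) < y" "y < G R" for y
    proof -
      have "\<bar>y\<bar> \<le> G R" using that by (simp add: abs_le_iff)
      then show ?thesis by (rule G_surj_on) simp
    qed
  qed (simp add: weight_neq_0)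
  then show ?thesis by simp
qed

lemma H1_G: "H1 a \<alpha> \<Longrightarrow> H1 (\<lambda>x. G (a x)) (\<lambda>x. \<alpha> x / weight (a x))"
proof -
  assume a: "H1 a \<alpha>"
  have "((\<lambda>z. 1 / weight z) has_real_derivative - weight' z / (weight z)\<^sup>2) (at z)" for z
    using weight_neq_0[of z]
    by (auto intro!: derivative_eq_intros DERIV_weight simp: power2_eq_square)
  moreover have "continuous_on UNIV (\<lambda>z. - weight' z / (weight z)\<^sup>2)"
    by (intro continuous_intros continuous_weight continuous_weight') (auto simp: weight_neq_0)
  ultimately have "H1 (\<lambda>x. G (a x)) (\<lambda>x. 1 / weight (a x) * \<alpha> x)"
    by (rule H1_compose_real[OF a DERIV_G])
  then show ?thesis by simp
qed

lemma H1_weight: "H1 a \<alpha> \<Longrightarrow> H1 (\<lambda>x. weight (a x)) (\<lambda>x. weight' (a x) * \<alpha> x)"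
  by (rule H1_compose_real[OF _ DERIV_weight DERIV_weight' continuous_weight''])

lemma H1_inv_G:
  assumes V: "H1 V v" and rng: "\<And>x. x \<in> {0..1} \<Longrightarrow> \<bar>V x\<bar> \<le> G R"
  shows "H1 (\<lambda>x. inv G (V x)) (\<lambda>x. weight (inv G (V x)) * v x)"
proof (rule H1_compose_C2[OF V, where l = "- G R" and u = "G R" and f' = "\<lambda>y. weight (inv G y)"
      and f'' = "\<lambda>y. weight' (inv G y) * weight (inv G y)"])
  show "V x \<in> {- G R..G R}" if "x \<in> {0..1}" for x
    using rng[OF that] by (auto simp: abs_le_iff)
  fix z assume "z \<in> {- G R..G R}"
  then have "\<bar>z\<bar> \<le> G R" by (auto simp: abs_le_iff)
  then obtain s where s: "z = G s" by (rule G_surj_on)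
  show D: "(inv G has_real_derivative weight (inv G z)) (at z)"
    using DERIV_inv_G[of s] by (simp add: s)
  show "((\<lambda>y. weight (inv G y)) has_real_derivative weight' (inv G z) * weight (inv G z)) (at z)"
    by (rule DERIV_chain2[OF DERIV_weight D])
next
  have "isCont (inv G) z" if "z \<in> {- G R..G R}" for z
  proof -
    have "\<bar>z\<bar> \<le> G R" using that by (auto simp: abs_le_iff)
    then obtain s where s: "z = G s" by (rule G_surj_on)
    show ?thesis unfolding s by (rule DERIV_isCont[OF DERIV_inv_G])
  qed
  then have c: "continuous_on {- G R..G R} (inv G)"
    by (intro continuous_at_imp_continuous_on ballI)
  show "continuous_on {- G R..G R} (\<lambda>y. weight' (inv G y) * weight (inv G y))"
    by (intro continuous_intros continuous_on_compose2[OF continuous_weight c]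
        continuous_on_compose2[OF continuous_weight' c]) auto
qed

text \<open>The curvature of the graph times the fourth root of 1 + p^2: its square integrated over
  x is the squared curvature integrated over arc length.\<close>

definition curv :: "sobolev \<Rightarrow> real \<Rightarrow> real" where
  "curv u x = fn'' u x / weight (slope u x)"

lemma G_slope_H1: "H1 (\<lambda>x. G (slope u x)) (curv u)"
  unfolding curv_def by (rule H1_G[OF slope_H1])

lemma curv_L2: "curv u \<in> L2"
  by (rule H1_L2[OF G_slope_H1])

lemma elastic_energy_curv: "elastic_energy u = integral {0..1} (\<lambda>x. (curv u x)\<^sup>2)"
proof -
  have "elastic_energy u = (LINT x|M01. (curv u x)\<^sup>2)"
    unfolding elastic_energy_def
  proof (rule integral_cong_AE)
    show "(\<lambda>x. (curv u x)\<^sup>2) \<in> borel_measurable M01"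
      using L2_measurable[OF curv_L2] by measurable
    show "(\<lambda>x. (fn'' u x)\<^sup>2 / (1 + (fn' u x)\<^sup>2) powr (5 / 2)) \<in> borel_measurable M01"
      using L2_measurable[OF fn''_L2] L2_measurable[OF W12_L2(2)[OF W22_D(1)[OF fn_W22]]] by measurable
    show "AE x in M01. (fn'' u x)\<^sup>2 / (1 + (fn' u x)\<^sup>2) powr (5 / 2) = (curv u x)\<^sup>2"
      using slope_AE[of u] by eventually_elim (simp add: curv_def power_divide weight_square)
  qed
  then show ?thesis
    by (simp add: LINT_square curv_L2)
qed

lemma G_slope_square_le:
  assumes "x \<in> {0..1}"
  shows "(G (slope u x))\<^sup>2 \<le> elastic_energy u"
proof -
  obtain z where z: "z \<in> {0<..<1}" "slope u z = 0"
    using slope_has_zero by blast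
  then show ?thesis
    using H1_oscillation[OF G_slope_H1, of z x u] assms by (simp add: elastic_energy_curv)
qed

lemma slope_le_of_energy:
  assumes "elastic_energy u \<le> (G R)\<^sup>2" "0 \<le> R" "x \<in> {0..1}"
  shows "\<bar>slope u x\<bar> \<le> R"
proof -
  have "(G (slope u x))\<^sup>2 \<le> (G R)\<^sup>2"
    using G_slope_square_le[OF assms(3), of u] assms(1) by linarith
  moreover have "0 \<le> G R" using G_le_iff[of 0 R] assms(2) by simp
  ultimately have "\<bar>G (slope u x)\<bar> \<le> G R"
    by (simp add: abs_le_square_iff[symmetric])
  then show ?thesis by (simp add: abs_G_le_iff)
qed

lemma sobolev_of_G_slope:
  assumes V: "H1 V v" and rng: "\<And>x. x \<in> {0..1} \<Longrightarrow> \<bar>V x\<bar> \<le> G R" and 0: "integral {0..1} (\<lambda>x. inv G (V x)) = 0"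
  obtains u where "\<And>x. x \<in> {0..1} \<Longrightarrow> slope u x = inv G (V x)"
    "elastic_energy u = integral {0..1} (\<lambda>x. (v x)\<^sup>2)"
proof -
  obtain u where u: "\<And>x. x \<in> {0..1} \<Longrightarrow> slope u x = inv G (V x)"
    by (rule sobolev_of_slope[OF H1_inv_G[OF V rng] 0], assumption, rule that)
  have "G (slope u x) = V x" if x: "x \<in> {0..1}" for x
    unfolding u[OF x] using rng[OF x] by (rule G_surj_on) simp
  then have "H1 (\<lambda>x. G (slope u x)) v"
    by (rule H1_cong[OF V])
  then have "AE x in M01. curv u x = v x"
    by (rule H1_unique[OF G_slope_H1])
  then have "AE x in M01. (curv u x)\<^sup>2 = (v x)\<^sup>2"
    by eventually_elim simp
  then have "elastic_energy u = integral {0..1} (\<lambda>x. (v x)\<^sup>2)"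
    unfolding elastic_energy_curv by (rule integral_cong_AE_M01) auto
  then show thesis
    using that u by blast
qed

section \<open>The obstacle condition and the direct method\<close>

lemma admissible_iff:
  assumes "continuous_on {0..1} \<psi>"
  shows "u \<in> admissible \<psi> \<longleftrightarrow> (\<forall>x\<in>{0..1}. \<psi> x \<le> fn u x)"
proof
  assume "u \<in> admissible \<psi>"
  then have "AE x in M01. \<psi> x \<le> fn u x"
    by (simp add: admissible_def)
  from AE_le_continuous[OF this assms fn_continuous] show "\<forall>x\<in>{0..1}. \<psi> x \<le> fn u x"
    by (rule ballI)
next
  assume "\<forall>x\<in>{0..1}. \<psi> x \<le> fn u x"
  then show "u \<in> admissible \<psi>"
    by (auto simp: admissible_def intro!: AE_I2)
qed

theorem minimizer_exists:
  assumes \<psi>: "continuous_on {0..1} \<psi>" and u0: "u0 \<in> admissible \<psi>" "elastic_energy u0 \<le> (G R)\<^sup>2" and R: "0 \<le> R"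
  obtains u where "minimizer \<psi> u" "elastic_energy u \<le> (G R)\<^sup>2"
proof -
  define m where "m = Inf (elastic_energy ` admissible \<psi>)"
  have bdd: "bdd_below (elastic_energy ` admissible \<psi>)"
    by (rule bdd_belowI[of _ 0]) (auto simp: elastic_energy_curv integral_square_nonneg)
  have m: "m \<le> elastic_energy v" if "v \<in> admissible \<psi>" for v
    unfolding m_def using bdd that by (intro cInf_lower) auto
  have "\<exists>v\<in>admissible \<psi>. elastic_energy v \<le> m + 1 / real (Suc n) \<and> elastic_energy v \<le> (G R)\<^sup>2" for n
  proof -
    have "m < m + 1 / real (Suc n)" by simp
    then obtain v where v: "v \<in> admissible \<psi>" "elastic_energy v < m + 1 / real (Suc n)"
      unfolding m_def using u0(1)
        cInf_lessD[of "elastic_energy ` admissible \<psi>" "Inf (elastic_energy ` admissible \<psi>) + 1 / real (Suc n)"]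
      by auto
    \<comment> \<open>Whichever of v and \<open>u0\<close> has less energy satisfies both
      bounds.\<close>
    then show ?thesis
      using u0 by (cases "elastic_energy v \<le> elastic_energy u0") (force intro: bexI[of _ v] bexI[of _ u0])+
  qed
  then obtain w where w: "\<And>n. w n \<in> admissible \<psi>" "\<And>n. elastic_energy (w n) \<le> m + 1 / real (Suc n)"
    "\<And>n. elastic_energy (w n) \<le> (G R)\<^sup>2"
    by metis
  define W where "W n x = G (slope (w n) x)" for n x
  have sl: "\<bar>slope (w n) x\<bar> \<le> R" if "x \<in> {0..1}" for n x
    using slope_le_of_energy[OF w(3) R that] .
  have Wb: "\<bar>W n x\<bar> \<le> G R" if "x \<in> {0..1}" for n x
    unfolding W_def abs_G_le_iff using sl that by blast
  have GR: "0 \<le> G R" using G_le_iff[of 0 R] R by simp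
  have Hol: "\<bar>W n y - W n x\<bar> \<le> G R * sqrt \<bar>y - x\<bar>" if "x \<in> {0..1}" "y \<in> {0..1}" for n x y
  proof -
    have "(W n y - W n x)\<^sup>2 \<le> \<bar>y - x\<bar> * integral {0..1} (\<lambda>t. (curv (w n) t)\<^sup>2)"
      unfolding W_def by (rule H1_increment_square_le[OF G_slope_H1 that])
    also have "\<dots> \<le> \<bar>y - x\<bar> * (G R)\<^sup>2"
      using w(3)[of n] by (intro mult_left_mono) (auto simp: elastic_energy_curv)
    finally have "sqrt ((W n y - W n x)\<^sup>2) \<le> sqrt (\<bar>y - x\<bar> * (G R)\<^sup>2)"
      by (rule real_sqrt_le_mono)
    then show ?thesis
      using GR by (simp add: real_sqrt_mult mult.commute)
  qed
  have "\<exists>V k. continuous_on {0..1} V \<and> strict_mono (k :: nat \<Rightarrow> nat) \<and>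
    (\<forall>e>0. \<exists>N. \<forall>n x. n \<ge> N \<and> x \<in> {0..1} \<longrightarrow> norm (W (k n) x - V x) < e)"
  proof (rule Arzela_Ascoli[of "{0..1::real}" W "G R"])
    show "compact {0..1::real}" by simp
    show "norm (W n x) \<le> G R" if "x \<in> {0..1}" for n x
      using Wb[OF that] by simp
  next
    fix x e :: real assume x: "x \<in> {0..1}" and e: "0 < e"
    define d where "d = (e / (G R + 1))\<^sup>2"
    have d: "d > 0" using e GR by (simp add: d_def)
    have "norm (W n x - W n y) < e" if "y \<in> {0..1}" "norm (x - y) < d" for n y
    proof -
      have "sqrt \<bar>x - y\<bar> < sqrt d"
        using that by simp
      also have "sqrt d = e / (G R + 1)"
        using e GR by (simp add: d_def)
      finally have "G R * sqrt \<bar>x - y\<bar> \<le> G R * (e / (G R + 1))"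
        using GR by (intro mult_left_mono) auto
      also have "\<dots> < e"
        using GR e by (simp add: field_simps)
      finally show ?thesis
        using Hol[OF that(1) x, of n] by simp
    qed
    then show "\<exists>d>0. \<forall>n y. y \<in> {0..1} \<and> norm (x - y) < d \<longrightarrow> norm (W n x - W n y) < e"
      using d by blast
  next
    fix g k
    assume "continuous_on {0..1} g" "strict_mono (k :: nat \<Rightarrow> nat)"
      "\<And>e. 0 < e \<Longrightarrow> \<exists>N. \<forall>n x. n \<ge> N \<and> x \<in> {0..1} \<longrightarrow> norm (W (k n) x - g x) < e"
    then show ?thesis by blast
  qed
  then obtain V k where V: "continuous_on {0..1} V" and k: "strict_mono (k :: nat \<Rightarrow> nat)"
    and unif: "\<And>e. 0 < e \<Longrightarrow> \<exists>N. \<forall>n x. n \<ge> N \<and> x \<in> {0..1} \<longrightarrow> norm (W (k n) x - V x) < e"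
    by auto
  have lim: "(\<lambda>n. W (k n) x) \<longlonglongrightarrow> V x" if "x \<in> {0..1}" for x
    unfolding LIMSEQ_iff using unif that by blast
  have Vb: "\<bar>V x\<bar> \<le> G R" if "x \<in> {0..1}" for x
    by (rule LIMSEQ_le_const2[OF tendsto_rabs[OF lim[OF that]]]) (use Wb that in auto)
  \<comment> \<open>Lower semicontinuity at a fixed level is convergence of a finite sum; the bound
    m does not depend on the level.\<close>
  have "dyadic_energy V n \<le> m" for n
  proof -
    have "(\<lambda>j. dyadic_energy (W (k j)) n) \<longlonglongrightarrow> dyadic_energy V n"
      unfolding dyadic_energy_def dyadic_increment_def
      by (intro tendsto_intros lim) (auto simp: dyadic_nonneg intro!: dyadic_le_1)
    moreover have "(\<lambda>j. m + 1 / real (Suc (k j))) \<longlonglongrightarrow> m + 0"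
      using LIMSEQ_subseq_LIMSEQ[OF LIMSEQ_inverse_real_of_nat k]
      by (intro tendsto_intros) (simp add: o_def inverse_eq_divide)
    moreover have "dyadic_energy (W (k j)) n \<le> m + 1 / real (Suc (k j))" for j
      using H1_dyadic_energy_le[OF G_slope_H1[of "w (k j)"], of n] w(2)[of "k j"]
      by (simp add: W_def[abs_def] elastic_energy_curv)
    ultimately show ?thesis
      using LIMSEQ_le[of "\<lambda>j. dyadic_energy (W (k j)) n"] by fastforce
  qed
  then obtain g where g: "H1 V g" "integral {0..1} (\<lambda>x. (g x)\<^sup>2) \<le> m"
    using H1_of_dyadic_energy[OF V] by metis
  have slim: "(\<lambda>j. slope (w (k j)) x) \<longlonglongrightarrow> inv G (V x)" if x: "x \<in> {0..1}" for x
  proof -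
    obtain s where s: "V x = G s" using Vb[OF x] by (rule G_surj_on)
    have "isCont (inv G) (V x)" unfolding s by (rule DERIV_isCont[OF DERIV_inv_G])
    then have "(\<lambda>j. inv G (W (k j) x)) \<longlonglongrightarrow> inv G (V x)"
      using lim[OF x] by (rule isCont_tendsto_compose)
    then show ?thesis by (simp add: W_def)
  qed
  \<comment> \<open>The common bound R on the slopes allows dominated convergence, which transfers
    both the boundary value at 1 and the obstacle condition to the limit.\<close>
  have ilim: "(\<lambda>j. integral {0..x} (slope (w (k j)))) \<longlonglongrightarrow> integral {0..x} (\<lambda>x. inv G (V x))"
    if x: "x \<in> {0..1}" for x
    by (rule dominated_convergence(2)[where h = "\<lambda>_. R"])
      (use x sl slim slope_integrable in auto)
  have "integral {0..1} (\<lambda>x. inv G (V x)) = 0"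
    using ilim[of 1] integral_slope by (simp add: LIMSEQ_const_iff)
  then obtain u where u: "\<And>x. x \<in> {0..1} \<Longrightarrow> slope u x = inv G (V x)"
    "elastic_energy u = integral {0..1} (\<lambda>x. (g x)\<^sup>2)"
    using sobolev_of_G_slope[OF g(1) Vb] by metis
  have "\<psi> x \<le> fn u x" if x: "x \<in> {0..1}" for x
  proof -
    have "fn u x = integral {0..x} (\<lambda>x. inv G (V x))"
      unfolding fn_eq[OF x] by (rule Henstock_Kurzweil_Integration.integral_cong) (use x u in auto)
    then have "(\<lambda>j. fn (w (k j)) x) \<longlonglongrightarrow> fn u x"
      using ilim[OF x] fn_eq[OF x] by simp
    then show ?thesis
      by (rule LIMSEQ_le_const) (use w(1) admissible_iff[OF \<psi>] x in auto)
  qed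
  then have adm: "u \<in> admissible \<psi>"
    by (simp add: admissible_iff[OF \<psi>])
  have "minimizer \<psi> u"
    unfolding minimizer_def using adm m u(2) g(2) by fastforce
  moreover have "elastic_energy u \<le> (G R)\<^sup>2"
    using u(2) g(2) m[OF u0(1)] u0(2) by linarith
  ultimately show thesis using that by blast
qed

section \<open>The first variation\<close>

definition energy_density :: "real \<Rightarrow> real" where
  "energy_density s = (1 + s\<^sup>2) powr (- 5 / 2)"

definition energy_density' :: "real \<Rightarrow> real" where
  "energy_density' s = - 5 * s * (1 + s\<^sup>2) powr (- 7 / 2)"

definition energy_density'' :: "real \<Rightarrow> real" where
  "energy_density'' s = - 5 * (1 + s\<^sup>2) powr (- 7 / 2) + 35 * s\<^sup>2 * (1 + s\<^sup>2) powr (- 9 / 2)"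

lemma DERIV_energy_density: "(energy_density has_real_derivative energy_density' s) (at s)"
proof -
  have "((\<lambda>s. (1 + s\<^sup>2) powr (- 5 / 2)) has_real_derivative - 5 / 2 * (1 + s\<^sup>2) powr (- 5 / 2 - 1) * (2 * s)) (at s)"
    using one_plus_square_pos[of s] by (auto intro!: derivative_eq_intros)
  then show ?thesis
    by (simp add: energy_density_def[abs_def] energy_density'_def mult_ac)
qed

lemma DERIV_energy_density': "(energy_density' has_real_derivative energy_density'' s) (at s)"
proof -
  have "((\<lambda>s. - 5 * s * (1 + s\<^sup>2) powr (- 7 / 2)) has_real_derivative
      - 5 * (1 + s\<^sup>2) powr (- 7 / 2) + - 5 * s * (- 7 / 2 * (1 + s\<^sup>2) powr (- 7 / 2 - 1) * (2 * s))) (at s)"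
    using one_plus_square_pos[of s] by (auto intro!: derivative_eq_intros)
  then show ?thesis
    by (simp add: energy_density'_def[abs_def] energy_density''_def power2_eq_square mult_ac)
qed

lemma energy_density_weight: "energy_density s = 1 / (weight s)\<^sup>2"
  by (simp add: energy_density_def weight_square powr_minus_divide)

lemma energy_density'_weight: "energy_density' s = - 2 * weight' s / (weight s) ^ 3"
proof (rule DERIV_unique[OF DERIV_energy_density])
  have "((\<lambda>s. 1 / (weight s)\<^sup>2) has_real_derivative - 2 * weight' s / (weight s) ^ 3) (at s)"
    using weight_neq_0[of s]
    by (auto intro!: derivative_eq_intros DERIV_weight simp: power2_eq_square power3_eq_cube field_simps)
  then show "(energy_density has_real_derivative - 2 * weight' s / (weight s) ^ 3) (at s)"
    by (simp add: energy_density_weight[abs_def])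
qed

text \<open>This crude decay absorbs a factor s or s^2; it yields the constants 5 and 40 = 5 + 35 in
  the bounds that follow.\<close>

lemma one_plus_square_powr_le: "r \<le> - 1 \<Longrightarrow> (1 + s\<^sup>2) powr r \<le> 1 / (1 + (s::real)\<^sup>2)"
  using powr_mono[of r "-1" "1 + s\<^sup>2"] one_plus_square_pos[of s] by (simp add: powr_minus_divide)

lemma energy_density_bounds: "0 \<le> energy_density s" "energy_density s \<le> 1"
proof -
  show "0 \<le> energy_density s" by (simp add: energy_density_def)
  have "(1 + s\<^sup>2) powr (- 5 / 2) \<le> (1 + s\<^sup>2) powr 0"
    by (intro powr_mono) auto
  then show "energy_density s \<le> 1"
    using one_plus_square_pos[of s] by (simp add: energy_density_def)
qed

lemma energy_density'_bound: "\<bar>energy_density' s\<bar> \<le> 5"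
proof -
  have "\<bar>s\<bar> * (1 + s\<^sup>2) powr (- 7 / 2) \<le> \<bar>s\<bar> * (1 / (1 + s\<^sup>2))"
    by (intro mult_left_mono one_plus_square_powr_le) auto
  also have "\<dots> \<le> 1"
  proof -
    have "0 \<le> (\<bar>s\<bar> - 1)\<^sup>2" by simp
    then have "2 * \<bar>s\<bar> \<le> 1 + s\<^sup>2" by (simp add: power2_diff)
    then have "\<bar>s\<bar> \<le> 1 + s\<^sup>2" by linarith
    then show ?thesis using one_plus_square_pos[of s] by (simp add: divide_le_eq)
  qed
  finally show ?thesis by (simp add: energy_density'_def abs_mult)
qed

lemma energy_density''_bound: "\<bar>energy_density'' s\<bar> \<le> 40"
proof -
  have "(1 + s\<^sup>2) powr (- 7 / 2) \<le> 1 / (1 + s\<^sup>2)"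
    by (intro one_plus_square_powr_le) auto
  also have "\<dots> \<le> 1" using one_plus_square_pos[of s] by (simp add: divide_le_eq)
  finally have a: "(1 + s\<^sup>2) powr (- 7 / 2) \<le> 1" .
  have "s\<^sup>2 * (1 + s\<^sup>2) powr (- 9 / 2) \<le> s\<^sup>2 * (1 / (1 + s\<^sup>2))"
    by (intro mult_left_mono one_plus_square_powr_le) auto
  also have "\<dots> \<le> 1" using one_plus_square_pos[of s] by (simp add: divide_le_eq)
  finally have b: "s\<^sup>2 * (1 + s\<^sup>2) powr (- 9 / 2) \<le> 1" .
  have "0 \<le> (1 + s\<^sup>2) powr (- 7 / 2)" "0 \<le> s\<^sup>2 * (1 + s\<^sup>2) powr (- 9 / 2)"
    by auto
  then show ?thesis
    unfolding energy_density''_def using a b by (simp only: abs_le_iff mult.assoc) linarith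
qed

lemma energy_density_Lipschitz: "\<bar>energy_density s - energy_density t\<bar> \<le> 5 * \<bar>s - t\<bar>"
  using field_differentiable_bound[of UNIV energy_density energy_density' 5 s t] DERIV_energy_density energy_density'_bound by simp

lemma energy_density'_Lipschitz: "\<bar>energy_density' s - energy_density' t\<bar> \<le> 40 * \<bar>s - t\<bar>"
  using field_differentiable_bound[of UNIV energy_density' energy_density'' 40 s t] DERIV_energy_density' energy_density''_bound by simp

lemma energy_density_Taylor: "\<bar>energy_density (p + a) - energy_density p - energy_density' p * a\<bar> \<le> 40 * a\<^sup>2"
proof -
  have mv: "\<exists>z. \<bar>z - p\<bar> \<le> \<bar>a\<bar> \<and> energy_density (p + a) - energy_density p = energy_density' z * a"
  proof (cases a "0::real" rule: linorder_cases)
    case less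
    then obtain z where "p + a < z" "z < p" "energy_density p - energy_density (p + a) = (p - (p + a)) * energy_density' z"
      using MVT2[of "p + a" p energy_density energy_density'] DERIV_energy_density by auto
    then show ?thesis by (intro exI[of _ z]) (auto simp: algebra_simps)
  next
    case greater
    then obtain z where "p < z" "z < p + a" "energy_density (p + a) - energy_density p = (p + a - p) * energy_density' z"
      using MVT2[of p "p + a" energy_density energy_density'] DERIV_energy_density by auto
    then show ?thesis by (intro exI[of _ z]) (auto simp: algebra_simps)
  qed auto
  then obtain z where z: "\<bar>z - p\<bar> \<le> \<bar>a\<bar>" "energy_density (p + a) - energy_density p = energy_density' z * a"
    by blast
  have "\<bar>energy_density (p + a) - energy_density p - energy_density' p * a\<bar> = \<bar>energy_density' z - energy_density' p\<bar> * \<bar>a\<bar>"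
    unfolding z(2) abs_mult[symmetric] by (simp add: algebra_simps)
  also have "\<dots> \<le> (40 * \<bar>a\<bar>) * \<bar>a\<bar>"
    using energy_density'_Lipschitz[of z p] z(1) by (intro mult_right_mono) auto
  finally show ?thesis by (simp add: power2_eq_square)
qed

text \<open>The remainder splits into f^2 times a Taylor error, a mixed term and a term quadratic in
  b. The mixed term is shared between f^2 a^2 and b^2 by the arithmetic-geometric inequality, so the
  coefficients are 40 + 5 and 5 + 1, both at most 45.\<close>

lemma energy_density_remainder:
  "\<bar>(f + b)\<^sup>2 * energy_density (p + a) - f\<^sup>2 * energy_density p - (2 * f * b * energy_density p + f\<^sup>2 * energy_density' p * a)\<bar>
    \<le> 45 * (f\<^sup>2 * a\<^sup>2 + b\<^sup>2)"
proof -
  define T where "T = energy_density (p + a) - energy_density p - energy_density' p * a"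
  define S where "S = energy_density (p + a) - energy_density p"
  have eq: "(f + b)\<^sup>2 * energy_density (p + a) - f\<^sup>2 * energy_density p - (2 * f * b * energy_density p + f\<^sup>2 * energy_density' p * a)
      = f\<^sup>2 * T + 2 * (f * b) * S + b\<^sup>2 * energy_density (p + a)"
    by (simp add: T_def S_def power2_eq_square algebra_simps)
  have 1: "\<bar>f\<^sup>2 * T\<bar> \<le> 40 * (f\<^sup>2 * a\<^sup>2)"
    using energy_density_Taylor[of p a] mult_left_mono[of "\<bar>T\<bar>" "40 * a\<^sup>2" "f\<^sup>2"] by (simp add: abs_mult T_def)
  have "\<bar>2 * (f * b) * S\<bar> = 2 * \<bar>f * b\<bar> * \<bar>S\<bar>"
    by (simp add: abs_mult)
  also have "\<dots> \<le> 2 * \<bar>f * b\<bar> * (5 * \<bar>a\<bar>)"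
    using energy_density_Lipschitz[of "p + a" p] by (intro mult_left_mono) (auto simp: S_def)
  also have "\<dots> = 5 * (2 * \<bar>f * a\<bar> * \<bar>b\<bar>)"
    by (simp add: abs_mult)
  also have "\<dots> \<le> 5 * (\<bar>f * a\<bar>\<^sup>2 + \<bar>b\<bar>\<^sup>2)"
    by (intro mult_left_mono sum_squares_bound) auto
  finally have 2: "\<bar>2 * (f * b) * S\<bar> \<le> 5 * (f\<^sup>2 * a\<^sup>2 + b\<^sup>2)"
    by (simp add: power_mult_distrib)
  have 3: "\<bar>b\<^sup>2 * energy_density (p + a)\<bar> \<le> b\<^sup>2"
    using energy_density_bounds[of "p + a"] mult_left_mono[of "energy_density (p + a)" 1 "b\<^sup>2"] by (simp add: abs_mult)
  have "\<bar>A + B + C\<bar> \<le> 45 * (P + Q)"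
    if "\<bar>A\<bar> \<le> 40 * P" "\<bar>B\<bar> \<le> 5 * (P + Q)" "\<bar>C\<bar> \<le> Q" for A B C P Q :: real
  proof -
    have "0 \<le> Q" using that(3) abs_ge_zero[of C] by (rule order_trans[rotated])
    have "\<bar>A + B + C\<bar> \<le> \<bar>A\<bar> + \<bar>B\<bar> + \<bar>C\<bar>"
      by (rule order_trans[OF abs_triangle_ineq add_right_mono[OF abs_triangle_ineq]])
    also have "\<dots> \<le> 40 * P + 5 * (P + Q) + Q"
      by (intro add_mono that)
    also have "\<dots> \<le> 45 * (P + Q)"
      using \<open>0 \<le> Q\<close> by simp
    finally show ?thesis .
  qed
  from this[OF 1 2 3] show ?thesis
    unfolding eq .
qed

definition first_variation :: "sobolev \<Rightarrow> sobolev \<Rightarrow> real" where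
  "first_variation u \<phi> = integral {0..1} (\<lambda>x. 2 * fn'' u x * fn'' \<phi> x * energy_density (slope u x)
     + (fn'' u x)\<^sup>2 * energy_density' (slope u x) * slope \<phi> x)"

lemma energy_density_slope_continuous: "continuous_on {0..1} (\<lambda>x. energy_density (slope u x))"
  and energy_density'_slope_continuous: "continuous_on {0..1} (\<lambda>x. energy_density' (slope u x))"
  by (intro continuous_on_compose2[OF _ slope_continuous, of UNIV] continuous_at_imp_continuous_on ballI
      DERIV_isCont[OF DERIV_energy_density] DERIV_isCont[OF DERIV_energy_density'] subset_UNIV)+

lemma first_variation_integrable:
  "(\<lambda>x. 2 * fn'' u x * fn'' \<phi> x * energy_density (slope u x)
     + (fn'' u x)\<^sup>2 * energy_density' (slope u x) * slope \<phi> x) integrable_on {0..1}"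
proof -
  have "(\<lambda>x. (energy_density (slope u x) * fn'' u x) * fn'' \<phi> x) integrable_on {0..1}"
    by (intro L2_mult_integrable L2_mult_continuous fn''_L2 energy_density_slope_continuous) auto
  then have "(\<lambda>x. 2 * ((energy_density (slope u x) * fn'' u x) * fn'' \<phi> x)) integrable_on {0..1}"
    by (rule integrable_on_mult_right)
  moreover have "(\<lambda>x. ((energy_density' (slope u x) * slope \<phi> x) * fn'' u x) * fn'' u x) integrable_on {0..1}"
    by (intro L2_mult_integrable L2_mult_continuous fn''_L2 energy_density'_slope_continuous continuous_intros
        slope_continuous) auto
  ultimately have "(\<lambda>x. 2 * ((energy_density (slope u x) * fn'' u x) * fn'' \<phi> x)
      + ((energy_density' (slope u x) * slope \<phi> x) * fn'' u x) * fn'' u x) integrable_on {0..1}"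
    by (rule integrable_add)
  then show ?thesis
    by (simp add: power2_eq_square mult_ac)
qed

lemma elastic_energy_density: "elastic_energy u = integral {0..1} (\<lambda>x. (fn'' u x)\<^sup>2 * energy_density (slope u x))"
  unfolding elastic_energy_curv by (simp add: curv_def power_divide energy_density_weight)

lemma energy_integrable: "(\<lambda>x. (fn'' u x)\<^sup>2 * energy_density (slope u x)) integrable_on {0..1}"
  using L2_square_integrable[OF curv_L2[of u], of 0 1]
  by (simp add: curv_def power_divide energy_density_weight)

text \<open>The term f^2 a^2 is the product of an integrable function with the square of a slope; it
  is quadratic in the norm of \<phi> only because slopes are bounded uniformly by the norm.\<close>

lemma energy_remainder:
  "\<bar>elastic_energy (u + \<phi>) - elastic_energy u - first_variation u \<phi>\<bar> \<le> 45 * ((norm u)\<^sup>2 + 1) * (norm \<phi>)\<^sup>2"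
proof -
  let ?f = "fn'' u" and ?p = "slope u" and ?b = "fn'' \<phi>" and ?a = "slope \<phi>"
  have s: "slope (u + \<phi>) x = ?p x + ?a x" if "x \<in> {0..1}" for x
    using lincomb_slope[OF that, of 1 u 1 \<phi>] by simp
  have "AE x in M01. fn'' (u + \<phi>) x = ?f x + ?b x"
    using lincomb_fn''[of 1 u 1 \<phi>] by simp
  moreover have "AE x in M01. x \<in> {0..1}"
    by (intro AE_I2) auto
  ultimately have ae: "AE x in M01. (fn'' (u + \<phi>) x)\<^sup>2 * energy_density (slope (u + \<phi>) x)
      = (?f x + ?b x)\<^sup>2 * energy_density (?p x + ?a x)"
    by eventually_elim (simp add: s)
  define X where "X x = (?f x + ?b x)\<^sup>2 * energy_density (?p x + ?a x)" for x
  define Y where "Y x = ?f x ^ 2 * energy_density (?p x)" for x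
  define Z where "Z x = 2 * ?f x * ?b x * energy_density (?p x) + ?f x ^ 2 * energy_density' (?p x) * ?a x" for x
  have X: "elastic_energy (u + \<phi>) = integral {0..1} X"
    unfolding elastic_energy_density X_def by (rule integral_cong_AE_M01[OF ae]) auto
  have iX: "X integrable_on {0..1}"
  proof (rule integrable_spike[OF energy_integrable[of "u + \<phi>"] AE_M01_negligible[OF ae]])
    show "X x = (fn'' (u + \<phi>) x)\<^sup>2 * energy_density (slope (u + \<phi>) x)"
      if "x \<in> {0..1} - {x \<in> {0..1}. \<not> (fn'' (u + \<phi>) x)\<^sup>2 * energy_density (slope (u + \<phi>) x)
      = (?f x + ?b x)\<^sup>2 * energy_density (?p x + ?a x)}" for x
      using that by (simp add: X_def)
  qed
  have iYZ: "Y integrable_on {0..1}" "Z integrable_on {0..1}"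
    unfolding Y_def Z_def by (rule energy_integrable first_variation_integrable)+
  have if2: "(\<lambda>x. (?f x)\<^sup>2) integrable_on {0..1}" "(\<lambda>x. (?b x)\<^sup>2) integrable_on {0..1}"
    by (intro L2_square_integrable fn''_L2; simp)+
  have "elastic_energy (u + \<phi>) - elastic_energy u - first_variation u \<phi> = integral {0..1} (\<lambda>x. X x - Y x - Z x)"
    unfolding X elastic_energy_density[of u] first_variation_def Y_def[symmetric] Z_def[symmetric]
    using iX iYZ by (simp add: Henstock_Kurzweil_Integration.integral_diff integrable_diff)
  also have "\<bar>\<dots>\<bar> \<le> integral {0..1} (\<lambda>x. 45 * ((norm \<phi>)\<^sup>2 * (?f x)\<^sup>2 + (?b x)\<^sup>2))"
  proof (rule integral_abs_bound)
    show "(\<lambda>x. X x - Y x - Z x) integrable_on {0..1}"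
      using iX iYZ by (intro integrable_diff)
    show "(\<lambda>x. 45 * ((norm \<phi>)\<^sup>2 * (?f x)\<^sup>2 + (?b x)\<^sup>2)) integrable_on {0..1}"
      using if2 by (intro integrable_on_mult_right integrable_add)
    fix x :: real assume x: "x \<in> {0..1}"
    have "(?a x)\<^sup>2 \<le> (norm \<phi>)\<^sup>2"
      using slope_le_norm[OF x, of \<phi>] by (simp add: abs_le_square_iff[symmetric])
    then have "(?f x)\<^sup>2 * (?a x)\<^sup>2 \<le> (?f x)\<^sup>2 * (norm \<phi>)\<^sup>2"
      by (rule mult_left_mono) simp
    then have "(?f x)\<^sup>2 * (?a x)\<^sup>2 \<le> (norm \<phi>)\<^sup>2 * (?f x)\<^sup>2"
      by (simp only: mult.commute)
    then show "\<bar>X x - Y x - Z x\<bar> \<le> 45 * ((norm \<phi>)\<^sup>2 * (?f x)\<^sup>2 + (?b x)\<^sup>2)"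
      unfolding X_def Y_def Z_def
      by (intro order_trans[OF energy_density_remainder[of "?f x" "?b x" "?p x" "?a x"]]) simp
  qed
  also have "\<dots> = 45 * ((norm \<phi>)\<^sup>2 * (norm u)\<^sup>2 + (norm \<phi>)\<^sup>2)"
    using if2 by (simp add: Henstock_Kurzweil_Integration.integral_add integrable_on_mult_right norm_sobolev_integral)
  finally show ?thesis
    by (simp add: algebra_simps)
qed

lemma first_variation_bounded_linear: "bounded_linear (first_variation u)"
proof (rule bounded_linear_intro)
  let ?f = "fn'' u" and ?p = "slope u"
  have lin: "first_variation u (a *\<^sub>R \<phi> + b *\<^sub>R \<phi>') = a * first_variation u \<phi> + b * first_variation u \<phi>'" for a b \<phi> \<phi>'
  proof -
    define I where "I \<phi> x = 2 * ?f x * fn'' \<phi> x * energy_density (?p x) + (?f x)\<^sup>2 * energy_density' (?p x) * slope \<phi> x" for \<phi> x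
    have i: "I \<phi> integrable_on {0..1}" for \<phi>
      unfolding I_def by (rule first_variation_integrable)
    have "AE x in M01. x \<in> {0..1}"
      by (intro AE_I2) auto
    then have "AE x in M01. I (a *\<^sub>R \<phi> + b *\<^sub>R \<phi>') x = a * I \<phi> x + b * I \<phi>' x"
      using lincomb_fn''[of a \<phi> b \<phi>']
      by eventually_elim (simp add: I_def lincomb_slope algebra_simps)
    then have "integral {0..1} (I (a *\<^sub>R \<phi> + b *\<^sub>R \<phi>')) = integral {0..1} (\<lambda>x. a * I \<phi> x + b * I \<phi>' x)"
      by (rule integral_cong_AE_M01) auto
    also have "\<dots> = a * integral {0..1} (I \<phi>) + b * integral {0..1} (I \<phi>')"
      using i by (simp add: Henstock_Kurzweil_Integration.integral_add integrable_on_mult_right)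
    finally show ?thesis
      by (simp add: first_variation_def I_def[abs_def])
  qed
  show "first_variation u (\<phi> + \<phi>') = first_variation u \<phi> + first_variation u \<phi>'" for \<phi> \<phi>'
    using lin[of 1 \<phi> 1 \<phi>'] by simp
  show "first_variation u (r *\<^sub>R \<phi>) = r *\<^sub>R first_variation u \<phi>" for r \<phi>
    using lin[of r \<phi> 0 \<phi>] by simp
  \<comment> \<open>The first term uses Cauchy-Schwarz and \<open>energy_density\<close> \<le> 1,
    the second the bound 5 on \<open>energy_density'\<close> and the uniform bound on the slope of
    \<phi>.\<close>
  define B where "B = 2 * norm u + 5 * (norm u)\<^sup>2"
  show "norm (first_variation u \<phi>) \<le> norm \<phi> * B" for \<phi>
  proof -
    let ?b = "fn'' \<phi>"
    define c where "c x = energy_density (?p x) * ?f x" for x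
    have cL: "c \<in> L2"
      unfolding c_def by (intro L2_mult_continuous fn''_L2 energy_density_slope_continuous)
    have nf: "norm_L2 (fn'' w) = norm w" for w
      by (simp add: norm_sobolev_def)
    have "integral {0..1} (\<lambda>x. (c x)\<^sup>2) \<le> integral {0..1} (\<lambda>x. (?f x)\<^sup>2)"
    proof (rule Henstock_Kurzweil_Integration.integral_le)
      fix x :: real
      have "(energy_density (?p x))\<^sup>2 \<le> 1"
        using energy_density_bounds[of "?p x"] by (intro power_le_one)
      then show "(c x)\<^sup>2 \<le> (?f x)\<^sup>2"
        unfolding c_def power_mult_distrib by (rule mult_left_le_one_le[rotated 2]) auto
    qed (auto intro!: L2_square_integrable cL fn''_L2)
    then have "norm_L2 c \<le> norm_L2 ?f"
      unfolding norm_L2_def LINT_square[OF cL] LINT_square[OF fn''_L2] by (rule real_sqrt_le_mono)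
    then have 1: "\<bar>integral {0..1} (\<lambda>x. c x * ?b x)\<bar> \<le> norm u * norm \<phi>"
      using L2_Cauchy_Schwarz[OF cL fn''_L2[of \<phi>]] mult_right_mono[of "norm_L2 c" "norm_L2 ?f" "norm_L2 ?b"]
      by (simp add: LINT_mult[OF cL fn''_L2] nf)
    have ic: "(\<lambda>x. c x * ?b x) integrable_on {0..1}"
      by (intro L2_mult_integrable cL fn''_L2) auto
    have id: "(\<lambda>x. (?f x)\<^sup>2 * energy_density' (?p x) * slope \<phi> x) integrable_on {0..1}"
      using integrable_diff[OF first_variation_integrable[of u \<phi>] integrable_on_mult_right[OF ic, of 2]]
      by (simp add: c_def mult_ac)
    have 2: "\<bar>integral {0..1} (\<lambda>x. (?f x)\<^sup>2 * energy_density' (?p x) * slope \<phi> x)\<bar>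
        \<le> integral {0..1} (\<lambda>x. (5 * norm \<phi>) * (?f x)\<^sup>2)"
    proof (rule integral_abs_bound[OF id])
      show "(\<lambda>x. (5 * norm \<phi>) * (?f x)\<^sup>2) integrable_on {0..1}"
        by (intro integrable_on_mult_right L2_square_integrable fn''_L2) auto
      fix x :: real assume x: "x \<in> {0..1}"
      have "\<bar>energy_density' (?p x)\<bar> * \<bar>slope \<phi> x\<bar> \<le> 5 * norm \<phi>"
        by (intro mult_mono energy_density'_bound slope_le_norm x) auto
      then have "(?f x)\<^sup>2 * (\<bar>energy_density' (?p x)\<bar> * \<bar>slope \<phi> x\<bar>) \<le> (?f x)\<^sup>2 * (5 * norm \<phi>)"
        by (rule mult_left_mono) simp
      then show "\<bar>(?f x)\<^sup>2 * energy_density' (?p x) * slope \<phi> x\<bar> \<le> (5 * norm \<phi>) * (?f x)\<^sup>2"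
        by (simp add: abs_mult mult_ac)
    qed
    have "first_variation u \<phi> = integral {0..1} (\<lambda>x. 2 * (c x * ?b x) + (?f x)\<^sup>2 * energy_density' (?p x) * slope \<phi> x)"
      unfolding first_variation_def c_def by (simp add: mult_ac)
    also have "\<dots> = 2 * integral {0..1} (\<lambda>x. c x * ?b x) + integral {0..1} (\<lambda>x. (?f x)\<^sup>2 * energy_density' (?p x) * slope \<phi> x)"
      using ic id by (simp add: Henstock_Kurzweil_Integration.integral_add integrable_on_mult_right)
    finally have "\<bar>first_variation u \<phi>\<bar> \<le> 2 * (norm u * norm \<phi>) + 5 * norm \<phi> * (norm u)\<^sup>2"
      using 1 2 by (simp add: norm_sobolev_integral)
    then show ?thesis
      by (simp add: B_def algebra_simps)
  qed
qed

lemma elastic_energy_has_derivative: "(elastic_energy has_derivative first_variation u) (at u)"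
proof (rule has_derivativeI_sandwich[of 1])
  define K where "K = 45 * ((norm u)\<^sup>2 + 1)"
  show "bounded_linear (first_variation u)" by (rule first_variation_bounded_linear)
  show "norm (elastic_energy v - elastic_energy u - first_variation u (v - u)) / norm (v - u) \<le> K * norm (v - u)"
    if "v \<noteq> u" for v
  proof -
    have "norm (elastic_energy v - elastic_energy u - first_variation u (v - u)) \<le> K * norm (v - u) * norm (v - u)"
      using energy_remainder[of u "v - u"] by (simp add: K_def power2_eq_square mult.assoc)
    then show ?thesis
      using that by (simp add: divide_le_eq)
  qed
  have "((\<lambda>v. K * norm (v - u)) \<longlongrightarrow> K * norm (u - u)) (at u)"
    by (intro tendsto_intros)
  then show "((\<lambda>v. K * norm (v - u)) \<longlongrightarrow> 0) (at u)" by simp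
qed auto

lemma critical_point_iff:
  "critical_point \<psi> u \<longleftrightarrow> u \<in> admissible \<psi> \<and> (\<forall>v\<in>admissible \<psi>. 0 \<le> first_variation u (v - u))"
  unfolding critical_point_def
  using elastic_energy_has_derivative has_derivative_unique[OF elastic_energy_has_derivative] by blast

lemma minimizer_imp_critical_point:
  assumes "minimizer \<psi> u"
  shows "critical_point \<psi> u"
  unfolding critical_point_iff
proof (intro conjI ballI)
  show u: "u \<in> admissible \<psi>" using assms by (simp add: minimizer_def)
  fix v assume v: "v \<in> admissible \<psi>"
  define \<phi> where "\<phi> = v - u"
  define K where "K = 45 * ((norm u)\<^sup>2 + 1) * (norm \<phi>)\<^sup>2"
  \<comment> \<open>The segment from u to v stays admissible. The remainder is of order t^2, so that
    after division by t it tends to 0.\<close>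
  have "- (K * t) \<le> first_variation u \<phi>" if t: "0 < t" "t \<le> 1" for t
  proof -
    have "AE x in M01. \<psi> x \<le> fn (u + t *\<^sub>R \<phi>) x"
      using u v unfolding admissible_def mem_Collect_eq
    proof eventually_elim
      case (elim x)
      have "\<psi> x = (1 - t) * \<psi> x + t * \<psi> x" by (simp add: algebra_simps)
      also have "\<dots> \<le> (1 - t) * fn u x + t * fn v x"
        using elim t by (intro add_mono mult_left_mono) auto
      also have "\<dots> = fn (u + t *\<^sub>R \<phi>) x"
        by (simp add: \<phi>_def plus_sobolev.rep_eq scaleR_sobolev.rep_eq minus_sobolev.rep_eq algebra_simps)
      finally show ?case .
    qed
    then have "elastic_energy u \<le> elastic_energy (u + t *\<^sub>R \<phi>)"
      using assms by (simp add: minimizer_def admissible_def)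
    also have "\<dots> \<le> elastic_energy u + first_variation u (t *\<^sub>R \<phi>) + 45 * ((norm u)\<^sup>2 + 1) * (norm (t *\<^sub>R \<phi>))\<^sup>2"
      using energy_remainder[of u "t *\<^sub>R \<phi>"] by linarith
    also have "\<dots> = elastic_energy u + t * first_variation u \<phi> + t * (K * t)"
      using linear_cmul[OF bounded_linear.linear[OF first_variation_bounded_linear], of u t \<phi>]
      by (simp add: K_def power_mult_distrib power2_eq_square)
    finally have "0 \<le> t * (first_variation u \<phi> + K * t)"
      by (simp add: distrib_left)
    then show ?thesis
      using t(1) by (simp add: zero_le_mult_iff)
  qed
  then have ev: "\<forall>\<^sub>F t in at_right 0. - (K * t) \<le> first_variation u \<phi>"
    unfolding eventually_at_right_field by (intro exI[of _ 1]) auto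
  have "((\<lambda>t. - (K * t)) \<longlongrightarrow> - (K * 0)) (at_right 0)"
    by (intro tendsto_intros)
  from tendsto_upperbound[OF this ev] show "0 \<le> first_variation u (v - u)"
    by (simp add: \<phi>_def)
qed

text \<open>Variations whose slope is \<open>weight\<close> times a primitive of \<open>\<zeta>\<close> make the first variation linear in
  the derivative of \<open>G (slope u x)\<close> alone.\<close>

lemma weighted_variation:
  assumes \<eta>: "H1 \<eta> \<zeta>" and 0: "integral {0..1} (\<lambda>x. weight (slope u x) * \<eta> x) = 0"
  obtains \<phi> where "\<And>x. x \<in> {0..1} \<Longrightarrow> slope \<phi> x = weight (slope u x) * \<eta> x"
    "first_variation u \<phi> = 2 * integral {0..1} (\<lambda>x. curv u x * \<zeta> x)"
proof -
  have "H1 (\<lambda>x. weight (slope u x) * \<eta> x) (\<lambda>x. weight' (slope u x) * fn'' u x * \<eta> x + weight (slope u x) * \<zeta> x)"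
    by (rule H1_mult[OF H1_weight[OF slope_H1] \<eta>])
  then obtain \<phi> where \<phi>: "\<And>x. x \<in> {0..1} \<Longrightarrow> slope \<phi> x = weight (slope u x) * \<eta> x"
    "AE x in M01. fn'' \<phi> x = weight' (slope u x) * fn'' u x * \<eta> x + weight (slope u x) * \<zeta> x"
    by (rule sobolev_of_slope[OF _ 0]) (rule that)
  \<comment> \<open>The terms containing the derivative of the weight cancel, because the density is
    the inverse square of the weight and the variation carries one factor of it.\<close>
  have alg: "2 * f * (w' * f * e + w * z) * (1 / w\<^sup>2) + f\<^sup>2 * (- 2 * w' / w ^ 3) * (w * e) = 2 * (f / w * z)"
    if "w \<noteq> 0" for f w' w e z :: real
    using that by (simp add: field_simps power2_eq_square power3_eq_cube)
  have "AE x in M01. x \<in> {0..1}"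
    by (intro AE_I2) auto
  then have "AE x in M01. 2 * fn'' u x * fn'' \<phi> x * energy_density (slope u x)
     + (fn'' u x)\<^sup>2 * energy_density' (slope u x) * slope \<phi> x = 2 * (curv u x * \<zeta> x)"
    using \<phi>(2)
  proof eventually_elim
    case (elim x)
    show ?case
      unfolding \<phi>(1)[OF elim(1)] elim(2) energy_density_weight energy_density'_weight curv_def
      by (rule alg[OF weight_neq_0])
  qed
  then have "first_variation u \<phi> = integral {0..1} (\<lambda>x. 2 * (curv u x * \<zeta> x))"
    unfolding first_variation_def by (rule integral_cong_AE_M01) auto
  then have "first_variation u \<phi> = 2 * integral {0..1} (\<lambda>x. curv u x * \<zeta> x)"
    by simp
  then show thesis
    using that \<phi>(1) by blast
qed

section \<open>Nonnegative variations and concavity of critical points\<close>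

lemma weight_slope_continuous: "continuous_on {0..1} (\<lambda>x. weight (slope u x))"
  by (rule continuous_on_compose2[OF continuous_weight slope_continuous subset_UNIV])

lemma integral_weight_ge:
  assumes "0 \<le> x" "x \<le> y" "y \<le> 1"
  shows "y - x \<le> integral {x..y} (\<lambda>t. weight (slope u t))"
proof -
  have "integral {x..y} (\<lambda>t. 1) \<le> integral {x..y} (\<lambda>t. weight (slope u t))"
    using assms weight_ge_1 continuous_on_subset[OF weight_slope_continuous]
    by (intro Henstock_Kurzweil_Integration.integral_le integrable_continuous_real) auto
  then show ?thesis using assms by simp
qed

text \<open>The constant c gives the slope of \<phi> mean zero. As \<eta> decreases, this slope is
  first nonnegative and then nonpositive, so \<phi> rises from 0 and falls back to 0.\<close>

lemma decreasing_variation: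
  assumes \<zeta>: "\<zeta> \<in> L2" "\<And>x. \<zeta> x \<le> 0"
  obtains \<phi> where "\<And>x. x \<in> {0..1} \<Longrightarrow> 0 \<le> fn \<phi> x"
    "first_variation u \<phi> = 2 * integral {0..1} (\<lambda>x. curv u x * \<zeta> x)"
proof -
  let ?h = "\<lambda>x. weight (slope u x)"
  define Z where "Z x = integral {0..x} \<zeta>" for x
  have ZH: "H1 (\<lambda>x. c + Z x) \<zeta>" for c
    unfolding Z_def by (rule H1_primitive[OF \<zeta>(1)])
  have Zc: "continuous_on {0..1} Z"
    using H1_continuous[OF ZH[of 0]] by simp
  have hc: "continuous_on {a..b} ?h" if "0 \<le> a" "b \<le> 1" for a b
    using that by (intro continuous_on_subset[OF weight_slope_continuous]) auto
  have hpos: "0 < integral {0..1} ?h"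
    using integral_weight_ge[of 0 1 u] by simp
  define c where "c = - integral {0..1} (\<lambda>x. ?h x * Z x) / integral {0..1} ?h"
  define \<eta> where "\<eta> x = c + Z x" for x
  have hZ: "(\<lambda>x. ?h x * Z x) integrable_on {0..1}"
    by (intro integrable_continuous_real continuous_intros hc Zc) auto
  have h1: "?h integrable_on {0..1}"
    by (intro integrable_continuous_real hc) auto
  have "integral {0..1} (\<lambda>x. ?h x * \<eta> x) = integral {0..1} (\<lambda>x. c * ?h x + ?h x * Z x)"
    by (simp add: \<eta>_def algebra_simps)
  also have "\<dots> = c * integral {0..1} ?h + integral {0..1} (\<lambda>x. ?h x * Z x)"
    using hZ h1 by (simp add: Henstock_Kurzweil_Integration.integral_add integrable_on_mult_right)
  also have "\<dots> = 0" using hpos by (simp add: c_def)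
  finally have int0: "integral {0..1} (\<lambda>x. ?h x * \<eta> x) = 0" .
  have \<eta>H: "H1 \<eta> \<zeta>" unfolding \<eta>_def by (rule ZH)
  obtain \<phi> where \<phi>: "\<And>x. x \<in> {0..1} \<Longrightarrow> slope \<phi> x = ?h x * \<eta> x"
    "first_variation u \<phi> = 2 * integral {0..1} (\<lambda>x. curv u x * \<zeta> x)"
    using weighted_variation[OF \<eta>H int0] by metis
  have mono: "\<eta> y \<le> \<eta> x" if "0 \<le> x" "x \<le> y" "y \<le> 1" for x y
  proof -
    have "\<eta> y - \<eta> x = integral {x..y} \<zeta>"
      using that by (rule H1_increment[OF \<eta>H])
    also have "\<dots> \<le> integral {x..y} (\<lambda>x. 0)"
      using that \<zeta>(2) by (intro Henstock_Kurzweil_Integration.integral_le L2_integrable[OF \<zeta>(1)]) auto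
    finally show ?thesis by simp
  qed
  show thesis
  proof (rule that[OF _ \<phi>(2)])
    fix x :: real assume x: "x \<in> {0..1}"
    show "0 \<le> fn \<phi> x"
    proof (cases "0 \<le> \<eta> x")
      case True
      have "0 \<le> slope \<phi> t" if "t \<in> {0..x}" for t
      proof -
        have "0 \<le> \<eta> t" using mono[of t x] True that x by auto
        then show ?thesis
          using \<phi>(1)[of t] that x weight_pos[of "slope u t"] by (simp add: mult_nonneg_nonneg)
      qed
      then show ?thesis
        unfolding fn_eq[OF x] using x by (intro Henstock_Kurzweil_Integration.integral_nonneg slope_integrable) auto
    next
      case False
      have "slope \<phi> t \<le> 0" if "t \<in> {x..1}" for t
      proof -
        have "\<eta> t \<le> 0" using mono[of x t] False that x by auto
        then show ?thesis
          using \<phi>(1)[of t] that x weight_pos[of "slope u t"] by (simp add: mult_nonneg_nonpos)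
      qed
      then have "integral {x..1} (slope \<phi>) \<le> integral {x..1} (\<lambda>x. 0)"
        using x by (intro Henstock_Kurzweil_Integration.integral_le slope_integrable) auto
      moreover have "fn \<phi> 1 - fn \<phi> x = integral {x..1} (slope \<phi>)"
        using x by (intro H1_increment[OF fn_H1]) auto
      ultimately show ?thesis by (simp add: fn_1)
    qed
  qed
qed

lemma critical_point_add_nonneg:
  assumes "critical_point \<psi> u" "\<And>x. x \<in> {0..1} \<Longrightarrow> 0 \<le> fn \<phi> x"
  shows "0 \<le> first_variation u \<phi>"
proof -
  have "AE x in M01. x \<in> {0..1}"
    by (intro AE_I2) auto
  moreover have "AE x in M01. \<psi> x \<le> fn u x"
    using assms(1) by (simp add: critical_point_iff admissible_def)
  ultimately have "AE x in M01. \<psi> x \<le> fn (u + \<phi>) x"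
    by eventually_elim (use assms(2) in \<open>force simp: plus_sobolev.rep_eq\<close>)
  then have "u + \<phi> \<in> admissible \<psi>"
    by (simp add: admissible_def)
  then show ?thesis
    using assms(1) unfolding critical_point_iff by (metis add_diff_cancel_left')
qed

lemma critical_point_curv_nonpos:
  assumes "critical_point \<psi> u"
  shows "AE x in M01. curv u x \<le> 0"
proof -
  define \<zeta> where "\<zeta> x = - max (curv u x) 0" for x
  have m: "(\<lambda>x. max (curv u x) 0) \<in> L2"
  proof -
    have "(\<lambda>x. 1/2 * curv u x + 1/2 * \<bar>curv u x\<bar>) \<in> L2"
      by (intro L2_lincomb L2_abs curv_L2)
    moreover have "(\<lambda>x. 1/2 * curv u x + 1/2 * \<bar>curv u x\<bar>) = (\<lambda>x. max (curv u x) 0)"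
      by (auto simp: fun_eq_iff max_def)
    ultimately show ?thesis by simp
  qed
  have \<zeta>L: "\<zeta> \<in> L2"
    using L2_cmult[OF m, of "-1"] by (simp add: \<zeta>_def[abs_def])
  have \<zeta>0: "\<zeta> x \<le> 0" for x by (simp add: \<zeta>_def)
  obtain \<phi> where \<phi>: "\<And>x. x \<in> {0..1} \<Longrightarrow> 0 \<le> fn \<phi> x"
    "first_variation u \<phi> = 2 * integral {0..1} (\<lambda>x. curv u x * \<zeta> x)"
    using decreasing_variation[OF \<zeta>L \<zeta>0, of u] by metis
  have "(\<lambda>x. curv u x * \<zeta> x) = (\<lambda>x. - (\<zeta> x)\<^sup>2)"
    by (auto simp: fun_eq_iff \<zeta>_def max_def power2_eq_square)
  then have "integral {0..1} (\<lambda>x. (\<zeta> x)\<^sup>2) \<le> 0"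
    using critical_point_add_nonneg[OF assms \<phi>(1)] \<phi>(2) by simp
  then have "norm_L2 \<zeta> = 0"
    using integral_square_nonneg[of 0 1 \<zeta>] by (simp add: norm_L2_def LINT_square[OF \<zeta>L])
  then have "AE x in M01. \<zeta> x = 0"
    using norm_L2_eq_0[OF \<zeta>L] by simp
  then show ?thesis
    by eventually_elim (auto simp: \<zeta>_def max_def split: if_splits)
qed

lemma critical_point_slope_antimono:
  assumes "critical_point \<psi> u" "0 \<le> x" "x \<le> y" "y \<le> 1"
  shows "slope u y \<le> slope u x"
proof -
  have "AE x in M01. curv u x = - \<bar>curv u x\<bar>"
    using critical_point_curv_nonpos[OF assms(1)] by eventually_elim auto
  then have "integral {x..y} (curv u) = integral {x..y} (\<lambda>x. - \<bar>curv u x\<bar>)"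
    using assms by (intro integral_cong_AE_M01) auto
  also have "\<dots> = - integral {x..y} (\<lambda>x. \<bar>curv u x\<bar>)" by simp
  also have "\<dots> \<le> 0"
    using assms by (simp add: Henstock_Kurzweil_Integration.integral_nonneg L2_abs_integrable[OF curv_L2])
  finally have "G (slope u y) - G (slope u x) \<le> 0"
    using H1_increment[OF G_slope_H1 assms(2-), of u] by simp
  then show ?thesis by simp
qed

lemma slope_antimono_increment:
  assumes dec: "\<And>x y. 0 \<le> x \<Longrightarrow> x \<le> y \<Longrightarrow> y \<le> 1 \<Longrightarrow> slope u y \<le> slope u x"
    and xy: "0 \<le> x" "x \<le> y" "y \<le> 1"
  shows "fn u y - fn u x \<le> slope u x * (y - x)" "slope u y * (y - x) \<le> fn u y - fn u x"
proof -
  have "integral {x..y} (slope u) \<le> integral {x..y} (\<lambda>_. slope u x)"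
    using xy dec by (intro Henstock_Kurzweil_Integration.integral_le slope_integrable) auto
  moreover have "integral {x..y} (\<lambda>_. slope u y) \<le> integral {x..y} (slope u)"
    using xy dec by (intro Henstock_Kurzweil_Integration.integral_le slope_integrable) auto
  ultimately show "fn u y - fn u x \<le> slope u x * (y - x)" "slope u y * (y - x) \<le> fn u y - fn u x"
    unfolding H1_increment[OF fn_H1 xy] using xy by (simp_all add: mult.commute)
qed

section \<open>Symmetrization of concave functions\<close>

lemma weight'_eq: "weight' s = 5 / 2 * s * weight s / (1 + s\<^sup>2)"
proof -
  have "(1 + s\<^sup>2) powr (1 / 4) = (1 + s\<^sup>2) powr (5 / 4 - 1)"
    by simp
  also have "\<dots> = (1 + s\<^sup>2) powr (5 / 4) / (1 + s\<^sup>2)"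
    using one_plus_square_pos[of s] by (simp only: powr_diff powr_one)
  finally show ?thesis
    by (simp add: weight'_def weight_def)
qed

text \<open>The derivative is - 1 / K, so convexity is monotonicity of K. For positive z, the
  derivative of K is nonnegative exactly when 5/4 \<le> 1 + z^2, that is, from z = 1/2 on.\<close>

lemma convex_G_inverse: "convex_on {1/2..} (\<lambda>z. G (1 / z))"
proof (rule convex_on_realI)
  define K where "K z = z\<^sup>2 * weight (1 / z)" for z
  have Kpos: "0 < K z" if "z \<in> {1/2..}" for z
    using that weight_pos[of "1 / z"] by (simp add: K_def)
  show "((\<lambda>z. G (1 / z)) has_real_derivative - 1 / K z) (at z)" if "z \<in> {1/2..}" for z
  proof -
    have "((\<lambda>z. 1 / z) has_real_derivative - 1 / z\<^sup>2) (at z)"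
      using that by (auto intro!: derivative_eq_intros simp: power2_eq_square)
    from DERIV_chain2[OF DERIV_G this] show ?thesis
      by (simp add: K_def mult.commute)
  qed
  show "- 1 / K x \<le> - 1 / K y" if "x \<in> {1/2..}" "y \<in> {1/2..}" "x \<le> y" for x y
  proof -
    have "K x \<le> K y"
    proof (rule DERIV_nonneg_imp_nondecreasing[OF \<open>x \<le> y\<close>])
      fix z assume "x \<le> z" "z \<le> y"
      then have z: "1/2 \<le> z" using that by auto
      have d: "((\<lambda>z. 1 / z) has_real_derivative - 1 / z\<^sup>2) (at z)"
        using z by (auto intro!: derivative_eq_intros simp: power2_eq_square)
      have "(K has_real_derivative 2 * z * weight (1 / z) + z\<^sup>2 * (weight' (1 / z) * (- 1 / z\<^sup>2))) (at z)"
        unfolding K_def using z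
        by (auto intro!: derivative_eq_intros DERIV_chain2[OF DERIV_weight d])
      moreover have "0 \<le> 2 * z * weight (1 / z) + z\<^sup>2 * (weight' (1 / z) * (- 1 / z\<^sup>2))"
      proof -
        have "(1/2)\<^sup>2 \<le> z\<^sup>2" using z by (intro power_mono) auto
        then have "(5 / 2) * (1 / z) / (1 + (1 / z)\<^sup>2) \<le> 2 * z"
          using z by (simp add: field_simps power2_eq_square)
        then have "(5 / 2) * (1 / z) / (1 + (1 / z)\<^sup>2) * weight (1 / z) \<le> 2 * z * weight (1 / z)"
          by (rule mult_right_mono) (use weight_pos[of "1 / z"] in simp)
        then show ?thesis
          using z by (simp add: weight'_eq)
      qed
      ultimately show "\<exists>d. (K has_real_derivative d) (at z) \<and> 0 \<le> d" by blast
    qed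
    then show ?thesis
      using Kpos[OF that(1)] by (simp add: frac_le)
  qed
qed (auto simp: is_interval_connected is_interval_ci)

lemma abs_average_le:
  fixes a b c :: real
  assumes "0 \<le> a" "a \<le> c" "0 \<le> b" "b \<le> c"
  shows "\<bar>(a + b) / 2\<bar> \<le> c"
  using assms by (simp add: abs_le_iff)

text \<open>The threshold \<open>G 2\<close> of the theorem enters here: \<open>z \<mapsto> G (1 / z)\<close> is convex for \<open>z \<ge> 1/2\<close>, so slopes
  up to \<open>2\<close> have a harmonic mean below their \<open>G\<close>-mean.\<close>

lemma harmonic_mean_le:
  assumes pq: "0 \<le> p" "p \<le> 2" "0 \<le> q" "q \<le> 2" and s: "0 \<le> s" "0 \<le> t" "s + t = 2 * d"
    and T: "T \<le> p * s" "T \<le> q * t"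
  shows "T \<le> d * inv G ((G p + G q) / 2)"
proof -
  have G0: "0 \<le> G p" "0 \<le> G q" using G_le_iff[of 0 p] G_le_iff[of 0 q] pq by simp_all
  have "G p \<le> G 2" "G q \<le> G 2" using pq by simp_all
  then have "\<bar>(G p + G q) / 2\<bar> \<le> G 2"
    using G0 by (intro abs_average_le)
  then obtain m where m: "(G p + G q) / 2 = G m" by (rule G_surj_on)
  have m0: "0 \<le> m" using G_le_iff[of 0 m] m G0 by simp
  have d0: "0 \<le> d" using s by simp
  show ?thesis
  proof (cases "T \<le> 0")
    case True
    also have "0 \<le> d * m" using d0 m0 by simp
    finally show ?thesis by (simp add: m)
  next
    case False
    then have "0 < p * s" "0 < q * t" using T by auto
    then have pos: "0 < p" "0 < q" using pq s by (auto simp: zero_less_mult_iff)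
    \<comment> \<open>The harmonic mean of p and q: dividing the two bounds on T by p and by q and
      adding gives T \<le> d * h.\<close>
    define h where "h = 2 / (1 / p + 1 / q)"
    have "T / p + T / q \<le> s + t"
      using T pos by (intro add_mono) (auto simp: divide_le_eq mult.commute)
    then have "T * (1 / p + 1 / q) \<le> 2 * d"
      using s by (simp add: distrib_left)
    then have "T \<le> d * h"
      using pos by (simp add: h_def le_divide_eq add_pos_pos mult.commute)
    also have "h \<le> m"
    proof -
      have "(1 - 1/2) *\<^sub>R (1 / p) + (1/2) *\<^sub>R (1 / q) = 1 / h"
        using pos by (simp add: h_def)
      moreover have "G (1 / ((1 - 1/2) *\<^sub>R (1 / p) + (1/2) *\<^sub>R (1 / q)))
          \<le> (1 - 1/2) * G (1 / (1 / p)) + (1/2) * G (1 / (1 / q))"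
        by (rule convex_onD[OF convex_G_inverse]) (use pos pq in \<open>auto simp: field_simps\<close>)
      ultimately have "G h \<le> G m"
        using m by (simp add: add_divide_distrib)
      then show ?thesis by simp
    qed
    then have "d * h \<le> d * m" using d0 by (rule mult_left_mono)
    finally show ?thesis by (simp add: m)
  qed
qed

text \<open>Two-term Cauchy-Schwarz, with 2 * x * y \<le> s * b + t * a. It joins energy estimates
  over two separate intervals into one over their total length.\<close>

lemma add_square_le:
  fixes x y s t a b :: real
  assumes "x\<^sup>2 \<le> s * a" "y\<^sup>2 \<le> t * b" "0 \<le> s" "0 \<le> t" "0 \<le> a" "0 \<le> b"
  shows "(x + y)\<^sup>2 \<le> (s + t) * (a + b)"
proof -
  have "(2 * (x * y))\<^sup>2 = 4 * (x\<^sup>2 * y\<^sup>2)"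
    by (simp add: power_mult_distrib)
  also have "\<dots> \<le> 4 * ((s * a) * (t * b))"
    using assms by (intro mult_left_mono mult_mono) auto
  also have "\<dots> \<le> (s * b + t * a)\<^sup>2"
    using zero_le_power2[of "s * b - t * a"] by (simp add: power2_eq_square algebra_simps)
  finally have "\<bar>2 * (x * y)\<bar> \<le> \<bar>s * b + t * a\<bar>"
    by (simp add: abs_le_square_iff)
  moreover have "0 \<le> s * b + t * a" using assms by simp
  ultimately have "2 * (x * y) \<le> s * b + t * a" by linarith
  then show ?thesis
    using assms by (simp add: power2_eq_square algebra_simps)
qed

lemma continuous_of_increments:
  assumes inc: "\<And>x y. 0 \<le> x \<Longrightarrow> x \<le> y \<Longrightarrow> y \<le> 1 \<Longrightarrow> (v y - v x)\<^sup>2 \<le> (y - x) * (\<Phi> y - \<Phi> x)"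
  shows "continuous_on {0..1} (v :: real \<Rightarrow> real)"
proof -
  define C where "C = \<Phi> 1 - \<Phi> 0"
  have mono: "\<Phi> x \<le> \<Phi> y" if "0 \<le> x" "x \<le> y" "y \<le> 1" for x y
  proof (cases "x = y")
    case False
    have "0 \<le> (y - x) * (\<Phi> y - \<Phi> x)"
      using inc[OF that] zero_le_power2 order_trans by blast
    then show ?thesis using False that by (simp add: zero_le_mult_iff)
  qed simp
  have C0: "0 \<le> C" using mono[of 0 1] by (simp add: C_def)
  have sq: "(v y - v x)\<^sup>2 \<le> C * \<bar>y - x\<bar>" if "x \<in> {0..1}" "y \<in> {0..1}" for x y
  proof -
    have *: "(v y - v x)\<^sup>2 \<le> C * \<bar>y - x\<bar>" if "0 \<le> x" "x \<le> y" "y \<le> 1" for x y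
    proof -
      have "(y - x) * (\<Phi> y - \<Phi> x) \<le> (y - x) * C"
        using that mono[of 0 x] mono[of y 1] by (intro mult_left_mono) (auto simp: C_def)
      then show ?thesis using inc[OF that] that by (simp add: mult.commute)
    qed
    show ?thesis
      using *[of x y] *[of y x] that by (cases "x \<le> y") (auto simp: power2_commute abs_minus_commute)
  qed
  show ?thesis
    unfolding continuous_on_iff
  proof (intro ballI allI impI)
    fix x e :: real assume x: "x \<in> {0..1}" and e: "0 < e"
    define d where "d = e\<^sup>2 / (C + 1)"
    have "d > 0" using e C0 by (simp add: d_def)
    moreover have "dist (v y) (v x) < e" if "y \<in> {0..1}" "dist y x < d" for y
    proof -
      have "(v y - v x)\<^sup>2 \<le> C * \<bar>y - x\<bar>" by (rule sq[OF x that(1)])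
      also have "\<dots> \<le> C * d" using that(2) C0 by (intro mult_left_mono) (auto simp: dist_real_def)
      also have "\<dots> < e\<^sup>2" using e C0 by (simp add: d_def field_simps)
      finally have "\<bar>v y - v x\<bar> < \<bar>e\<bar>" by (metis abs_le_square_iff not_less)
      then show ?thesis using e by (simp add: dist_real_def)
    qed
    ultimately show "\<exists>d>0. \<forall>y\<in>{0..1}. dist y x < d \<longrightarrow> dist (v y) (v x) < e" by blast
  qed
qed

lemma integral_antisymmetric:
  fixes q :: "real \<Rightarrow> real"
  assumes c: "continuous_on {0..1} q" and q: "\<And>x. x \<in> {0..1} \<Longrightarrow> q (1 - x) = - q x" and x: "x \<in> {0..1}"
  shows "integral {0..x} q = integral {0..1 - x} q"
proof -
  define I where "I x = integral {0..x} q" for x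
  have Ic: "continuous_on {0..1} I"
    unfolding I_def using c by (intro indefinite_integral_continuous_1 integrable_continuous_real)
  have ID: "(I has_real_derivative q x) (at x)" if "0 < x" "x < 1" for x
  proof -
    have "(I has_vector_derivative q x) (at x within {0..1})"
      unfolding I_def using that by (intro integral_has_vector_derivative c) auto
    then show ?thesis
      using that by (simp add: has_real_derivative_iff_has_vector_derivative at_within_Icc_at)
  qed
  define F where "F x = I x - I (1 - x)" for x
  have Fc: "continuous_on {0..1} F"
    unfolding F_def by (intro continuous_intros Ic continuous_on_compose2[OF Ic]) auto
  have "DERIV F x :> 0" if "0 < x" "x < 1" for x
  proof -
    have "(F has_real_derivative q x - q (1 - x) * (- 1)) (at x)"
      unfolding F_def using that
      by (intro DERIV_diff ID DERIV_chain2[where f = I and g = "\<lambda>x. 1 - x"]) (auto intro!: derivative_eq_intros)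
    then show ?thesis using q[of x] that by simp
  qed
  then have const: "F y = F 0" if "y \<in> {0..1}" for y
    using DERIV_isconst2[of 0 1 F y] Fc that by auto
  \<comment> \<open>F is constant and changes sign under reflection, hence it is 0.\<close>
  have "F 1 = F 0" by (rule const) simp
  then have "F 0 = 0" by (simp add: F_def)
  then show ?thesis using const[OF x] by (simp add: F_def I_def)
qed

lemma symmetricD:
  assumes "symmetric f" "x \<in> {0..1}"
  shows "f (1 - x) = f x"
  using bspec[OF assms(1)[unfolded symmetric_def] assms(2)] by (rule sym)

text \<open>In terms of V the energy is quadratic: by \<open>add_square_le\<close> the increments of
  V cost half the energy of u on the two pieces by which the interval shrinks, and mirroring at 1/2
  supplies the other half. The comparison with u goes through the height f (a x), whose rate of
  growth is bounded by the harmonic mean of the two end slopes and hence, by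
  \<open>harmonic_mean_le\<close>, by the slope of w.\<close>

lemma concave_symmetrization:
  fixes u :: sobolev
  assumes dec: "\<And>x y. 0 \<le> x \<Longrightarrow> x \<le> y \<Longrightarrow> y \<le> 1 \<Longrightarrow> slope u y \<le> slope u x"
    and bound: "\<And>x. x \<in> {0..1} \<Longrightarrow> \<bar>slope u x\<bar> \<le> 2"
  obtains w where "symmetric (fn w)" "elastic_energy w \<le> elastic_energy u"
    "\<And>x. x \<in> {0..1} \<Longrightarrow> min (fn u x) (fn u (1 - x)) \<le> fn w x"
proof -
  define p where "p = slope u"
  define f where "f = fn u"
  define g where "g = curv u"
  have f01: "f 0 = 0" "f 1 = 0" by (simp_all add: f_def fn_0 fn_1)
  have fc: "continuous_on {0..1} f" by (simp add: f_def fn_continuous)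
  have pc: "continuous_on {0..1} p" by (simp add: p_def slope_continuous)
  have p: "p y \<le> p x" if "0 \<le> x" "x \<le> y" "y \<le> 1" for x y
    using dec that by (simp add: p_def)
  have inc: "f y - f x \<le> p x * (y - x)" "p y * (y - x) \<le> f y - f x" if "0 \<le> x" "x \<le> y" "y \<le> 1" for x y
    unfolding f_def p_def by (rule slope_antimono_increment[OF dec that]; assumption)+
  have f0: "0 \<le> f x" if "x \<in> {0..1}" for x
  proof (cases "0 \<le> p x")
    case True
    then have "0 \<le> p x * (x - 0)" using that by simp
    then show ?thesis using inc(2)[of 0 x] that f01 by simp
  next
    case False
    then have "p x * (1 - x) \<le> 0" using that by (simp add: mult_nonpos_nonneg)
    then show ?thesis using inc(1)[of x 1] that f01 by simp
  qed

  text \<open>The interval \<open>[a x, b x]\<close> is the superlevel set of \<open>f\<close> of length \<open>1 - 2 x\<close>.\<close>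
  define S where "S x = {a \<in> {0..2 * x}. f (a + (1 - 2 * x)) = f a \<and> 0 \<le> p a \<and> p (a + (1 - 2 * x)) \<le> 0}" for x
  define a where "a x = Inf (S x)" for x
  define b where "b x = a x + (1 - 2 * x)" for x
  \<comment> \<open>A concave function gains less over a window moved to the right. Overlapping
    windows are compared on the end pieces [c, d] and [c + \<mu>, d + \<mu>], disjoint ones
    directly.\<close>
  have Dmono: "f (d + \<mu>) - f d \<le> f (c + \<mu>) - f c" if "0 \<le> c" "c \<le> d" "0 \<le> \<mu>" "d + \<mu> \<le> 1" for c d \<mu>
  proof (cases "d \<le> c + \<mu>")
    case True
    have "f (d + \<mu>) - f (c + \<mu>) \<le> p (c + \<mu>) * (d - c)" using inc(1)[of "c + \<mu>" "d + \<mu>"] that by simp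
    also have "\<dots> \<le> p d * (d - c)" using p[of d "c + \<mu>"] that True by (intro mult_right_mono) auto
    also have "\<dots> \<le> f d - f c" using inc(2)[of c d] that by simp
    finally show ?thesis by simp
  next
    case False
    have "f (d + \<mu>) - f d \<le> p d * \<mu>" using inc(1)[of d "d + \<mu>"] that by simp
    also have "\<dots> \<le> p (c + \<mu>) * \<mu>" using p[of "c + \<mu>" d] that False by (intro mult_right_mono) auto
    also have "\<dots> \<le> f (c + \<mu>) - f c" using inc(2)[of c "c + \<mu>"] that by simp
    finally show ?thesis .
  qed
  \<comment> \<open>For x < 1/2 the gain over a window of length 1 - 2 * x is nonnegative at the
    left end of the range and nonpositive at the right end, because f is nonnegative and vanishes at
    0 and 1. At x = 1/2 the window is a point, the equation for f is void, and the sign conditions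
    alone select a zero of the slope.\<close>
  have Sne: "S x \<noteq> {}" if x: "0 \<le> x" "x \<le> 1/2" for x
  proof (cases "x = 1/2")
    case True
    obtain z where "z \<in> {0<..<1}" "p z = 0" using slope_has_zero[of u] by (auto simp: p_def)
    then have "z \<in> S x" unfolding True S_def by auto
    then show ?thesis by blast
  next
    case False
    define \<mu> where "\<mu> = 1 - 2 * x"
    have \<mu>: "0 < \<mu>" "\<mu> \<le> 1" using x False by (auto simp: \<mu>_def)
    have "continuous_on {0..2 * x} (\<lambda>c. f (c + \<mu>) - f c)"
      using x by (intro continuous_intros continuous_on_compose2[OF fc] continuous_on_subset[OF fc]) (auto simp: \<mu>_def)
    moreover have "f (2 * x + \<mu>) - f (2 * x) \<le> 0" "0 \<le> f (0 + \<mu>) - f 0"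
      using f0[of "2 * x"] f0[of \<mu>] x \<mu> f01 by (auto simp: \<mu>_def)
    ultimately obtain c where c: "0 \<le> c" "c \<le> 2 * x" "f (c + \<mu>) - f c = 0"
      using IVT2'[of "\<lambda>c. f (c + \<mu>) - f c" "2 * x" 0 0] x by auto
    have "p (c + \<mu>) * \<mu> \<le> 0" "0 \<le> p c * \<mu>"
      using inc[of c "c + \<mu>"] c \<mu> x by (auto simp: \<mu>_def)
    then have "c \<in> S x"
      using c \<mu> unfolding S_def \<mu>_def[symmetric] by (auto simp: mult_le_0_iff zero_le_mult_iff)
    then show ?thesis by blast
  qed
  have Sbdd: "bdd_below (S x)" for x
    by (rule bdd_belowI[of _ 0]) (auto simp: S_def)
  \<comment> \<open>When f has a flat top several windows may qualify; choosing the leftmost one is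
    what makes a and b monotone.\<close>
  have aS: "a x \<in> S x" if x: "0 \<le> x" "x \<le> 1/2" for x
  proof -
    have sh: "continuous_on {0..2 * x} (\<lambda>c. f (c + (1 - 2 * x)))" "continuous_on {0..2 * x} (\<lambda>c. p (c + (1 - 2 * x)))"
      using x by (auto intro!: continuous_on_compose2[OF fc] continuous_on_compose2[OF pc] continuous_intros)
    have fp: "continuous_on {0..2 * x} f" "continuous_on {0..2 * x} p"
      using x by (auto intro!: continuous_on_subset[OF fc] continuous_on_subset[OF pc])
    have "S x = {c \<in> {0..2 * x}. f (c + (1 - 2 * x)) = f c} \<inter> {c \<in> {0..2 * x}. 0 \<le> p c} \<inter> {c \<in> {0..2 * x}. p (c + (1 - 2 * x)) \<le> 0}"
      by (auto simp: S_def)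
    moreover have "closed {c \<in> {0..2 * x}. f (c + (1 - 2 * x)) = f c}"
      by (rule continuous_closed_preimage_constant[of _ "\<lambda>c. f (c + (1 - 2 * x)) - f c" 0, simplified])
        (intro continuous_intros sh fp closed_atLeastAtMost)+
    moreover have "closed {c \<in> {0..2 * x}. 0 \<le> p c}" "closed {c \<in> {0..2 * x}. p (c + (1 - 2 * x)) \<le> 0}"
      by (rule continuous_on_closed_Collect_le[OF continuous_on_const fp(2) closed_atLeastAtMost]
          continuous_on_closed_Collect_le[OF sh(2) continuous_on_const closed_atLeastAtMost])+
    ultimately have "closed (S x)" by auto
    then show ?thesis
      unfolding a_def by (intro closed_contains_Inf Sne Sbdd x)
  qed
  have a: "0 \<le> a x" "a x \<le> 2 * x" "f (b x) = f (a x)" "0 \<le> p (a x)" "p (b x) \<le> 0" "a x \<le> b x" "b x \<le> 1"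
    if "0 \<le> x" "x \<le> 1/2" for x
    using aS[OF that] that by (auto simp: S_def b_def)
  \<comment> \<open>Minimality test: a window at c that gains no height and ends where f does not
    rise would, if it lay left of a x, have gain exactly 0 by \<open>Dmono\<close> and so belong to
    S x.\<close>
  have a_le: "a x \<le> c" if x: "0 \<le> x" "x \<le> 1/2" and c: "0 \<le> c" "c \<le> 2 * x" "f (c + (1 - 2 * x)) \<le> f c" "p (c + (1 - 2 * x)) \<le> 0" for x c
  proof (rule ccontr)
    assume "\<not> a x \<le> c"
    then have "f (b x) - f (a x) \<le> f (c + (1 - 2 * x)) - f c"
      unfolding b_def using a[OF x] c x by (intro Dmono) auto
    then have "f (c + (1 - 2 * x)) = f c" using a(3)[OF x] c by simp
    moreover have "0 \<le> p c"
      using p[of c "a x"] a[OF x] c x \<open>\<not> a x \<le> c\<close> by simp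
    ultimately have "c \<in> S x" using c by (simp add: S_def)
    then have "a x \<le> c" unfolding a_def by (rule cInf_lower) (rule Sbdd)
    then show False using \<open>\<not> a x \<le> c\<close> by simp
  qed
  \<comment> \<open>The window at a y is lengthened to the right, past b y, where f does not
    increase; it then passes the minimality test for x.\<close>
  have a_mono: "a x \<le> a y" if xy: "0 \<le> x" "x \<le> y" "y \<le> 1/2" for x y
  proof (cases "a y \<le> 2 * x")
    case True
    have x: "x \<le> 1/2" and y: "0 \<le> y" using xy by auto
    have le: "b y \<le> a y + (1 - 2 * x)" "a y + (1 - 2 * x) \<le> 1" using xy True by (auto simp: b_def)
    have by0: "0 \<le> b y" using a[OF y xy(3)] by simp
    have "f (a y + (1 - 2 * x)) - f (b y) \<le> p (b y) * (a y + (1 - 2 * x) - b y)"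
      using inc(1)[OF by0 le] .
    also have "\<dots> \<le> 0" using a(5)[OF y xy(3)] le by (simp add: mult_nonpos_nonneg)
    finally have 1: "f (a y + (1 - 2 * x)) \<le> f (a y)" using a(3)[OF y xy(3)] by simp
    have 2: "p (a y + (1 - 2 * x)) \<le> 0" using p[OF by0 le] a(5)[OF y xy(3)] by simp
    show ?thesis by (rule a_le[OF xy(1) x a(1)[OF y xy(3)] True 1 2])
  qed (use a(2)[of x] xy in auto)
  have b_mono: "b y \<le> b x" if xy: "0 \<le> x" "x \<le> y" "y \<le> 1/2" for x y
  proof -
    have x: "x \<le> 1/2" and y: "0 \<le> y" using xy by auto
    \<comment> \<open>The left end of the window of length 1 - 2 * y that ends at b x.\<close>
    define c where "c = a x + 2 * (y - x)"
    note ax = a[OF xy(1) x]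
    have c: "a x \<le> c" "c \<le> b x" "0 \<le> c" "c \<le> 2 * y" "c + (1 - 2 * y) = b x"
      using xy ax by (auto simp: c_def b_def)
    have "f (b x) \<le> f c"
    proof (cases "0 \<le> p c")
      case True
      then have "0 \<le> p c * (c - a x)" using c by simp
      also have "\<dots> \<le> f c - f (a x)" using inc(2)[of "a x" c] c ax by simp
      finally show ?thesis using ax by simp
    next
      case False
      have "f (b x) - f c \<le> p c * (b x - c)" using inc(1)[of c "b x"] c ax by simp
      also have "\<dots> \<le> 0" using False c by (simp add: mult_nonpos_nonneg)
      finally show ?thesis by simp
    qed
    then have "a y \<le> c"
      using c ax by (intro a_le[OF y xy(3)]) auto
    then show ?thesis by (simp add: c_def b_def)
  qed

  define V where "V x = (G (p (a x)) + G (- p (b x))) / 2" for x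
  define q where "q x = inv G (V x)" for x
  have pb: "\<bar>p x\<bar> \<le> 2" if "x \<in> {0..1}" for x using bound that by (simp add: p_def)
  have ab01: "a x \<in> {0..1}" "b x \<in> {0..1}" if "0 \<le> x" "x \<le> 1/2" for x
    using a[OF that] by auto
  have V_bounds: "0 \<le> V x" "V x \<le> G 2" if x: "0 \<le> x" "x \<le> 1/2" for x
  proof -
    have "0 \<le> G (p (a x))" "0 \<le> G (- p (b x))"
      using a[OF x] G_le_iff[of 0 "p (a x)"] G_le_iff[of 0 "- p (b x)"] by (simp_all del: G_minus)
    then show "0 \<le> V x"
      unfolding V_def by (intro divide_nonneg_nonneg add_nonneg_nonneg) simp_all
    have "G (p (a x)) \<le> G 2" "G (- p (b x)) \<le> G 2"
      using pb[OF ab01(1)[OF x]] pb[OF ab01(2)[OF x]] unfolding G_le_iff by auto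
    then have "\<bar>V x\<bar> \<le> G 2"
      unfolding V_def by (intro abs_average_le \<open>0 \<le> G (p (a x))\<close> \<open>0 \<le> G (- p (b x))\<close>)
    then show "V x \<le> G 2" by (rule abs_le_D1)
  qed
  have V_anti: "V y \<le> V x" if xy: "0 \<le> x" "x \<le> y" "y \<le> 1/2" for x y
  proof -
    have "p (a y) \<le> p (a x)" "p (b x) \<le> p (b y)"
      using a_mono[OF xy] b_mono[OF xy] a[of x] a[of y] xy by (auto intro!: p)
    then have "G (p (a y)) \<le> G (p (a x))" "G (- p (b y)) \<le> G (- p (b x))" by auto
    then show ?thesis unfolding V_def by (intro divide_right_mono add_mono) auto
  qed
  have V_half: "V (1/2) = 0"
  proof -
    have "p (a (1/2)) = 0" using a(4,5)[of "1/2"] by (simp add: b_def)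
    then show ?thesis by (simp add: V_def b_def)
  qed
  have GV: "G (q x) = V x" if x: "0 \<le> x" "x \<le> 1/2" for x
  proof -
    have "\<bar>V x\<bar> \<le> G 2" using V_bounds[OF x] by simp
    then show ?thesis unfolding q_def by (rule G_surj_on) simp
  qed
  have q0: "0 \<le> q x" if x: "0 \<le> x" "x \<le> 1/2" for x
    using V_bounds(1)[OF x] G_le_iff[of 0 "q x"] GV[OF x] by simp
  have q_anti: "q y \<le> q x" if xy: "0 \<le> x" "x \<le> y" "y \<le> 1/2" for x y
    using V_anti[OF xy] GV[of x] GV[of y] xy G_le_iff[of "q y" "q x"] by simp

  define J where "J x = integral {0..x} (\<lambda>t. (g t)\<^sup>2)" for x
  have gi: "(\<lambda>t. (g t)\<^sup>2) integrable_on {x..y}" if "0 \<le> x" "y \<le> 1" for x y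
    unfolding g_def by (rule L2_square_integrable[OF curv_L2 that])
  have Jd: "J y - J x = integral {x..y} (\<lambda>t. (g t)\<^sup>2)" if "0 \<le> x" "x \<le> y" "y \<le> 1" for x y
    unfolding J_def using that by (intro integral_Icc_diff gi) auto
  have Jmono: "J x \<le> J y" if "0 \<le> x" "x \<le> y" "y \<le> 1" for x y
    using Jd[OF that] integral_square_nonneg[of x y g] by linarith
  have Gp: "(G (p y) - G (p x))\<^sup>2 \<le> (y - x) * (J y - J x)" if "0 \<le> x" "x \<le> y" "y \<le> 1" for x y
    unfolding Jd[OF that] p_def g_def by (rule H1_increment_square[OF G_slope_H1 that])
  have J1: "J 1 = elastic_energy u" by (simp add: J_def g_def elastic_energy_curv)
  \<comment> \<open>Half the energy of u outside [a x, b x]; the factor accounts for the reflected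
    copy.\<close>
  define \<Phi> where "\<Phi> x = (J (a x) + (J 1 - J (b x))) / 2" for x
  have \<Phi>_mono: "\<Phi> x \<le> \<Phi> y" if xy: "0 \<le> x" "x \<le> y" "y \<le> 1/2" for x y
  proof -
    have "J (a x) \<le> J (a y)" "J (b y) \<le> J (b x)"
      using a_mono[OF xy] b_mono[OF xy] a[of x] a[of y] xy by (auto intro!: Jmono)
    then show ?thesis by (simp add: \<Phi>_def)
  qed
  have V_inc: "(V y - V x)\<^sup>2 \<le> (y - x) * (\<Phi> y - \<Phi> x)" if xy: "0 \<le> x" "x \<le> y" "y \<le> 1/2" for x y
  proof -
    have x: "x \<le> 1/2" and y: "0 \<le> y" using xy by auto
    note ab = a[OF xy(1) x] a[OF y xy(3)] a_mono[OF xy] b_mono[OF xy]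
    have "((G (p (a y)) - G (p (a x))) + (G (p (b x)) - G (p (b y))))\<^sup>2
        \<le> ((a y - a x) + (b x - b y)) * ((J (a y) - J (a x)) + (J (b x) - J (b y)))"
      using ab Jmono[of "a x" "a y"] Jmono[of "b y" "b x"] by (intro add_square_le Gp) auto
    also have "(a y - a x) + (b x - b y) = 2 * (y - x)" by (simp add: b_def)
    also have "(J (a y) - J (a x)) + (J (b x) - J (b y)) = 2 * (\<Phi> y - \<Phi> x)" by (simp add: \<Phi>_def field_simps)
    also have "(G (p (a y)) - G (p (a x))) + (G (p (b x)) - G (p (b y))) = 2 * (V y - V x)" by (simp add: V_def field_simps)
    finally have le: "(2 * (V y - V x))\<^sup>2 \<le> 2 * (y - x) * (2 * (\<Phi> y - \<Phi> x))" .
    have "A\<^sup>2 \<le> d * P" if "(2 * A)\<^sup>2 \<le> 2 * d * (2 * P)" for A d P :: real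
      using that by (simp add: power2_eq_square)
    from this[OF le] show ?thesis .
  qed

  \<comment> \<open>The slope of a symmetric function is odd about 1/2, and so is G of it. The
    vanishing of V at 1/2 makes the two halves fit together.\<close>
  define V' where "V' x = (if x \<le> 1/2 then V x else - V (1 - x))" for x
  define \<Phi>' where "\<Phi>' x = (if x \<le> 1/2 then \<Phi> x else 2 * \<Phi> (1/2) - \<Phi> (1 - x))" for x
  have V'_inc: "(V' y - V' x)\<^sup>2 \<le> (y - x) * (\<Phi>' y - \<Phi>' x)" if xy: "0 \<le> x" "x \<le> y" "y \<le> 1" for x y
  proof -
    consider "y \<le> 1/2" | "1/2 < x" | "x \<le> 1/2" "1/2 < y" by linarith
    then show ?thesis
    proof cases
      case 1
      then show ?thesis using V_inc[of x y] xy by (simp add: V'_def \<Phi>'_def)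
    next
      case 2
      then show ?thesis using V_inc[of "1 - y" "1 - x"] xy by (simp add: V'_def \<Phi>'_def)
    next
      \<comment> \<open>The increment is split at 1/2, and the two estimates are joined by
        \<open>add_square_le\<close>.\<close>
      case 3
      have "((V (1/2) - V x) + (V (1/2) - V (1 - y)))\<^sup>2
          \<le> ((1/2 - x) + (1/2 - (1 - y))) * ((\<Phi> (1/2) - \<Phi> x) + (\<Phi> (1/2) - \<Phi> (1 - y)))"
        using xy 3 \<Phi>_mono[of x "1/2"] \<Phi>_mono[of "1 - y" "1/2"]
        by (intro add_square_le V_inc) auto
      also have "(V (1/2) - V x) + (V (1/2) - V (1 - y)) = V' y - V' x"
        using 3 by (simp add: V'_def V_half)
      also have "(\<Phi> (1/2) - \<Phi> x) + (\<Phi> (1/2) - \<Phi> (1 - y)) = \<Phi>' y - \<Phi>' x"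
        using 3 by (simp add: \<Phi>'_def)
      finally show ?thesis by (simp add: algebra_simps)
    qed
  qed
  have total: "\<Phi>' 1 - \<Phi>' 0 = elastic_energy u"
  proof -
    have "a 0 = 0" using a(1,2)[of 0] by simp
    then have "\<Phi> 0 = 0" by (simp add: \<Phi>_def b_def J_def)
    moreover have "\<Phi> (1/2) = elastic_energy u / 2" by (simp add: \<Phi>_def b_def J1)
    ultimately show ?thesis by (simp add: \<Phi>'_def)
  qed
  have V'c: "continuous_on {0..1} V'"
    by (rule continuous_of_increments[OF V'_inc])
  have "\<exists>v. H1 V' v \<and> integral {0..1} (\<lambda>x. (v x)\<^sup>2) \<le> \<Phi>' 1 - \<Phi>' 0"
  proof (rule H1_of_increments[OF _ V'c, of \<Phi>'])
    fix x y :: real assume "0 \<le> x" "x \<le> y" "y \<le> 1"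
    then show "(V' y - V' x)\<^sup>2 \<le> (y - x) * (\<Phi>' y - \<Phi>' x)" by (rule V'_inc)
  qed blast
  then obtain v where v: "H1 V' v" "integral {0..1} (\<lambda>x. (v x)\<^sup>2) \<le> elastic_energy u"
    unfolding total by blast
  have V'_b: "\<bar>V' x\<bar> \<le> G 2" if "x \<in> {0..1}" for x
    using V_bounds[of x] V_bounds[of "1 - x"] that by (auto simp: V'_def)
  have V'_anti: "V' (1 - x) = - V' x" if "x \<in> {0..1}" for x
  proof (cases "x = 1/2")
    case True
    show ?thesis unfolding True using V_half by (simp add: V'_def)
  qed (auto simp: V'_def)
  define q' where "q' x = inv G (V' x)" for x
  have q'_anti: "q' (1 - x) = - q' x" if x: "x \<in> {0..1}" for x
  proof -
    obtain s where s: "V' x = G s" using V'_b[OF x] by (rule G_surj_on)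
    have "inv G (- G s) = inv G (G (- s))" by (simp only: G_minus)
    then have "inv G (- G s) = - s" by (simp only: inv_G_G)
    then show ?thesis by (simp add: q'_def V'_anti[OF x] s)
  qed
  have q'c: "continuous_on {0..1} q'"
    unfolding q'_def by (rule H1_continuous[OF H1_inv_G[OF v(1) V'_b]])
  have sym: "integral {0..x} q' = integral {0..1 - x} q'" if "x \<in> {0..1}" for x
    by (rule integral_antisymmetric[OF q'c q'_anti that])
  have "integral {0..1} q' = 0" using sym[of 1] by simp
  then obtain w where w: "\<And>x. x \<in> {0..1} \<Longrightarrow> slope w x = q' x"
    "elastic_energy w = integral {0..1} (\<lambda>x. (v x)\<^sup>2)"
    using sobolev_of_G_slope[OF v(1) V'_b] unfolding q'_def by metis
  have fw: "fn w x = integral {0..x} q'" if x: "x \<in> {0..1}" for x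
    unfolding fn_eq[OF x] by (rule Henstock_Kurzweil_Integration.integral_cong) (use x w in auto)
  have w_sym: "symmetric (fn w)"
    unfolding symmetric_def
  proof
    fix x :: real assume x: "x \<in> {0..1}"
    show "fn w x = fn w (1 - x)"
      using sym[OF x] fw[OF x] fw[of "1 - x"] x by simp
  qed
  \<comment> \<open>Over [y, z] the height f (a x) gains at most (z - y) * q y, by the harmonic mean
    estimate, while w gains at least (z - y) * q z. The discrepancy is of the form that
    \<open>chain_le\<close> removes, with M = - q.\<close>
  have U_le: "f (a x) \<le> fn w x" if x: "0 \<le> x" "x \<le> 1/2" for x
  proof -
    define F where "F x = f (a x) - fn w x" for x
    have "F x \<le> F 0"
    proof (rule chain_le[where M = "\<lambda>x. - q x" and F = F and a = 0 and b = x])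
      fix y z :: real assume yz: "0 \<le> y" "y \<le> z" "z \<le> x"
      have y: "y \<le> 1/2" and z: "0 \<le> z" "z \<le> 1/2" using yz x by auto
      note ab = a[OF yz(1) y] a[OF z] a_mono[OF yz(1,2) z(2)] b_mono[OF yz(1,2) z(2)]
      have "f (a z) - f (a y) \<le> (z - y) * q y"
        unfolding q_def V_def
      proof (rule harmonic_mean_le)
        show "0 \<le> p (a y)" "0 \<le> - p (b y)" using ab by auto
        show "p (a y) \<le> 2" "- p (b y) \<le> 2"
          using pb[OF ab01(1)[OF yz(1) y]] pb[OF ab01(2)[OF yz(1) y]] by auto
        show "0 \<le> a z - a y" "0 \<le> b y - b z" using ab by auto
        show "a z - a y + (b y - b z) = 2 * (z - y)" by (simp add: b_def)
        show "f (a z) - f (a y) \<le> p (a y) * (a z - a y)" using inc(1)[of "a y" "a z"] ab by simp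
        have "p (b y) * (b y - b z) \<le> f (b y) - f (b z)" using inc(2)[of "b z" "b y"] ab by simp
        then show "f (a z) - f (a y) \<le> - p (b y) * (b y - b z)" using ab by simp
      qed
      moreover have "q z * (z - y) \<le> fn w z - fn w y"
      proof -
        have "integral {y..z} (\<lambda>t. q z) \<le> integral {y..z} (slope w)"
        proof (intro Henstock_Kurzweil_Integration.integral_le slope_integrable)
          fix t assume "t \<in> {y..z}"
          then show "q z \<le> slope w t"
            using q_anti[of t z] w(1)[of t] yz z by (auto simp: q'_def q_def V'_def)
        qed (use yz z in auto)
        then show ?thesis
          using H1_increment[OF fn_H1, of y z w] yz z by (simp add: mult.commute)
      qed
      ultimately show "F z - F y \<le> (z - y) * (- q z - - q y)"
        by (simp add: F_def algebra_simps)
    qed (use x in auto)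
    also have "F 0 = 0"
      using a(1,2)[of 0] by (simp add: F_def f01 fn_0)
    finally show ?thesis by (simp add: F_def)
  qed
  have ge: "min (f x) (f (1 - x)) \<le> fn w x" if x: "0 \<le> x" "x \<le> 1/2" for x
  proof -
    note ax = a[OF x]
    \<comment> \<open>A window of the same length as [x, 1 - x] leaves x or 1 - x outside its
      interior, and outside the window f is no higher than at its ends.\<close>
    have "x \<le> a x \<or> b x \<le> 1 - x" by (auto simp: b_def)
    then have "f x \<le> f (a x) \<or> f (1 - x) \<le> f (a x)"
    proof
      assume le: "x \<le> a x"
      have "0 \<le> p (a x) * (a x - x)" using le ax by simp
      also have "\<dots> \<le> f (a x) - f x" using inc(2)[of x "a x"] le ax x by simp
      finally show ?thesis by simp
    next
      assume le: "b x \<le> 1 - x"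
      have "f (1 - x) - f (b x) \<le> p (b x) * (1 - x - b x)" using inc(1)[of "b x" "1 - x"] le ax x by simp
      also have "\<dots> \<le> 0" using le ax by (simp add: mult_nonpos_nonneg)
      finally show ?thesis using ax by simp
    qed
    then show ?thesis using U_le[OF x] by linarith
  qed
  show thesis
  proof (rule that[OF w_sym])
    show "elastic_energy w \<le> elastic_energy u" using w(2) v(2) by simp
    fix x :: real assume x: "x \<in> {0..1}"
    show "min (fn u x) (fn u (1 - x)) \<le> fn w x"
    proof (cases "x \<le> 1/2")
      case True
      then show ?thesis using ge[of x] x by (simp add: f_def)
    next
      case False
      then have "min (f (1 - x)) (f x) \<le> fn w (1 - x)" using ge[of "1 - x"] x by simp
      also have "fn w (1 - x) = fn w x" by (rule symmetricD[OF w_sym x])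
      finally show ?thesis by (simp add: f_def min.commute)
    qed
  qed
qed

lemma symmetric_minimizer_exists:
  assumes \<psi>: "continuous_on {0..1} \<psi>" "symmetric \<psi>"
    and u0: "u0 \<in> admissible \<psi>" "elastic_energy u0 \<le> (G 2)\<^sup>2"
  obtains w where "minimizer \<psi> w" "symmetric (fn w)"
proof -
  obtain u where u: "minimizer \<psi> u" "elastic_energy u \<le> (G 2)\<^sup>2"
    using minimizer_exists[OF \<psi>(1) u0] by auto
  have adm: "\<psi> x \<le> fn u x" if "x \<in> {0..1}" for x
    using u(1) admissible_iff[OF \<psi>(1)] that by (simp add: minimizer_def)
  show thesis
  proof (rule concave_symmetrization[of u])
    show "slope u y \<le> slope u x" if "0 \<le> x" "x \<le> y" "y \<le> 1" for x y
      using critical_point_slope_antimono[OF minimizer_imp_critical_point[OF u(1)] that] .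
    show "\<bar>slope u x\<bar> \<le> 2" if "x \<in> {0..1}" for x
      using slope_le_of_energy[OF u(2) _ that] by simp
    fix w
    assume w: "symmetric (fn w)" "elastic_energy w \<le> elastic_energy u"
      "\<And>x. x \<in> {0..1} \<Longrightarrow> min (fn u x) (fn u (1 - x)) \<le> fn w x"
    have "\<psi> x \<le> fn w x" if x: "x \<in> {0..1}" for x
    proof -
      have "\<psi> x = \<psi> (1 - x)" by (rule symmetricD[OF \<psi>(2) x, symmetric])
      then have "\<psi> x \<le> min (fn u x) (fn u (1 - x))"
        using adm[OF x] adm[of "1 - x"] x by simp
      then show ?thesis using w(3)[OF x] by (rule order_trans)
    qed
    then have "w \<in> admissible \<psi>" by (simp add: admissible_iff[OF \<psi>(1)])
    moreover have "elastic_energy w \<le> elastic_energy v" if "v \<in> admissible \<psi>" for v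
      using u(1) w(2) that unfolding minimizer_def by force
    ultimately have "minimizer \<psi> w"
      by (simp add: minimizer_def)
    from this w(1) show thesis by (rule that)
  qed
qed

section \<open>Uniqueness for the Euler-Lagrange equation on a half interval\<close>

text \<open>In this unit the weight is a fifth power and 1 + s^2 a fourth power, so that the
  identities for the first integrals become rational.\<close>

definition quartic_root :: "real \<Rightarrow> real" where
  "quartic_root s = (1 + s\<^sup>2) powr (1 / 4)"

lemma quartic_root_pos: "0 < quartic_root s"
  using one_plus_square_pos[of s] by (simp add: quartic_root_def)

lemma quartic_root_powers:
  "(quartic_root s)\<^sup>2 = sqrt (1 + s\<^sup>2)" "quartic_root s ^ 4 = 1 + s\<^sup>2" "quartic_root s ^ 5 = weight s"
proof -
  have pos: "1 + s\<^sup>2 \<noteq> 0" "0 \<le> 1 + s\<^sup>2" using one_plus_square_pos[of s] by auto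
  show "(quartic_root s)\<^sup>2 = sqrt (1 + s\<^sup>2)"
    using pos by (simp add: quartic_root_def powr_power powr_half_sqrt)
  show "quartic_root s ^ 4 = 1 + s\<^sup>2" "quartic_root s ^ 5 = weight s"
    using pos by (simp_all add: quartic_root_def weight_def powr_power)
qed

lemma quartic_root_mono: "0 \<le> s \<Longrightarrow> s \<le> t \<Longrightarrow> quartic_root s \<le> quartic_root t"
  unfolding quartic_root_def by (intro powr_mono2 add_left_mono power_mono) auto

lemma DERIV_quartic_root: "(quartic_root has_real_derivative s / (2 * quartic_root s ^ 3)) (at s)"
proof -
  have "(quartic_root has_real_derivative 1 / 4 * (1 + s\<^sup>2) powr (1 / 4 - 1) * (2 * s)) (at s)"
    unfolding quartic_root_def using one_plus_square_pos[of s] by (auto intro!: derivative_eq_intros)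
  moreover have "(1 + s\<^sup>2) powr (1 / 4 - 1) = 1 / quartic_root s ^ 3"
    using one_plus_square_pos[of s] by (simp add: quartic_root_def powr_power powr_minus_divide)
  ultimately show ?thesis by (simp add: mult.commute)
qed

text \<open>The antiderivative that integrates the angle equation of an elastica. The absolute value
  makes the integrand continuous on the whole line, hence the integral differentiable everywhere;
  the angles that occur lie in [0, pi/2).\<close>

definition sqrt_sin_integral :: "real \<Rightarrow> real" where
  "sqrt_sin_integral s = (LBINT t=0..s. sqrt \<bar>sin t\<bar>)"

lemma DERIV_sqrt_sin_integral: "(sqrt_sin_integral has_real_derivative sqrt \<bar>sin s\<bar>) (at s)"
proof -
  define R where "R = \<bar>s\<bar> + 1"
  have "((\<lambda>u. LBINT t=ereal 0..u. sqrt \<bar>sin t\<bar>) has_vector_derivative sqrt \<bar>sin s\<bar>) (at s within {- R..R})"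
    by (intro interval_integral_FTC2 continuous_intros) (auto simp: R_def)
  moreover have "at s within {- R..R} = at s"
    by (rule at_within_Icc_at) (auto simp: R_def)
  ultimately show ?thesis
    by (simp add: has_real_derivative_iff_has_vector_derivative sqrt_sin_integral_def[abs_def] zero_ereal_def)
qed

lemma sqrt_sin_integral_0: "sqrt_sin_integral 0 = 0"
  by (simp add: sqrt_sin_integral_def zero_ereal_def)

lemma sqrt_sin_integral_mono:
  assumes "s \<le> t"
  shows "sqrt_sin_integral s \<le> sqrt_sin_integral t"
proof (rule DERIV_nonneg_imp_nondecreasing[OF assms])
  fix x :: real assume "s \<le> x" "x \<le> t"
  show "\<exists>y. (sqrt_sin_integral has_real_derivative y) (at x) \<and> 0 \<le> y"
    using DERIV_sqrt_sin_integral[of x] by (intro exI[of _ "sqrt \<bar>sin x\<bar>"]) simp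
qed

lemma sqrt_sin_integral_increment:
  assumes "0 \<le> s" "s < t" "t \<le> pi / 2"
  shows "sqrt_sin_integral t - sqrt_sin_integral s \<le> (t - s) * sqrt (sin t)"
proof -
  obtain z where z: "s < z" "z < t" "sqrt_sin_integral t - sqrt_sin_integral s = (t - s) * sqrt \<bar>sin z\<bar>"
    using MVT2[OF assms(2) DERIV_sqrt_sin_integral] by blast
  have "sin z \<le> sin t" "0 \<le> sin z"
    using z assms by (auto intro!: sin_monotone_2pi_le sin_ge_zero)
  then show ?thesis
    unfolding z(3) using assms by (intro mult_left_mono) auto
qed

lemma constant_on_half:
  fixes F :: "real \<Rightarrow> real"
  assumes "\<And>x. x \<in> {0..1/2} \<Longrightarrow> (F has_real_derivative 0) (at x within {0..1/2})" "x \<in> {0..1/2}"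
  shows "F x = F 0"
proof -
  have "\<exists>c. \<forall>x\<in>{0..1/2}. F x = c"
    by (rule has_field_derivative_zero_constant) (use assms(1) in auto)
  then obtain c where "\<forall>x\<in>{0..1/2}. F x = c" by blast
  then show ?thesis using assms(2) by simp
qed

text \<open>For \<open>f' = p\<close> and \<open>V = G (p x)\<close> the last two equations say \<open>V'' = - k * weight p\<close>, \<open>V' 0 = 0\<close>.\<close>

definition elastica :: "real \<Rightarrow> real \<Rightarrow> (real \<Rightarrow> real) \<Rightarrow> (real \<Rightarrow> real) \<Rightarrow> (real \<Rightarrow> real) \<Rightarrow> bool" where
  "elastica h k f p H \<longleftrightarrow> 0 < k \<and> 0 < p 0 \<and> f 0 = 0 \<and> H 0 = 0 \<and> f (1/2) = h \<and> p (1/2) = 0 \<and>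
     (\<forall>x\<in>{0..1/2}. 0 \<le> p x \<and> p x \<le> p 0 \<and> 0 \<le> H x \<and>
        (f has_real_derivative p x) (at x within {0..1/2}) \<and>
        (H has_real_derivative weight (p x)) (at x within {0..1/2}) \<and>
        (p has_real_derivative - (k * H x * weight (p x))) (at x within {0..1/2}))"

lemma elasticaD:
  assumes "elastica h k f p H"
  shows "0 < k" "0 < p 0" "f 0 = 0" "H 0 = 0" "f (1/2) = h" "p (1/2) = 0"
    and "\<And>x. x \<in> {0..1/2} \<Longrightarrow> 0 \<le> p x" "\<And>x. x \<in> {0..1/2} \<Longrightarrow> p x \<le> p 0" "\<And>x. x \<in> {0..1/2} \<Longrightarrow> 0 \<le> H x"
    and "\<And>x. x \<in> {0..1/2} \<Longrightarrow> (f has_real_derivative p x) (at x within {0..1/2})"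
    and "\<And>x. x \<in> {0..1/2} \<Longrightarrow> (H has_real_derivative weight (p x)) (at x within {0..1/2})"
    and "\<And>x. x \<in> {0..1/2} \<Longrightarrow> (p has_real_derivative - (k * H x * weight (p x))) (at x within {0..1/2})"
  using assms unfolding elastica_def by blast+

lemma elastica_energy_integral:
  assumes e: "elastica h k f p H" and x: "x \<in> {0..1/2}"
  shows "k * (H x)\<^sup>2 = 2 * (p 0 - p x)"
proof -
  note D = elasticaD[OF e]
  have "((\<lambda>x. k * (H x)\<^sup>2 + 2 * p x) has_real_derivative
      k * (2 * H x * weight (p x)) + 2 * (- (k * H x * weight (p x)))) (at x within {0..1/2})"
    if "x \<in> {0..1/2}" for x
    by (auto intro!: derivative_eq_intros D(11,12)[OF that])
  then have "k * (H x)\<^sup>2 + 2 * p x = k * (H 0)\<^sup>2 + 2 * p 0"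
    by (intro constant_on_half[OF _ x]) simp
  then show ?thesis by (simp add: D(4))
qed

text \<open>The left side is - 1 / k times the curvature of the graph, so curvature is proportional
  to the distance from the line through the left end perpendicular to the initial tangent. After
  insertion of the energy integral the squares of p x cancel, and the derivative of the left side
  becomes 1 + p 0 * p x.\<close>

lemma elastica_linear_integral:
  assumes e: "elastica h k f p H" and x: "x \<in> {0..1/2}"
  shows "H x / quartic_root (p x) = x + p 0 * f x"
proof -
  note D = elasticaD[OF e]
  have "((\<lambda>x. H x / quartic_root (p x) - (x + p 0 * f x)) has_real_derivative 0) (at x within {0..1/2})"
    if x: "x \<in> {0..1/2}" for x
  proof -
    let ?r = "quartic_root (p x)"
    have r: "0 < ?r" by (rule quartic_root_pos)
    have "((\<lambda>x. quartic_root (p x)) has_real_derivative p x / (2 * ?r ^ 3) * (- (k * H x * weight (p x)))) (at x within {0..1/2})"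
      by (rule DERIV_chain2[OF DERIV_quartic_root D(12)[OF x]])
    then have "((\<lambda>x. H x / quartic_root (p x) - (x + p 0 * f x)) has_real_derivative
        (weight (p x) * ?r - H x * (p x / (2 * ?r ^ 3) * (- (k * H x * weight (p x))))) / (?r * ?r)
          - (1 + p 0 * p x)) (at x within {0..1/2})"
      using r by (auto intro!: derivative_eq_intros D(10,11)[OF x])
    moreover have "(weight (p x) * ?r - H x * (p x / (2 * ?r ^ 3) * (- (k * H x * weight (p x))))) / (?r * ?r)
        = ?r ^ 4 + p x * (k * (H x)\<^sup>2) / 2"
      using r unfolding quartic_root_powers(3)[symmetric]
      by (simp add: field_simps power2_eq_square power3_eq_cube power4_eq_xxxx eval_nat_numeral)
    moreover have "?r ^ 4 + p x * (k * (H x)\<^sup>2) / 2 = 1 + p 0 * p x"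
      unfolding elastica_energy_integral[OF e x] quartic_root_powers
      by (simp add: power2_eq_square field_simps)
    ultimately show ?thesis by simp
  qed
  from constant_on_half[OF this x] show ?thesis
    by (simp add: D(3,4))
qed

text \<open>For the angle \<theta> against the initial tangent, sin \<theta> is p 0 - p x over the
  two square roots of 1 + p^2, and k * H x is the square root of 2 * k * (p 0 - p x). Hence
  \<theta>' * sqrt (sin \<theta>) is a constant multiple of p 0 - p x. Up to a factor, the right
  side is the distance from the initial tangent.\<close>

lemma elastica_angle_integral:
  assumes e: "elastica h k f p H" and x: "x \<in> {0..1/2}"
  shows "sqrt_sin_integral (arctan (p 0) - arctan (p x)) = sqrt (2 * k) / quartic_root (p 0) * (p 0 * x - f x)"
proof -
  note D = elasticaD[OF e]
  define c where "c = sqrt (2 * k) / quartic_root (p 0)"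
  have "((\<lambda>x. sqrt_sin_integral (arctan (p 0) - arctan (p x)) - c * (p 0 * x - f x)) has_real_derivative 0) (at x within {0..1/2})"
    if x: "x \<in> {0..1/2}" for x
  proof -
    let ?r = "quartic_root (p x)" and ?rz = "quartic_root (p 0)"
    define y where "y = sqrt (p 0 - p x)"
    have r: "0 < ?r" "0 < ?rz" by (rule quartic_root_pos)+
    have yy: "y * y = p 0 - p x" using D(8)[OF x] by (simp add: y_def)
    have y0: "0 \<le> y" using D(8)[OF x] by (simp add: y_def)
    have "sin (arctan (p 0) - arctan (p x)) = (p 0 - p x) / (?rz\<^sup>2 * ?r\<^sup>2)"
      unfolding sin_diff sin_arctan cos_arctan quartic_root_powers(1) by (simp add: diff_divide_distrib)
    also have "\<dots> = (y / (?rz * ?r))\<^sup>2"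
      by (simp add: power2_eq_square yy)
    finally have s: "sqrt \<bar>sin (arctan (p 0) - arctan (p x))\<bar> = y / (?rz * ?r)"
      using y0 r by simp
    have "(k * H x)\<^sup>2 = k * (k * (H x)\<^sup>2)" by (simp add: power2_eq_square)
    also have "\<dots> = 2 * k * y\<^sup>2"
      unfolding elastica_energy_integral[OF e x] by (simp add: power2_eq_square yy)
    finally have "sqrt ((k * H x)\<^sup>2) = sqrt (2 * k * y\<^sup>2)" by (rule arg_cong)
    then have kH: "k * H x = sqrt (2 * k) * y"
      using D(1) D(9)[OF x] y0 by (simp add: real_sqrt_mult)
    have "((\<lambda>x. arctan (p 0) - arctan (p x)) has_real_derivative 0 - inverse (1 + (p x)\<^sup>2) * (- (k * H x * weight (p x)))) (at x within {0..1/2})"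
      by (intro DERIV_diff DERIV_const DERIV_chain2[OF DERIV_arctan D(12)[OF x]])
    from DERIV_chain2[OF DERIV_sqrt_sin_integral this]
    have "((\<lambda>x. sqrt_sin_integral (arctan (p 0) - arctan (p x)) - c * (p 0 * x - f x)) has_real_derivative
        sqrt \<bar>sin (arctan (p 0) - arctan (p x))\<bar> * (0 - inverse (1 + (p x)\<^sup>2) * (- (k * H x * weight (p x))))
         - c * (p 0 - p x)) (at x within {0..1/2})"
      by (auto intro!: derivative_eq_intros D(10)[OF x])
    moreover have "sqrt \<bar>sin (arctan (p 0) - arctan (p x))\<bar> * (0 - inverse (1 + (p x)\<^sup>2) * (- (k * H x * weight (p x))))
        = c * (p 0 - p x)"
      unfolding s kH quartic_root_powers(2)[symmetric] quartic_root_powers(3)[symmetric] yy[symmetric] c_def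
      using r by (simp add: field_simps eval_nat_numeral)
    ultimately show ?thesis by simp
  qed
  from constant_on_half[OF this x] show ?thesis
    by (simp add: D(3) sqrt_sin_integral_0 c_def)
qed

section \<open>The initial slope determined by the height of the tip\<close>

lemma tan_arctan_diff:
  assumes "0 < p" "0 < q"
  shows "tan (arctan p - arctan q) = (p - q) / (1 + p * q)" "- (pi / 2) < arctan p - arctan q" "arctan p - arctan q < pi / 2"
proof -
  have b: "0 < arctan p" "arctan p < pi / 2" "0 < arctan q" "arctan q < pi / 2"
    using assms arctan_ubound by auto
  then show B: "- (pi / 2) < arctan p - arctan q" "arctan p - arctan q < pi / 2" by linarith+
  have "cos (arctan p - arctan q) \<noteq> 0"
    using cos_gt_zero_pi[OF B] by simp
  then show "tan (arctan p - arctan q) = (p - q) / (1 + p * q)"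
    by (subst tan_diff) (auto simp: tan_arctan)
qed

text \<open>All three integrals are evaluated at 1/2, where the slope is 0 and the height is h;
  eliminating k leaves an equation in the initial angle. The number 2 * h is the slope of the chord
  from the left end to the tip, so the right side is the tangent of the angle between initial
  tangent and chord.\<close>

lemma elastica_parameters:
  assumes e: "elastica h k f p H" and h: "0 < h"
  shows "k = 2 * p 0 / (1/2 + p 0 * h)\<^sup>2"
    and "sqrt_sin_integral (arctan (p 0)) / (2 * sqrt (sin (arctan (p 0)))) = tan (arctan (p 0) - arctan (2 * h))"
proof -
  note D = elasticaD[OF e]
  let ?rz = "quartic_root (p 0)"
  have half: "1/2 \<in> {0..1/2::real}" by simp
  define m where "m = 1/2 + p 0 * h"
  have m: "0 < m" using D(2) h by (simp add: m_def add_pos_pos)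
  have H: "H (1/2) = m"
    using elastica_linear_integral[OF e half] by (simp add: D(5,6) m_def quartic_root_def)
  have "k * m\<^sup>2 = 2 * p 0"
    using elastica_energy_integral[OF e half] by (simp add: H D(6))
  then have "k = 2 * p 0 / m\<^sup>2"
    using m by (simp add: field_simps)
  then show k: "k = 2 * p 0 / (1/2 + p 0 * h)\<^sup>2"
    by (simp only: m_def)
  have r0: "0 < ?rz" by (rule quartic_root_pos)
  define y where "y = sqrt (p 0)"
  have y: "0 < y" using D(2) by (simp add: y_def)
  have "sin (arctan (p 0)) = p 0 / ?rz\<^sup>2"
    by (simp add: sin_arctan quartic_root_powers(1))
  then have s: "sqrt (sin (arctan (p 0))) = y / ?rz"
    using r0 by (simp add: real_sqrt_divide y_def)
  have "sqrt (2 * k) = sqrt ((2 * y / m)\<^sup>2)"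
    unfolding k m_def[symmetric] using D(2) by (simp add: y_def power_divide power_mult_distrib)
  then have sk: "sqrt (2 * k) = 2 * y / m" using y m by simp
  have "sqrt_sin_integral (arctan (p 0)) = 2 * y / m / ?rz * (p 0 / 2 - h)"
    using elastica_angle_integral[OF e half] by (simp add: D(5,6) sk)
  then have "sqrt_sin_integral (arctan (p 0)) / (2 * sqrt (sin (arctan (p 0)))) = (p 0 / 2 - h) / m"
    unfolding s using y r0 m by (simp add: field_simps)
  also have "\<dots> = (p 0 - 2 * h) / (1 + p 0 * (2 * h))"
  proof -
    have "(p 0 - 2 * h) = 2 * (p 0 / 2 - h)" "1 + p 0 * (2 * h) = 2 * m"
      by (simp_all add: m_def)
    then show ?thesis by (simp only: mult_divide_mult_cancel_left_if) simp
  qed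
  also have "\<dots> = tan (arctan (p 0) - arctan (2 * h))"
    using tan_arctan_diff(1)[of "p 0" "2 * h"] D(2) h by simp
  finally show "sqrt_sin_integral (arctan (p 0)) / (2 * sqrt (sin (arctan (p 0)))) = tan (arctan (p 0) - arctan (2 * h))" .
qed

text \<open>As functions of the initial angle, the left side of the previous equation grows at most at rate
  \<open>1/2\<close> and the right side at least at rate \<open>1\<close>.\<close>

lemma initial_slope_unique:
  assumes p: "0 < p" "0 < q" and h: "0 < h"
    and P: "sqrt_sin_integral (arctan p) / (2 * sqrt (sin (arctan p))) = tan (arctan p - arctan h)"
    and Q: "sqrt_sin_integral (arctan q) / (2 * sqrt (sin (arctan q))) = tan (arctan q - arctan h)"
  shows "\<not> p < q"
proof
  assume "p < q"
  define s t where "s = arctan p" and "t = arctan q"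
  have st: "0 < s" "s < t" "t < pi / 2"
    using p arctan_monotone[OF \<open>p < q\<close>] arctan_ubound[of q] by (simp_all add: s_def t_def)
  define c where "c = arctan h"
  have cb: "- (pi / 2) < s - c" "t - c < pi / 2"
    using tan_arctan_diff(2)[OF p(1) h] tan_arctan_diff(3)[OF p(2) h] by (auto simp: s_def t_def c_def)
  obtain z where z: "s - c < z" "z < t - c" "tan (t - c) - tan (s - c) = (t - c - (s - c)) * inverse ((cos z)\<^sup>2)"
  proof -
    have "\<exists>z. s - c < z \<and> z < t - c \<and> tan (t - c) - tan (s - c) = (t - c - (s - c)) * inverse ((cos z)\<^sup>2)"
    proof (rule MVT2[where f = tan and f' = "\<lambda>x. inverse ((cos x)\<^sup>2)"])
      show "s - c < t - c" using st by simp
      fix x assume "s - c \<le> x" "x \<le> t - c"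
      then have "cos x \<noteq> 0" using cos_gt_zero_pi[of x] cb by simp
      then show "(tan has_real_derivative inverse ((cos x)\<^sup>2)) (at x)" by (rule DERIV_tan)
    qed
    then show thesis using that by blast
  qed
  have "0 < cos z" using cos_gt_zero_pi[of z] cb z by simp
  then have "1 \<le> inverse ((cos z)\<^sup>2)"
    using power_le_one[of "cos z" 2] by (intro one_le_inverse) auto
  then have tan_ge: "t - s \<le> tan (t - c) - tan (s - c)"
    unfolding z(3) using st by (simp add: mult_le_cancel_left1)
  define a b where "a = sqrt (sin s)" and "b = sqrt (sin t)"
  have "0 < sin s" "sin s \<le> sin t"
    using st by (auto intro!: sin_gt_zero sin_monotone_2pi_le)
  then have ab: "0 < a" "a \<le> b" by (auto simp: a_def b_def)
  define I J where "I = sqrt_sin_integral s" and "J = sqrt_sin_integral t"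
  have "0 \<le> I" using sqrt_sin_integral_mono[of 0 s] st by (simp add: I_def sqrt_sin_integral_0)
  have "J - I \<le> (t - s) * b"
    unfolding I_def J_def b_def using st by (intro sqrt_sin_integral_increment) auto
  \<comment> \<open>Replacing a by the larger b enlarges the difference because I is
    nonnegative.\<close>
  have "J / (2 * b) - I / (2 * a) \<le> J / (2 * b) - I / (2 * b)"
    using \<open>0 \<le> I\<close> ab by (intro diff_left_mono divide_left_mono) auto
  also have "\<dots> = (J - I) / (2 * b)" by (simp add: diff_divide_distrib)
  also have "\<dots> \<le> (t - s) / 2"
    using \<open>J - I \<le> (t - s) * b\<close> ab by (simp add: field_simps)
  finally have "tan (t - c) - tan (s - c) \<le> (t - s) / 2"
    using P Q by (simp add: a_def b_def I_def J_def s_def t_def c_def)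
  then show False using tan_ge st by simp
qed

text \<open>The comparison is pointwise. A smaller first slope means a larger H by the energy
  integral, hence a larger height by the linear integral; but it also means a larger turning angle,
  hence a height that is no larger by the angle integral.\<close>

lemma elastica_slope_le:
  assumes e1: "elastica h k f\<^sub>1 p\<^sub>1 H\<^sub>1" and e2: "elastica h k f\<^sub>2 p\<^sub>2 H\<^sub>2" and eq: "p\<^sub>1 0 = p\<^sub>2 0"
    and x: "x \<in> {0..1/2}"
  shows "p\<^sub>2 x \<le> p\<^sub>1 x"
proof (rule ccontr)
  assume "\<not> p\<^sub>2 x \<le> p\<^sub>1 x"
  then have lt: "p\<^sub>1 x < p\<^sub>2 x" by simp
  note D1 = elasticaD[OF e1] and D2 = elasticaD[OF e2]
  have "k * (H\<^sub>2 x)\<^sup>2 < k * (H\<^sub>1 x)\<^sup>2"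
    unfolding elastica_energy_integral[OF e1 x] elastica_energy_integral[OF e2 x] using lt eq by simp
  then have "(H\<^sub>2 x)\<^sup>2 < (H\<^sub>1 x)\<^sup>2" using D1(1) by simp
  then have "H\<^sub>2 x < H\<^sub>1 x" using D1(9)[OF x] by (rule power2_less_imp_less)
  moreover have "quartic_root (p\<^sub>1 x) \<le> quartic_root (p\<^sub>2 x)"
    using D1(7)[OF x] lt by (intro quartic_root_mono) auto
  ultimately have "H\<^sub>2 x / quartic_root (p\<^sub>2 x) < H\<^sub>1 x / quartic_root (p\<^sub>1 x)"
    using D2(9)[OF x] quartic_root_pos by (intro frac_less) auto
  then have "p\<^sub>1 0 * f\<^sub>2 x < p\<^sub>1 0 * f\<^sub>1 x"
    unfolding elastica_linear_integral[OF e1 x] elastica_linear_integral[OF e2 x] using eq by simp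
  then have f: "f\<^sub>2 x < f\<^sub>1 x" using D1(2) by simp
  have "sqrt_sin_integral (arctan (p\<^sub>2 0) - arctan (p\<^sub>2 x)) \<le> sqrt_sin_integral (arctan (p\<^sub>1 0) - arctan (p\<^sub>1 x))"
    using lt eq by (intro sqrt_sin_integral_mono) (simp add: arctan_monotone')
  then have "sqrt (2 * k) / quartic_root (p\<^sub>1 0) * (p\<^sub>1 0 * x - f\<^sub>2 x) \<le> sqrt (2 * k) / quartic_root (p\<^sub>1 0) * (p\<^sub>1 0 * x - f\<^sub>1 x)"
    unfolding elastica_angle_integral[OF e1 x] elastica_angle_integral[OF e2 x] by (simp only: eq)
  moreover have "0 < sqrt (2 * k) / quartic_root (p\<^sub>1 0)"
    using D1(1) quartic_root_pos by simp
  ultimately have "p\<^sub>1 0 * x - f\<^sub>2 x \<le> p\<^sub>1 0 * x - f\<^sub>1 x"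
    using mult_le_cancel_left_pos by blast
  then show False using f by simp
qed

theorem elastica_unique:
  assumes h: "0 < h" and e1: "elastica h k\<^sub>1 f\<^sub>1 p\<^sub>1 H\<^sub>1" and e2: "elastica h k\<^sub>2 f\<^sub>2 p\<^sub>2 H\<^sub>2"
    and x: "x \<in> {0..1/2}"
  shows "p\<^sub>1 x = p\<^sub>2 x"
proof -
  have eq: "p\<^sub>1 0 = p\<^sub>2 0"
    using initial_slope_unique[OF elasticaD(2)[OF e1] elasticaD(2)[OF e2], of "2 * h"]
      initial_slope_unique[OF elasticaD(2)[OF e2] elasticaD(2)[OF e1], of "2 * h"]
      elastica_parameters(2)[OF e1 h] elastica_parameters(2)[OF e2 h] h by force
  have "k\<^sub>1 = k\<^sub>2"
    using elastica_parameters(1)[OF e1 h] elastica_parameters(1)[OF e2 h] eq by simp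
  with e2 have e2': "elastica h k\<^sub>1 f\<^sub>2 p\<^sub>2 H\<^sub>2" by simp
  show ?thesis
    by (rule antisym[OF elastica_slope_le[OF e2' e1 eq[symmetric] x] elastica_slope_le[OF e1 e2' eq x]])
qed

section \<open>Symmetric critical points over a cone\<close>

lemma symmetric_slope_half:
  assumes "symmetric (fn w)"
  shows "slope w (1/2) = 0"
proof -
  have D: "(fn w has_real_derivative slope w (1/2)) (at (1/2))"
    by (rule fn_deriv) auto
  have "((\<lambda>x. fn w (1 - x)) has_real_derivative slope w (1 - 1/2) * (- 1)) (at (1/2))"
    by (rule DERIV_chain2[where f = "fn w" and g = "\<lambda>x. 1 - x"]) (auto intro!: fn_deriv derivative_eq_intros)
  then have "(fn w has_real_derivative slope w (1 - 1/2) * (- 1)) (at (1/2))"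
    by (rule has_field_derivative_transform_within_open[of _ _ _ "{0<..<1}"])
      (auto intro!: symmetricD[OF assms])
  from DERIV_unique[OF D this] show ?thesis by simp
qed

lemma critical_point_two_sided:
  assumes crit: "critical_point \<psi> w" and \<epsilon>: "0 < \<epsilon>"
    and le: "\<And>x. x \<in> {0..1} \<Longrightarrow> \<epsilon> * \<bar>fn \<phi> x\<bar> \<le> fn w x - \<psi> x"
  shows "first_variation w \<phi> = 0"
proof -
  have lin: "first_variation w (c *\<^sub>R \<phi>) = c * first_variation w \<phi>" for c
    using linear_cmul[OF bounded_linear.linear[OF first_variation_bounded_linear], of w c \<phi>] by simp
  have ge: "0 \<le> c * first_variation w \<phi>" if c: "\<bar>c\<bar> = \<epsilon>" for c
  proof -
    have "\<psi> x \<le> fn (w + c *\<^sub>R \<phi>) x" if x: "x \<in> {0..1}" for x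
    proof -
      have "\<bar>c * fn \<phi> x\<bar> \<le> fn w x - \<psi> x" using le[OF x] c by (simp add: abs_mult)
      then show ?thesis by (simp add: plus_sobolev.rep_eq scaleR_sobolev.rep_eq abs_le_iff)
    qed
    then have "w + c *\<^sub>R \<phi> \<in> admissible \<psi>"
      unfolding admissible_def by (auto intro!: AE_I2)
    then have "0 \<le> first_variation w (w + c *\<^sub>R \<phi> - w)"
      using crit unfolding critical_point_iff by blast
    then show ?thesis by (simp add: lin)
  qed
  have "0 \<le> \<epsilon> * first_variation w \<phi>" "0 \<le> - \<epsilon> * first_variation w \<phi>"
    using ge[of \<epsilon>] ge[of "- \<epsilon>"] \<epsilon> by auto
  then have "\<epsilon> * first_variation w \<phi> = 0" by simp
  then show ?thesis using \<epsilon> by simp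
qed

text \<open>Concavity keeps w above its chord, so over a cone contact away from the ends is possible
  only at the tip, and variations supported on the left half are free. In L2 of that half,
  \<open>curv w\<close> is then orthogonal to everything orthogonal to H, hence a multiple of
  H.\<close>

lemma symmetric_critical_point_elastica:
  assumes \<psi>: "continuous_on {0..1} \<psi>" "symmetric \<psi>" "\<psi> 0 < 0" "0 < \<psi> (1/2)"
    and cone: "\<And>x. x \<in> {0..1/2} \<Longrightarrow> \<psi> x = (1 - 2 * x) * \<psi> 0 + 2 * x * \<psi> (1/2)"
    and crit: "critical_point \<psi> w" and sym: "symmetric (fn w)"
  obtains k H where "elastica (\<psi> (1/2)) k (fn w) (slope w) H"
proof -
  define f p g where "f = fn w" and "p = slope w" and "g = curv w"
  define \<beta> h where "\<beta> = - \<psi> 0" and "h = \<psi> (1/2)"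
  have \<beta>: "0 < \<beta>" and h: "0 < h" using \<psi> by (auto simp: \<beta>_def h_def)
  have adm: "\<psi> x \<le> f x" if "x \<in> {0..1}" for x
    using crit that unfolding critical_point_iff admissible_iff[OF \<psi>(1)] f_def by blast
  have f0: "f 0 = 0" "f 1 = 0" by (simp_all add: f_def fn_0 fn_1)
  have p: "p y \<le> p x" if "0 \<le> x" "x \<le> y" "y \<le> 1" for x y
    unfolding p_def using critical_point_slope_antimono[OF crit that] .
  have p_half: "p (1/2) = 0" unfolding p_def by (rule symmetric_slope_half[OF sym])
  have pc: "continuous_on {0..1} p" by (simp add: p_def slope_continuous)
  have f_inc: "f y - f x = integral {x..y} p" if "0 \<le> x" "x \<le> y" "y \<le> 1" for x y
    unfolding f_def p_def using that by (rule H1_increment[OF fn_H1])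
  have inc: "f y - f x \<le> p x * (y - x)" "p y * (y - x) \<le> f y - f x" if "0 \<le> x" "x \<le> y" "y \<le> 1" for x y
    unfolding f_def p_def
    by (rule slope_antimono_increment[OF critical_point_slope_antimono[OF crit] that]; assumption)+
  have conc: "2 * x * f (1/2) \<le> f x" if x: "x \<in> {0..1/2}" for x
  proof -
    have "x * (f (1/2) - f x) \<le> x * (p x * (1/2 - x))"
      using inc(1)[of x "1/2"] x by (intro mult_left_mono) auto
    also have "\<dots> = (p x * (x - 0)) * (1/2 - x)" by simp
    also have "\<dots> \<le> (f x - f 0) * (1/2 - x)"
      using inc(2)[of 0 x] x by (intro mult_right_mono) auto
    finally show ?thesis by (simp add: f0 algebra_simps)
  qed
  have gap: "(1 - 2 * x) * \<beta> + 2 * x * (f (1/2) - h) \<le> f x - \<psi> x" if x: "x \<in> {0..1/2}" for x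
    using conc[OF x] cone[OF x] by (simp add: \<beta>_def h_def algebra_simps)
  \<comment> \<open>A positive gap at the tip spreads to a uniform gap, and every variation becomes
    free. The choice \<zeta> = - 1 then gives equal slopes at both ends, so the decreasing slope
    vanishes identically and w cannot reach the tip.\<close>
  have contact: "f (1/2) = h"
  proof (rule ccontr)
    assume "f (1/2) \<noteq> h"
    then have gt: "h < f (1/2)" using adm[of "1/2"] by (simp add: h_def)
    define \<delta> where "\<delta> = min \<beta> (f (1/2) - h)"
    have \<delta>: "0 < \<delta>" using gt \<beta> by (simp add: \<delta>_def)
    have low: "\<delta> \<le> f x - \<psi> x" if x: "x \<in> {0..1}" for x
    proof -
      have half: "\<delta> \<le> f x - \<psi> x" if x: "x \<in> {0..1/2}" for x
      proof -
        have "\<delta> = (1 - 2 * x) * \<delta> + 2 * x * \<delta>" by (simp add: algebra_simps)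
        also have "\<dots> \<le> (1 - 2 * x) * \<beta> + 2 * x * (f (1/2) - h)"
          using x by (intro add_mono mult_left_mono) (auto simp: \<delta>_def)
        also have "\<dots> \<le> f x - \<psi> x" by (rule gap[OF x])
        finally show ?thesis .
      qed
      show ?thesis
      proof (cases "x \<le> 1/2")
        case False
        then show ?thesis
          using half[of "1 - x"] x symmetricD[OF sym x] symmetricD[OF \<psi>(2) x] by (simp add: f_def)
      qed (use half x in auto)
    qed
    have m1: "(\<lambda>x. - 1 :: real) \<in> L2" using L2_cmult[OF L2_one, of "-1"] by simp
    obtain \<phi> where \<phi>: "first_variation w \<phi> = 2 * integral {0..1} (\<lambda>x. curv w x * (- 1))"
      using decreasing_variation[OF m1, of w] by auto
    obtain B where B: "B \<ge> 0" "\<And>x. x \<in> {0..1} \<Longrightarrow> \<bar>fn \<phi> x\<bar> \<le> B"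
      using H1_bounded[OF fn_H1] by blast
    have "first_variation w \<phi> = 0"
    proof (rule critical_point_two_sided[OF crit, of "\<delta> / (B + 1)"])
      show "0 < \<delta> / (B + 1)" using \<delta> B by simp
      fix x :: real assume x: "x \<in> {0..1}"
      have "\<delta> / (B + 1) * \<bar>fn \<phi> x\<bar> \<le> \<delta> / (B + 1) * (B + 1)"
        using \<delta> B(1) B(2)[OF x] by (intro mult_left_mono) auto
      also have "\<dots> = \<delta>" using B by simp
      finally show "\<delta> / (B + 1) * \<bar>fn \<phi> x\<bar> \<le> fn w x - \<psi> x"
        using low[OF x] by (simp add: f_def)
    qed
    then have "integral {0..1} (curv w) = 0" using \<phi> by simp
    then have "G (p 1) = G (p 0)"
      using H1_increment[OF G_slope_H1, of 0 1 w] by (simp add: p_def)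
    then have "p 1 = p 0" by simp
    then have "p x = 0" if "x \<in> {0..1}" for x
      using p[of 0 x] p[of x 1] p[of 0 "1/2"] p[of "1/2" 1] p_half that by auto
    then have "integral {0..1/2} p = integral {0..1/2} (\<lambda>_::real. 0)"
      by (intro Henstock_Kurzweil_Integration.integral_cong) auto
    then have "f (1/2) = 0" using f_inc[of 0 "1/2"] f0 by simp
    then show False using gt h by simp
  qed
  have p0: "0 < p 0" using inc(1)[of 0 "1/2"] contact h f0 by simp

  \<comment> \<open>Integration by parts turns the mean-zero condition on weight times \<eta> into
    orthogonality of \<zeta> to this primitive; the boundary terms vanish because H 0 = 0 and \<eta>
    1 = 0.\<close>
  define H where "H x = 0 + integral {0..x} (\<lambda>t. weight (p t))" for x
  have hc: "continuous_on {0..1} (\<lambda>t. weight (p t))"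
    unfolding p_def by (rule weight_slope_continuous)
  have HH: "H1 H (\<lambda>t. weight (p t))"
    unfolding H_def by (rule H1_primitive[OF continuous_L2[OF hc]])
  have HL: "H \<in> L2" by (rule H1_fun_L2[OF HH])
  have gL: "g \<in> L2" by (simp add: g_def curv_L2)
  have Hge: "x \<le> H x" if "x \<in> {0..1}" for x
    using integral_weight_ge[of 0 x w] that by (simp add: H_def p_def)

  text \<open>A variation that vanishes on \<open>[1/2, 1]\<close> is admissible in both directions: it decays linearly
    towards the contact point, where \<open>f - \<psi>\<close> opens at least linearly.\<close>
  have free: "integral {0..1} (\<lambda>x. g x * \<zeta> x) = 0"
    if \<zeta>: "\<zeta> \<in> L2" "\<And>x. 1/2 < x \<Longrightarrow> \<zeta> x = 0" and 0: "integral {0..1} (\<lambda>x. H x * \<zeta> x) = 0" for \<zeta>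
  proof -
    \<comment> \<open>The initial value is chosen so that \<eta> vanishes from 1/2 onwards.\<close>
    define \<eta> where "\<eta> x = - integral {0..1} \<zeta> + integral {0..x} \<zeta>" for x
    have \<eta>H: "H1 \<eta> \<zeta>" unfolding \<eta>_def by (rule H1_primitive[OF \<zeta>(1)])
    have \<eta>0: "\<eta> x = 0" if x: "x \<in> {1/2..1}" for x
    proof -
      have "integral {x..1} \<zeta> = integral {x..1} (\<lambda>_. 0)"
        by (rule integral_spike[of "{1/2}"]) (use x \<zeta>(2) in auto)
      then have "\<eta> 1 - \<eta> x = 0" using H1_increment[OF \<eta>H, of x 1] x by simp
      then show ?thesis by (simp add: \<eta>_def)
    qed
    have "integral {0..1} (\<lambda>x. weight (p x) * \<eta> x + H x * \<zeta> x) = H 1 * \<eta> 1 - H 0 * \<eta> 0"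
      using H1_increment[OF H1_mult[OF HH \<eta>H], of 0 1] by simp
    also have "\<dots> = 0" using \<eta>0[of 1] by (simp add: H_def)
    finally have "integral {0..1} (\<lambda>x. weight (p x) * \<eta> x) + integral {0..1} (\<lambda>x. H x * \<zeta> x) = 0"
      using L2_mult_integrable[OF continuous_L2[OF hc] H1_fun_L2[OF \<eta>H], of 0 1] L2_mult_integrable[OF HL \<zeta>(1), of 0 1]
      by (simp add: Henstock_Kurzweil_Integration.integral_add)
    then have i0: "integral {0..1} (\<lambda>x. weight (slope w x) * \<eta> x) = 0" using 0 by (simp add: p_def)
    obtain \<phi> where \<phi>: "\<And>x. x \<in> {0..1} \<Longrightarrow> slope \<phi> x = weight (slope w x) * \<eta> x"
      "first_variation w \<phi> = 2 * integral {0..1} (\<lambda>x. curv w x * \<zeta> x)"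
      using weighted_variation[OF \<eta>H i0] by metis
    have \<phi>1: "fn \<phi> x = 0" if x: "x \<in> {1/2..1}" for x
    proof -
      have "integral {x..1} (slope \<phi>) = integral {x..1} (\<lambda>_. 0)"
        by (rule Henstock_Kurzweil_Integration.integral_cong) (use x \<phi>(1) \<eta>0 in auto)
      then show ?thesis using H1_increment[OF fn_H1, of x 1 \<phi>] x by (simp add: fn_1)
    qed
    have \<phi>2: "\<bar>fn \<phi> x\<bar> \<le> norm \<phi> * (1/2 - x)" if x: "x \<in> {0..1/2}" for x
    proof -
      have "\<bar>integral {x..1/2} (slope \<phi>)\<bar> \<le> integral {x..1/2} (\<lambda>_. norm \<phi>)"
        using x by (intro integral_abs_bound slope_integrable slope_le_norm) auto
      then show ?thesis
        using H1_increment[OF fn_H1, of x "1/2" \<phi>] x \<phi>1[of "1/2"] by (simp add: mult.commute)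
    qed
    have "first_variation w \<phi> = 0"
    proof (rule critical_point_two_sided[OF crit, of "2 * \<beta> / (norm \<phi> + 1)"])
      show "0 < 2 * \<beta> / (norm \<phi> + 1)" using \<beta> by (simp add: add_nonneg_pos)
      fix x :: real assume x: "x \<in> {0..1}"
      show "2 * \<beta> / (norm \<phi> + 1) * \<bar>fn \<phi> x\<bar> \<le> fn w x - \<psi> x"
      proof (cases "x \<le> 1/2")
        case True
        then have x': "x \<in> {0..1/2}" using x by simp
        have "2 * \<beta> / (norm \<phi> + 1) * \<bar>fn \<phi> x\<bar> \<le> 2 * \<beta> / (norm \<phi> + 1) * ((norm \<phi> + 1) * (1/2 - x))"
        proof (intro mult_left_mono)
          have "norm \<phi> * (1/2 - x) \<le> (norm \<phi> + 1) * (1/2 - x)"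
            using x' by (intro mult_right_mono) auto
          then show "\<bar>fn \<phi> x\<bar> \<le> (norm \<phi> + 1) * (1/2 - x)" using \<phi>2[OF x'] by linarith
        qed (use \<beta> in simp)
        also have "\<dots> = (1 - 2 * x) * \<beta>"
          using add_nonneg_pos[OF norm_ge_zero[of \<phi>] zero_less_one] by (simp add: field_simps)
        also have "\<dots> \<le> f x - \<psi> x" using gap[OF x'] contact by simp
        finally show ?thesis by (simp add: f_def)
      next
        case False
        then show ?thesis using \<phi>1[of x] adm[OF x] x by (simp add: f_def)
      qed
    qed
    then show ?thesis using \<phi>(2) by (simp add: g_def)
  qed

  define J where "J = (indicator {0..1/2} :: real \<Rightarrow> real)"
  have JJ: "J x * J x = J x" for x by (simp add: J_def indicator_def)
  have JL: "(\<lambda>x. J x * g x) \<in> L2" "(\<lambda>x. J x * H x) \<in> L2"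
    unfolding J_def by (intro L2_indicator gL HL; simp)+
  define A where "A = integral {0..1} (\<lambda>x. (J x * H x) * (J x * H x))"
  define B where "B = integral {0..1} (\<lambda>x. (J x * g x) * (J x * H x))"
  \<comment> \<open>The projection coefficient that makes \<zeta> below orthogonal to H. Then
    \<zeta> is a permitted choice in \<open>free\<close>, and the integral of its square is
    0.\<close>
  define k where "k = - B / A"
  have iA: "(\<lambda>x. (J x * H x) * (J x * H x)) integrable_on {0..1}"
    by (rule L2_mult_integrable[OF JL(2) JL(2)]) auto
  have iB: "(\<lambda>x. (J x * g x) * (J x * H x)) integrable_on {0..1}"
    by (rule L2_mult_integrable[OF JL(1) JL(2)]) auto
  have "A > 0"
  proof -
    have "integral {1/4..1/2} (\<lambda>x::real. 1 / 16) \<le> integral {1/4..1/2} (\<lambda>x. (J x * H x) * (J x * H x))"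
    proof (rule Henstock_Kurzweil_Integration.integral_le)
      show "(\<lambda>x. (J x * H x) * (J x * H x)) integrable_on {1/4..1/2}"
        by (rule L2_mult_integrable[OF JL(2) JL(2)]) auto
      fix x :: real assume x: "x \<in> {1/4..1/2}"
      then have "1/4 \<le> H x" using Hge[of x] by auto
      then have "1/4 * (1/4) \<le> H x * H x" by (intro mult_mono) auto
      then show "1 / 16 \<le> (J x * H x) * (J x * H x)" using x by (simp add: J_def)
    qed auto
    also have "\<dots> \<le> A"
      unfolding A_def by (intro integral_subset_le iA L2_mult_integrable[OF JL(2) JL(2)]) auto
    finally show ?thesis by simp
  qed
  define \<zeta> where "\<zeta> x = J x * g x + k * (J x * H x)" for x
  have \<zeta>L: "\<zeta> \<in> L2"
    unfolding \<zeta>_def using L2_lincomb[OF JL, of 1 k] by simp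
  have H\<zeta>: "integral {0..1} (\<lambda>x. H x * \<zeta> x) = 0"
  proof -
    have "(\<lambda>x. H x * \<zeta> x) = (\<lambda>x. (J x * g x) * (J x * H x) + k * ((J x * H x) * (J x * H x)))"
    proof
      fix x
      have "(J x * g x) * (J x * H x) + k * ((J x * H x) * (J x * H x)) = (J x * J x) * (g x * H x + k * H x * H x)"
        by (simp add: algebra_simps)
      then show "H x * \<zeta> x = (J x * g x) * (J x * H x) + k * ((J x * H x) * (J x * H x))"
        unfolding JJ by (simp add: \<zeta>_def algebra_simps)
    qed
    then have "integral {0..1} (\<lambda>x. H x * \<zeta> x) = B + k * A"
      using iA iB by (simp add: Henstock_Kurzweil_Integration.integral_add integrable_on_mult_right A_def B_def)
    then show ?thesis using \<open>A > 0\<close> by (simp add: k_def)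
  qed
  have g\<zeta>: "integral {0..1} (\<lambda>x. g x * \<zeta> x) = 0"
    by (rule free[OF \<zeta>L _ H\<zeta>]) (simp add: \<zeta>_def J_def)
  have "(\<lambda>x. (\<zeta> x)\<^sup>2) = (\<lambda>x. g x * \<zeta> x + k * (H x * \<zeta> x))"
  proof
    fix x
    show "(\<zeta> x)\<^sup>2 = g x * \<zeta> x + k * (H x * \<zeta> x)"
      by (cases "x \<in> {0..1/2}") (auto simp: \<zeta>_def J_def power2_eq_square algebra_simps)
  qed
  then have "integral {0..1} (\<lambda>x. (\<zeta> x)\<^sup>2) = 0"
    using L2_mult_integrable[OF gL \<zeta>L, of 0 1] L2_mult_integrable[OF HL \<zeta>L, of 0 1] g\<zeta> H\<zeta>
    by (simp add: Henstock_Kurzweil_Integration.integral_add integrable_on_mult_right)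
  then have "norm_L2 \<zeta> = 0" by (simp add: norm_L2_def LINT_square[OF \<zeta>L])
  then have "AE x in M01. \<zeta> x = 0" by (simp add: norm_L2_eq_0[OF \<zeta>L])
  then have ae: "AE x in M01. J x * g x = - k * (J x * H x)"
    by eventually_elim (simp add: \<zeta>_def)
  have Hc: "continuous_on {0..1/2} H"
    using H1_continuous[OF HH] by (rule continuous_on_subset) auto
  define W where "W x = G (p 0) - k * integral {0..x} H" for x
  have GW: "G (p x) = W x" if x: "x \<in> {0..1/2}" for x
  proof -
    have "integral {0..x} g = integral {0..x} (\<lambda>x. J x * g x)"
      by (rule Henstock_Kurzweil_Integration.integral_cong) (use x in \<open>auto simp: J_def\<close>)
    also have "\<dots> = integral {0..x} (\<lambda>x. - k * (J x * H x))"
      by (rule integral_cong_AE_M01[OF ae]) (use x in auto)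
    also have "\<dots> = integral {0..x} (\<lambda>x. - k * H x)"
      by (rule Henstock_Kurzweil_Integration.integral_cong) (use x in \<open>auto simp: J_def\<close>)
    finally have "integral {0..x} g = - k * integral {0..x} H" by simp
    then show ?thesis
      using H1_increment[OF G_slope_H1, of 0 x w] x by (simp add: W_def p_def g_def)
  qed
  have Dp: "(p has_real_derivative - (k * H x * weight (p x))) (at x within {0..1/2})" if x: "x \<in> {0..1/2}" for x
  proof -
    have "((\<lambda>x. integral {0..x} H) has_real_derivative H x) (at x within {0..1/2})"
      using integral_has_vector_derivative[OF Hc x] by (simp add: has_real_derivative_iff_has_vector_derivative)
    then have "(W has_real_derivative - (k * H x)) (at x within {0..1/2})"
      unfolding W_def by (auto intro!: derivative_eq_intros)
    moreover have "(inv G has_real_derivative weight (p x)) (at (W x))"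
      using DERIV_inv_G[of "p x"] GW[OF x] by simp
    ultimately have "((\<lambda>x. inv G (W x)) has_real_derivative weight (p x) * - (k * H x)) (at x within {0..1/2})"
      by (rule DERIV_chain2[rotated])
    then have "(p has_real_derivative weight (p x) * - (k * H x)) (at x within {0..1/2})"
      by (rule has_field_derivative_transform_within[of _ _ _ _ 1])
        (use x GW in \<open>auto simp: GW[symmetric]\<close>)
    then show ?thesis by (simp add: mult.commute)
  qed
  have DH: "(H has_real_derivative weight (p x)) (at x within {0..1/2})" if x: "x \<in> {0..1/2}" for x
  proof -
    have "((\<lambda>x. integral {0..x} (\<lambda>t. weight (p t))) has_real_derivative weight (p x)) (at x within {0..1})"
      using integral_has_vector_derivative[OF hc, of x] x by (simp add: has_real_derivative_iff_has_vector_derivative)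
    then have "(H has_real_derivative weight (p x)) (at x within {0..1})"
      by (simp add: H_def[abs_def])
    then show ?thesis by (rule has_field_derivative_subset) auto
  qed
  have Df: "(f has_real_derivative p x) (at x within {0..1/2})" if x: "x \<in> {0..1/2}" for x
  proof -
    have "((\<lambda>x. integral {0..x} p) has_real_derivative p x) (at x within {0..1})"
      using integral_has_vector_derivative[OF pc, of x] x by (simp add: has_real_derivative_iff_has_vector_derivative)
    then have "(f has_real_derivative p x) (at x within {0..1})"
      by (rule has_field_derivative_transform_within[of _ _ _ _ 1])
        (use x in \<open>auto simp: f_def p_def fn_eq\<close>)
    then show ?thesis by (rule has_field_derivative_subset) auto
  qed
  \<comment> \<open>G of the slope falls from a positive value at 0 to 0 at 1/2, at rate k * H with
    H nonnegative.\<close>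
  have "0 < k"
  proof -
    have "k * integral {0..1/2} H = G (p 0)"
      using GW[of "1/2"] p_half by (simp add: W_def)
    then have "0 < k * integral {0..1/2} H" using G_less_iff[of 0 "p 0"] p0 by simp
    moreover have "0 \<le> integral {0..1/2} H"
    proof (intro Henstock_Kurzweil_Integration.integral_nonneg L2_integrable[OF HL])
      show "0 \<le> H x" if "x \<in> {0..1/2}" for x
        using Hge[of x] that by auto
    qed auto
    ultimately show ?thesis by (simp add: zero_less_mult_iff)
  qed
  have "elastica h k f p H"
    unfolding elastica_def
  proof (intro conjI ballI)
    fix x :: real assume x: "x \<in> {0..1/2}"
    show "0 \<le> p x" "p x \<le> p 0" using p[of x "1/2"] p[of 0 x] p_half x by auto
    show "0 \<le> H x" using Hge[of x] x by auto
  qed (use \<open>0 < k\<close> p0 f0 contact p_half Df DH Dp in \<open>auto simp: H_def\<close>)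
  then show thesis
    using that by (simp add: f_def p_def h_def)
qed

theorem theorem2p9:
  fixes \<psi> :: "real \<Rightarrow> real" and u\<^sub>0 :: sobolev
  assumes "obstacle \<psi>"
    and "symmetric \<psi>"
    and "radially_decreasing \<psi>"
    and "u\<^sub>0 \<in> admissible \<psi>"
    and "elastic_energy u\<^sub>0 \<le> (G 2)\<^sup>2"
  shows "\<exists>u. minimizer \<psi> u \<and> symmetric (fn u) \<and>
    (symmetric_cone \<psi> \<longrightarrow>
      critical_point \<psi> u \<and>
      (\<forall>w. critical_point \<psi> w \<and> symmetric (fn w) \<longrightarrow> w = u))"
proof -
  have \<psi>: "continuous_on {0..1} \<psi>" "\<psi> 0 < 0" using assms(1) by (auto simp: obstacle_def)
  obtain u where u: "minimizer \<psi> u" "symmetric (fn u)"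
    using symmetric_minimizer_exists[OF \<psi>(1) assms(2,4,5)] .
  note crit = minimizer_imp_critical_point[OF u(1)]
  have "w = u" if cone: "symmetric_cone \<psi>" and w: "critical_point \<psi> w" "symmetric (fn w)" for w
  proof -
    obtain a b where ab: "\<And>x. x \<in> {0..1/2} \<Longrightarrow> \<psi> x = a * x + b"
      using cone by (auto simp: symmetric_cone_def)
    have b: "\<psi> 0 = b" "\<psi> (1/2) = a / 2 + b" using ab[of 0] ab[of "1/2"] by auto
    have cone': "\<psi> x = (1 - 2 * x) * \<psi> 0 + 2 * x * \<psi> (1/2)" if "x \<in> {0..1/2}" for x
      unfolding b ab[OF that] by (simp add: algebra_simps)
    obtain x where x: "x \<in> {0<..<1}" "0 < \<psi> x"
      using assms(1) by (auto simp: obstacle_def)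
    obtain y where y: "y \<in> {0..1/2}" "0 < \<psi> y"
    proof (cases "x \<le> 1/2")
      case True
      then show thesis using x by (intro that[of x]) auto
    next
      case False
      moreover have "\<psi> (1 - x) = \<psi> x" using x by (intro symmetricD[OF assms(2)]) auto
      ultimately show thesis using x by (intro that[of "1 - x"]) auto
    qed
    \<comment> \<open>On the left half \<psi> is a convex combination of its negative value at 0 and
      its value at the tip, and by symmetry it is positive somewhere there.\<close>
    have top: "0 < \<psi> (1/2)"
    proof (rule ccontr)
      assume "\<not> 0 < \<psi> (1/2)"
      then have "(1 - 2 * y) * \<psi> 0 + 2 * y * \<psi> (1/2) \<le> 0"
        using y(1) \<psi>(2) by (intro add_nonpos_nonpos mult_nonneg_nonpos) auto
      then show False using y cone'[OF y(1)] by simp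
    qed
    obtain k H where e1: "elastica (\<psi> (1/2)) k (fn w) (slope w) H"
      by (rule symmetric_critical_point_elastica[OF \<psi>(1) assms(2) \<psi>(2) top cone' w])
    obtain k' H' where e2: "elastica (\<psi> (1/2)) k' (fn u) (slope u) H'"
      by (rule symmetric_critical_point_elastica[OF \<psi>(1) assms(2) \<psi>(2) top cone' crit u(2)])
    have half: "fn w x = fn u x" if x: "x \<in> {0..1/2}" for x
    proof -
      have "integral {0..x} (slope w) = integral {0..x} (slope u)"
        by (rule Henstock_Kurzweil_Integration.integral_cong) (use x elastica_unique[OF top e1 e2] in auto)
      then show ?thesis using fn_eq[of x w] fn_eq[of x u] x by simp
    qed
    have "fn w x = fn u x" for x
    proof -
      consider "x \<in> {0..1/2}" | "1 - x \<in> {0..1/2}" "x \<in> {0..1}" | "x \<notin> {0..1}" by force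
      then show ?thesis
      proof cases
        case 2
        then show ?thesis
          using half[of "1 - x"] symmetricD[OF w(2), of x] symmetricD[OF u(2), of x] by simp
      qed (use half fn_outside[of x] in auto)
    qed
    then show ?thesis by (simp add: fn_inject[symmetric] fun_eq_iff)
  qed
  then show ?thesis using u crit by blast
qed

end
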